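(* For any $\epsilon > 0$ there exists $d_0 \in \mathbb{N}$ such that if $d \geq d_0$ then $\big[ d^{-1} + (\tfrac{7}{6} + \epsilon) d^{-2}, \infty\big) \subseteq \mathscr{T}^{\mathcal{T}_{d}}$.
   Context: $\mathcal{T}_d$ denotes the rooted regular tree each of whose vertices has exactly $d$ offspring (neighbours farther from the root). For a graph $G$, $\mathscr{T}^G$ denotes the set of $T>0$ such that the random stirring model on $G$ with parameter $T$ has infinite cycles (cycles with infinitely many elements) almost surely. The random stirring model with parameter $T$ is the random permutation $\sigma_T$ of $V(G)$, where $(\sigma_t)_{t\ge0}$ starts at the identity and, independently for each edge $e$, the transposition of the endpoints of $e$ is composed at each point of a rate-one Poisson process on $[0,\infty)$. *)

theory Defs
  imports "HOL-Probability.Probability"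
begin

text \<open>The rooted d-ary tree: vertices are finite lists of offspring indices below d;
  the root is the empty list, the children of v are the lists i # v with i < d.
  Every non-root vertex c is joined to its parent tl c; we index that edge by c.\<close>

definition tree_vertex :: "nat \<Rightarrow> nat list \<Rightarrow> bool" where
  "tree_vertex d v \<longleftrightarrow> (\<forall>i\<in>set v. i < d)"

definition tree_edge :: "nat \<Rightarrow> nat list \<Rightarrow> nat list \<Rightarrow> nat list \<Rightarrow> bool" where
  "tree_edge d u w c \<longleftrightarrow> tree_vertex d c \<and> c \<noteq> [] \<and>
     ((u = c \<and> w = tl c) \<or> (w = c \<and> u = tl c))"

text \<open>Randomness: i.i.d. Exp(1) variables omega (c,k); the rate-one Poisson process of the
  edge indexed by c has points (arrival times) sum_{k \<le> n} omega (c,k), n = 0,1,2,...\<close>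
definition stir_space :: "(nat list \<times> nat \<Rightarrow> real) measure" where
  "stir_space = (\<Pi>\<^sub>M _\<in>(UNIV :: (nat list \<times> nat) set). density lborel (exponential_density 1))"

definition rings :: "nat \<Rightarrow> (nat list \<times> nat \<Rightarrow> real) \<Rightarrow> nat list \<Rightarrow> nat list \<Rightarrow> real \<Rightarrow> bool" where
  "rings d \<omega> u w t \<longleftrightarrow> (\<exists>c. tree_edge d u w c \<and> (\<exists>n. t = (\<Sum>k\<le>n. \<omega> (c, k))))"

definition stir_path :: "nat \<Rightarrow> (nat list \<times> nat \<Rightarrow> real) \<Rightarrow> real \<Rightarrow> nat list \<Rightarrow> nat list \<Rightarrow> bool" where
  "stir_path d \<omega> T x y \<longleftrightarrow> tree_vertex d x \<and>
     (\<exists>(k::nat) (vs :: nat \<Rightarrow> nat list) (ts :: nat \<Rightarrow> real).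
        vs 0 = x \<and> vs k = y \<and> ts 0 = 0 \<and> ts k \<le> T \<and>
        (\<forall>i<k. ts i < ts (Suc i) \<and> rings d \<omega> (vs i) (vs (Suc i)) (ts (Suc i)) \<and>
               (\<forall>s w. ts i < s \<and> s < ts (Suc i) \<longrightarrow> \<not> rings d \<omega> (vs i) w s)) \<and>
        (\<forall>s w. ts k < s \<and> s \<le> T \<longrightarrow> \<not> rings d \<omega> (vs k) w s))"

definition stir_perm :: "nat \<Rightarrow> (nat list \<times> nat \<Rightarrow> real) \<Rightarrow> real \<Rightarrow> nat list \<Rightarrow> nat list" where
  "stir_perm d \<omega> T x = (THE y. stir_path d \<omega> T x y)"

definition has_infinite_cycle :: "nat \<Rightarrow> (nat list \<times> nat \<Rightarrow> real) \<Rightarrow> real \<Rightarrow> bool" where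
  "has_infinite_cycle d \<omega> T \<longleftrightarrow>
     (\<exists>x. tree_vertex d x \<and> infinite (range (\<lambda>n. (stir_perm d \<omega> T ^^ n) x)))"

definition inf_cycle_params :: "nat \<Rightarrow> real set" where
  "inf_cycle_params d = {T. T > 0 \<and> (AE \<omega> in stir_space. has_infinite_cycle d \<omega> T)}"

end

theory Submission
  imports Defs
begin

text \<open>
  Time [0, T] is cut into K slots and the law is studied for the field of bits ``edge c rings in slot j'',
  which are independent with probability 1 - exp (-T/K). The cycle through a vertex is followed as a
  walk on vertices and slots, slots being read cyclically. Let q n be the supremum of the probability
  that the walk, having just entered a vertex, leaves it again towards the parent before reaching
  depth n below. A bound below 1 on q n, uniform in n and in large K, makes the cycle of a vertex
  infinite with positive probability, and disjoint subtrees hanging off a ray provide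
  independent trials.

  If T sqrt d \<le> 1, a child whose edge carries a single bar, at a time not straddled by bars of any
  other child, must be visited. In the limit of large K the mean number of such children is at least
  d T exp (-T) (1 - (d-1) T^2/6), which exceeds 1 in the range of the theorem (this is where
  7/6 = 1 + 1/6 comes from), and comparison with a branching process bounds q n away from 1.
  If T sqrt d \<ge> 1, the walk most likely enters a fresh child very soon, and if it comes back
  from there it most likely enters a second fresh child very soon after; so q (n+1) is at most
  small + small q n + (1 + small) (q n)^2, which keeps q n below 1/4.
\<close>

section \<open>The walk read through time slots\<close>

text \<open>Origin of 7/6: the edge of a child carries exactly one bar with probability T exp (-T),
  so near T = 1/d the demand of a single bar lowers the mean by about 1/d. A bar at relative height
  y of the cycle is straddled by a given other child with probability about T^2 y (1 - y); averaged
  over y this is T^2/6, and about d such children lower the mean by another 1/(6d). Origin of the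
  split at T sqrt d = 1: the factor 1 - (d-1) T^2/6 is useless once d T^2 passes 6. A time window of
  length 1/(4 sqrt d), however, holds about sqrt d / 4 fresh bars at a vertex, while a given edge is
  unlikely to ring in it; two such windows fit into the cycle as soon as T is at least 1/sqrt d. The
  obstacle is dependence: time is cyclic, so the walk reads the same bars again, and an excursion
  may end in any bar of the edge through which it began. Therefore \<open>returns\<close> takes the
  stopping slots \<open>P\<close> as an argument: the edge above a vertex enters only through
  \<open>P\<close>, and what lies below is an independent field.\<close>

definition bars :: "nat \<Rightarrow> (nat list \<times> nat \<Rightarrow> bool) \<Rightarrow> nat list \<Rightarrow> nat set" where
  "bars K \<eta> c = {i. i < K \<and> \<eta> (c, i)}"

text \<open>Reading slots cyclically, from the one after j on, the first slot met in P is i; the relation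
  \<^term>\<open>\<phi> s s'\<close> says that a walk meeting slot s outside P reads on behind slot s'.\<close>
inductive scan :: "nat \<Rightarrow> (nat \<Rightarrow> nat \<Rightarrow> bool) \<Rightarrow> nat set \<Rightarrow> nat \<Rightarrow> nat \<Rightarrow> bool" for K \<phi> P where
  stop: "Suc j mod K \<in> P \<Longrightarrow> scan K \<phi> P j (Suc j mod K)"
| step: "Suc j mod K \<notin> P \<Longrightarrow> \<phi> (Suc j mod K) j' \<Longrightarrow> scan K \<phi> P j' i \<Longrightarrow> scan K \<phi> P j i"

definition hop :: "nat \<Rightarrow> (nat list \<times> nat \<Rightarrow> bool) \<Rightarrow> (nat list \<Rightarrow> nat \<Rightarrow> nat \<Rightarrow> bool)
    \<Rightarrow> nat list \<Rightarrow> nat \<Rightarrow> nat \<Rightarrow> bool" where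
  "hop d \<eta> R v s s' \<longleftrightarrow> (s = s' \<and> (\<forall>c<d. \<not> \<eta> (c # v, s))) \<or>
     (\<exists>c<d. \<eta> (c # v, s) \<and> (\<forall>c'<d. \<eta> (c' # v, s) \<longrightarrow> c' = c) \<and> R (c # v) s s')"

text \<open>With bars \<^term>\<open>\<eta>\<close>, the walk that arrived at v in slot j stays less than n levels below v until it
  meets, at v, the set P of slots, and this first happens in slot i. Bars towards two children in
  one slot block the walk; they are absent from the configurations met later, and
  blocking can only help when returns are bounded from above.\<close>
primrec returns :: "nat \<Rightarrow> nat \<Rightarrow> (nat list \<times> nat \<Rightarrow> bool) \<Rightarrow> nat \<Rightarrow> nat list \<Rightarrow> nat set \<Rightarrow> nat \<Rightarrow> nat \<Rightarrow> bool" where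
  "returns d K \<eta> 0 v P j i = False"
| "returns d K \<eta> (Suc n) v P j i =
     scan K (hop d \<eta> (\<lambda>c. returns d K \<eta> n c (bars K \<eta> c)) v) P j i"

lemma scan_mem: "scan K \<phi> P j i \<Longrightarrow> i \<in> P"
  by (induction rule: scan.induct) auto

lemma scan_det:
  assumes "scan K \<phi> P j i" "scan K \<phi> P j i'" "\<And>s a b. \<phi> s a \<Longrightarrow> \<phi> s b \<Longrightarrow> a = b"
  shows "i = i'"
  using assms(1,2)
proof (induction arbitrary: i')
  case (stop j) from stop.prems show ?case by (cases rule: scan.cases) (use stop.hyps in auto)
next
  case (step j j' i)
  from step.prems show ?case
  proof (cases rule: scan.cases)
    case stop then show ?thesis using step.hyps by auto
  next
    case (step j2) then show ?thesis using step.hyps step.IH assms(3) by blast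
  qed
qed

lemma scan_more_stops: "scan K \<phi> P j i \<Longrightarrow> P \<subseteq> P' \<Longrightarrow> \<exists>i'. scan K \<phi> P' j i'"
proof (induction rule: scan.induct)
  case (stop j) then show ?case using scan.stop by blast
next
  case (step j j' i) then show ?case using scan.stop scan.step by metis
qed

text \<open>A scan ends at the first stop it meets, so no other stop lies in the part that was read.
  This is what later allows a bar at which an excursion does not end to be deleted.\<close>

lemma scan_unused_stop: "scan K \<phi> P j i \<Longrightarrow> y \<noteq> i \<Longrightarrow> scan K \<phi> (P - {y}) j i"
  by (induction rule: scan.induct) (auto intro: scan.intros)

lemma returns_mem: "returns d K \<eta> n v P j i \<Longrightarrow> i \<in> P"
  by (cases n) (auto dest: scan_mem)

lemma hop_det:
  assumes "\<And>c s a b. R c s a \<Longrightarrow> R c s b \<Longrightarrow> a = b" "hop d \<eta> R v s a" "hop d \<eta> R v s b"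
  shows "a = b"
  using assms(2,3) unfolding hop_def by (metis assms(1))

lemma returns_det: "returns d K \<eta> n v P j i \<Longrightarrow> returns d K \<eta> n v P j i' \<Longrightarrow> i = i'"
proof (induction n arbitrary: v P j i i')
  case (Suc n)
  show ?case
    by (rule scan_det[OF Suc.prems[unfolded returns.simps]]) (erule (1) hop_det[rotated], rule Suc.IH)
qed simp

lemma returns_more_stops: "returns d K \<eta> n v P j i \<Longrightarrow> P \<subseteq> P' \<Longrightarrow> \<exists>i'. returns d K \<eta> n v P' j i'"
  by (cases n) (auto dest: scan_more_stops)

lemma returns_unused_stop: "returns d K \<eta> n v P j i \<Longrightarrow> y \<noteq> i \<Longrightarrow> returns d K \<eta> n v (P - {y}) j i"
  by (cases n) (auto dest: scan_unused_stop)

text \<open>The edge from \<open>v\<close> to its parent is left out on purpose: its bars act on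
  \<open>returns\<close> through \<open>P\<close> alone, which makes an excursion below
  \<open>v\<close> independent of the edge by which \<open>v\<close> is entered.\<close>

definition below :: "nat \<Rightarrow> nat \<Rightarrow> nat \<Rightarrow> nat list \<Rightarrow> (nat list \<times> nat) set" where
  "below d K n v = {(w @ v, i) | w i. w \<noteq> [] \<and> length w \<le> n \<and> (\<forall>x\<in>set w. x < d) \<and> i < K}"

lemma below_child: "c < d \<Longrightarrow> below d K n (c # v) \<subseteq> below d K (Suc n) v"
proof
  fix x assume c: "c < d" and "x \<in> below d K n (c # v)"
  then obtain w i where w: "x = (w @ c # v, i)" "w \<noteq> []" "length w \<le> n" "\<forall>x\<in>set w. x < d" "i < K"
    by (auto simp: below_def)
  have "x = ((w @ [c]) @ v, i)" "w @ [c] \<noteq> []" "length (w @ [c]) \<le> Suc n" "\<forall>x\<in>set (w @ [c]). x < d"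
    using w c by auto
  then show "x \<in> below d K (Suc n) v" using w(5) unfolding below_def by blast
qed

lemma below_child_edge: "c < d \<Longrightarrow> i < K \<Longrightarrow> (c # v, i) \<in> below d K (Suc n) v"
  unfolding below_def by (rule CollectI, rule exI[of _ "[c]"]) auto

lemma scan_local:
  assumes "scan K \<phi> P j i" "K > 0" "\<And>s a. s < K \<Longrightarrow> \<phi> s a \<Longrightarrow> \<psi> s a"
  shows "scan K \<psi> P j i"
  using assms(1)
proof (induction rule: scan.induct)
  case (step j j' i)
  then show ?case using assms(2,3) by (intro scan.step[of j K P \<psi> j']) auto
qed (auto intro: scan.intros)

lemma returns_local:
  assumes "returns d K \<eta> n v P j i" "K > 0" "\<And>x. x \<in> below d K n v \<Longrightarrow> \<eta> x = \<eta>' x"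
  shows "returns d K \<eta>' n v P j i"
  using assms(1,3)
proof (induction n arbitrary: v P j i)
  case (Suc n)
  show ?case unfolding returns.simps
  proof (rule scan_local[OF Suc.prems(1)[unfolded returns.simps] assms(2)])
    fix s a assume s: "s < K" and h: "hop d \<eta> (\<lambda>c. returns d K \<eta> n c (bars K \<eta> c)) v s a"
    have e: "\<eta> (c # v, i) = \<eta>' (c # v, i)" if "c < d" "i < K" for c i
      using Suc.prems(2) below_child_edge that by blast
    have b: "bars K \<eta> (c # v) = bars K \<eta>' (c # v)" if "c < d" for c
      using e[OF that] by (auto simp: bars_def)
    have r: "returns d K \<eta>' n (c # v) (bars K \<eta>' (c # v)) s a"
      if "c < d" "returns d K \<eta> n (c # v) (bars K \<eta> (c # v)) s a" for c
      using Suc.IH[of "c # v" "bars K \<eta> (c # v)" s a] that b[OF that(1)] Suc.prems(2) below_child[OF that(1)]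
      by (metis subsetD)
    show "hop d \<eta>' (\<lambda>c. returns d K \<eta>' n c (bars K \<eta>' c)) v s a"
      using h unfolding hop_def using e[OF _ s] r by metis
  qed
qed simp

lemma returns_cong:
  assumes "K > 0" "\<And>x. x \<in> below d K n v \<Longrightarrow> \<eta> x = \<eta>' x"
  shows "returns d K \<eta> n v P j i = returns d K \<eta>' n v P j i"
  using returns_local[OF _ assms(1)] assms(2) by metis

text \<open>The scan proceeds slot by slot until it meets a stop or a bar of a child, so the three
  cases exhaust what can happen in a window of \<open>w\<close> slots. In the last case the walk
  after the excursion is again a return to \<open>P\<close> with the same depth budget; the lemma
  can then be applied a second time.\<close>

lemma returns_first_event:
  assumes "returns d K \<eta> (Suc n) v P j i"
  obtains (none) "\<forall>x\<in>{1..w}. \<forall>c<d. \<not> \<eta> (c # v, (j + x) mod K)"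
  | (stop) x where "x \<in> {1..w}" "\<forall>y\<in>{1..<x}. \<forall>c<d. \<not> \<eta> (c # v, (j + y) mod K)" "(j + x) mod K \<in> P"
  | (child) x c i' where "x \<in> {1..w}" "\<forall>y\<in>{1..<x}. \<forall>c<d. \<not> \<eta> (c # v, (j + y) mod K)"
      "c < d" "\<eta> (c # v, (j + x) mod K)"
      "returns d K \<eta> n (c # v) (bars K \<eta> (c # v)) ((j + x) mod K) i'" "returns d K \<eta> (Suc n) v P i' i"
proof -
  let ?o = "\<lambda>x. (j + x) mod K"
  let ?free = "\<lambda>x. \<forall>c<d. \<not> \<eta> (c # v, ?o x)"
  let ?\<phi> = "hop d \<eta> (\<lambda>c. returns d K \<eta> n c (bars K \<eta> c)) v"
  let ?event = "\<lambda>x. ?o x \<in> P \<or> (\<exists>c i'. c < d \<and> \<eta> (c # v, ?o x) \<and>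
    returns d K \<eta> n (c # v) (bars K \<eta> (c # v)) (?o x) i' \<and> scan K ?\<phi> P i' i)"
  \<comment> \<open>Either nothing has happened so far and the scan is still running, or an event
    lies in the window. The running position is known modulo \<open>K\<close> only, because the
    initial \<open>j\<close> need not be below \<open>K\<close>.\<close>
  have "((\<forall>x\<in>{1..w}. ?free x) \<and> (\<exists>j'. j' mod K = ?o w \<and> scan K ?\<phi> P j' i)) \<or>
    (\<exists>x\<in>{1..w}. (\<forall>y\<in>{1..<x}. ?free y) \<and> ?event x)" (is "?A w \<or> ?B w")
  proof (induction w)
    case 0 then show ?case using assms by auto
  next
    case (Suc w)
    then show ?case
    proof
      assume "?B w"
      then show ?thesis by (intro disjI2) (elim bexE, rule bexI, auto)
    next
      assume "?A w"
      then obtain j' where free: "\<forall>x\<in>{1..w}. ?free x" and j': "j' mod K = ?o w" "scan K ?\<phi> P j' i" by blast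
      have eq: "Suc j' mod K = ?o (Suc w)" using j'(1) by (metis add_Suc_right mod_Suc_eq)
      have B: "?B (Suc w)" if "?event (Suc w)"
        using free that by (intro bexI[of _ "Suc w"]) auto
      from j'(2) show ?thesis
      proof (cases rule: scan.cases)
        case stop
        then show ?thesis using B eq by auto
      next
        case (step j2)
        from step(2)[unfolded hop_def eq] show ?thesis
        proof (elim disjE exE conjE)
          assume h: "?o (Suc w) = j2" "?free (Suc w)"
          have "\<forall>x\<in>insert (Suc w) {1..w}. ?free x" using free h(2) by blast
          then have "\<forall>x\<in>{1..Suc w}. ?free x" by (simp only: atLeastAtMostSuc_conv le_add1 plus_1_eq_Suc)
          moreover have "j2 mod K = ?o (Suc w)" using h(1) by auto
          ultimately show ?thesis using step(3) by blast
        next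
          fix c assume "c < d" "\<eta> (c # v, ?o (Suc w))" "returns d K \<eta> n (c # v) (bars K \<eta> (c # v)) (?o (Suc w)) j2"
          then have "?event (Suc w)" using step(3) by blast
          then show ?thesis using B by blast
        qed
      qed
    qed
  qed
  then show thesis
  proof (elim disjE bexE conjE exE)
    assume "\<forall>x\<in>{1..w}. ?free x" then show thesis by (rule none)
  next
    fix x assume "x \<in> {1..w}" "\<forall>y\<in>{1..<x}. ?free y" "?o x \<in> P" then show thesis by (rule stop)
  next
    fix x c i' assume h: "x \<in> {1..w}" "\<forall>y\<in>{1..<x}. ?free y" "c < d" "\<eta> (c # v, ?o x)"
      "returns d K \<eta> n (c # v) (bars K \<eta> (c # v)) (?o x) i'" "scan K ?\<phi> P i' i"
    then show thesis by (intro child[of x c i']) auto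
  qed
qed

text \<open>Seen from \<open>j0\<close>, slots are numbered by offsets 1 to \<open>K\<close>; the
  slot \<open>j0\<close> itself comes last and has offset \<open>K\<close>, not 0.\<close>

lemma ex_offset:
  fixes K j0 s :: nat
  assumes "s < K"
  shows "\<exists>x\<in>{1..K}. (j0 + x) mod K = s"
proof -
  define r where "r = j0 mod K"
  have r: "r < K" using assms by (simp add: r_def)
  have e: "(j0 + x) mod K = (r + x) mod K" for x by (simp add: r_def mod_add_left_eq)
  show ?thesis
  proof (cases "r < s")
    case True
    then have "(r + (s - r)) mod K = s" "s - r \<in> {1..K}" using assms by auto
    then show ?thesis using e by metis
  next
    case False
    then have "(r + (s + K - r)) mod K = s" "s + K - r \<in> {1..K}" using assms r by auto
    then show ?thesis using e by metis
  qed
qed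

lemma offset_inj:
  fixes K j0 x y :: nat
  assumes "(j0 + x) mod K = (j0 + y) mod K" "x \<in> {1..K}" "y \<in> {1..K}"
  shows "x = y"
proof -
  have *: "b = a" if "(j0 + a) mod K = (j0 + b) mod K" "a \<le> b" "b - a < K" for a b
  proof -
    have "K dvd (j0 + b) - (j0 + a)" using that(1,2) by (subst mod_eq_dvd_iff_nat[symmetric]) auto
    then have "K dvd b - a" by simp
    then show ?thesis using that(2,3) by (auto dest: dvd_imp_le)
  qed
  have "x - y < K" "y - x < K" using assms by auto
  then show ?thesis using *[OF assms(1)] *[OF assms(1)[symmetric]] by (metis nat_le_linear)
qed

text \<open>A slot can only be jumped over by an excursion into a child whose edge has bars on both
  sides of that slot.\<close>
lemma returns_visits:
  assumes "returns d K \<eta> (Suc n) v {j0} j0 i" "j0 < K" "c < d"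
    and y: "y \<in> {1..<K}" and bc: "bars K \<eta> (c # v) = {(j0 + y) mod K}"
    and others: "\<And>c'. c' < d \<Longrightarrow> c' \<noteq> c \<Longrightarrow> \<not> \<eta> (c' # v, (j0 + y) mod K) \<and>
       ((\<forall>x\<in>{1..<y}. \<not> \<eta> (c' # v, (j0 + x) mod K)) \<or> (\<forall>x\<in>{y<..K}. \<not> \<eta> (c' # v, (j0 + x) mod K)))"
  shows "returns d K \<eta> n (c # v) {(j0 + y) mod K} ((j0 + y) mod K) ((j0 + y) mod K)"
proof -
  let ?\<phi> = "hop d \<eta> (\<lambda>c. returns d K \<eta> n c (bars K \<eta> c)) v"
  have K: "K > 0" using assms by auto
  have o0: "(j0 + K) mod K = j0" using assms by simp
  \<comment> \<open>Invariant of the scan: the position stays at an offset below \<open>y\<close>.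
    The stop \<open>j0\<close>, at offset \<open>K\<close>, cannot be met before slot
    \<open>y\<close> has been read.\<close>
  have main: "scan K ?\<phi> {j0} j i \<Longrightarrow> \<exists>b<y. j = (j0 + b) mod K \<Longrightarrow> ?thesis" for j
  proof (induction rule: scan.induct)
    case (stop j)
    then obtain b where b: "b < y" "j = (j0 + b) mod K" by blast
    then have "Suc j mod K = (j0 + Suc b) mod K" by (simp add: mod_Suc_eq)
    then have "(j0 + Suc b) mod K = (j0 + K) mod K" using stop o0 by simp
    then have "Suc b = K" using b y by (intro offset_inj[of j0 "Suc b" K K]) auto
    then show ?case using b y by auto
  next
    case (step j j' i)
    then obtain b where b: "b < y" "j = (j0 + b) mod K" by blast
    then have s: "Suc j mod K = (j0 + Suc b) mod K" by (simp add: mod_Suc_eq)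
    have ey: "\<eta> (c # v, (j0 + y) mod K)" using bc by (auto simp: bars_def)
    from step.hyps(2) show ?case unfolding hop_def
    proof (elim disjE exE conjE)
      assume h: "Suc j mod K = j'" "\<forall>c<d. \<not> \<eta> (c # v, Suc j mod K)"
      then have "Suc b \<noteq> y" using ey s assms(3) by metis
      then have "Suc b < y" using b by simp
      then show ?case using step.IH h(1) s by metis
    next
      fix c' assume h: "c' < d" "\<eta> (c' # v, Suc j mod K)"
        "\<forall>c''<d. \<eta> (c'' # v, Suc j mod K) \<longrightarrow> c'' = c'"
        "returns d K \<eta> n (c' # v) (bars K \<eta> (c' # v)) (Suc j mod K) j'"
      show ?case
      proof (cases "c' = c")
        case True
        then have "Suc j mod K \<in> bars K \<eta> (c # v)" using h(2) K by (simp add: bars_def)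
        then have "Suc j mod K = (j0 + y) mod K" using bc by simp
        \<comment> \<open>The only bar of \<open>c\<close> is the only stop of the excursion, which
          therefore ends in the slot in which it began.\<close>
        moreover have "j' = (j0 + y) mod K" using returns_mem[OF h(4)] True bc by simp
        ultimately show ?thesis using h(4) True bc by simp
      next
        case False
        have ne: "Suc b \<noteq> y" using others[OF h(1) False] h(2) s by auto
        then have "Suc b \<in> {1..<y}" using b by auto
        \<comment> \<open>Having been entered before offset \<open>y\<close>, the child
          \<open>c'\<close> has no bar behind \<open>y\<close>. The excursion ends at a bar of
          \<open>c'\<close>, hence again before \<open>y\<close>.\<close>
        then have no: "\<forall>x\<in>{y<..K}. \<not> \<eta> (c' # v, (j0 + x) mod K)"
          using others[OF h(1) False] h(2) s by metis
        have j': "j' < K" "\<eta> (c' # v, j')" using returns_mem[OF h(4)] by (auto simp: bars_def)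
        obtain x where x: "x \<in> {1..K}" "(j0 + x) mod K = j'" using ex_offset[OF j'(1)] by blast
        have "x < y"
        proof (rule ccontr)
          assume "\<not> x < y"
          moreover have "x \<noteq> y" using others[OF h(1) False] j'(2) x(2) by auto
          ultimately have "x \<in> {y<..K}" using x(1) by auto
          then show False using no j'(2) x(2) by auto
        qed
        then show ?thesis using step.IH x(2) by metis
      qed
    qed
  qed
  show ?thesis
    by (rule main[OF assms(1)[unfolded returns.simps]]) (use y assms(2) in \<open>intro exI[of _ 0], auto\<close>)
qed

section \<open>Independent Bernoulli fields\<close>

definition depends :: "(('a \<Rightarrow> 'b) \<Rightarrow> bool) \<Rightarrow> 'a set \<Rightarrow> bool" where
  "depends E A \<longleftrightarrow> (\<forall>\<eta> \<eta>'. (\<forall>x\<in>A. \<eta> x = \<eta>' x) \<longrightarrow> E \<eta> = E \<eta>')"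

lemma dependsI: "(\<And>\<eta> \<eta>'. (\<And>x. x \<in> A \<Longrightarrow> \<eta> x = \<eta>' x) \<Longrightarrow> E \<eta> \<Longrightarrow> E \<eta>') \<Longrightarrow> depends E A"
  unfolding depends_def by metis

lemma dependsD: "depends E A \<Longrightarrow> (\<And>x. x \<in> A \<Longrightarrow> \<eta> x = \<eta>' x) \<Longrightarrow> E \<eta> = E \<eta>'"
  unfolding depends_def by metis

lemma depends_mono: "depends E A \<Longrightarrow> A \<subseteq> B \<Longrightarrow> depends E B"
  unfolding depends_def by blast

lemma depends_coord: "depends (\<lambda>\<eta>. \<eta> x) {x}"
  by (auto intro: dependsI)

lemma depends_conj: "depends E A \<Longrightarrow> depends F B \<Longrightarrow> depends (\<lambda>\<eta>. E \<eta> \<and> F \<eta>) (A \<union> B)"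
  unfolding depends_def by (metis UnCI)

lemma depends_not: "depends E A \<Longrightarrow> depends (\<lambda>\<eta>. \<not> E \<eta>) A"
  unfolding depends_def by blast

lemma depends_ball: "(\<And>z. z \<in> Z \<Longrightarrow> depends (E z) (A z)) \<Longrightarrow> depends (\<lambda>\<eta>. \<forall>z\<in>Z. E z \<eta>) (\<Union>z\<in>Z. A z)"
  unfolding depends_def by (metis UN_I)

lemma depends_bex: "(\<And>z. depends (E z) A) \<Longrightarrow> depends (\<lambda>\<eta>. \<exists>z. E z \<eta>) A"
  unfolding depends_def by metis

text \<open>The product splits into the factors over \<open>I \<inter> A\<close> and
  \<open>I - A\<close>. A sample of the first factor, extended by \<open>dflt\<close>, decides
  \<open>E\<close> as the joint sample does, and likewise the second decides \<open>F\<close>. So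
  \<open>A\<close> and \<open>B\<close> may reach outside \<open>I\<close>, where samples are
  constantly \<open>dflt\<close>.\<close>

lemma Pi_pmf_indep:
  assumes I: "finite I" and E: "depends E A" and F: "depends F B" and AB: "A \<inter> B = {}"
  shows "measure_pmf.prob (Pi_pmf I dflt p) {\<eta>. E \<eta> \<and> F \<eta>} =
    measure_pmf.prob (Pi_pmf I dflt p) {\<eta>. E \<eta>} * measure_pmf.prob (Pi_pmf I dflt p) {\<eta>. F \<eta>}"
proof -
  let ?A = "I \<inter> A" and ?B = "I - A"
  let ?m = "\<lambda>(f, g) x. if x \<in> ?A then f x else g x"
  let ?P = "Pi_pmf ?A dflt p" and ?Q = "Pi_pmf ?B dflt p"
  have fin: "finite ?A" "finite ?B" using I by auto
  have split: "Pi_pmf I dflt p = map_pmf ?m (pair_pmf ?P ?Q)"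
    using Pi_pmf_union[of ?A ?B dflt p] fin by (simp add: Int_Diff_Un Int_Diff_disjoint)
  have out: "\<And>x. x \<notin> ?A \<Longrightarrow> f x = dflt" "\<And>x. x \<notin> ?B \<Longrightarrow> g x = dflt"
    if "(f, g) \<in> set_pmf (pair_pmf ?P ?Q)" for f g
    using that set_Pi_pmf_subset[OF fin(1), of dflt p] set_Pi_pmf_subset[OF fin(2), of dflt p] by auto
  have e: "E (?m (f, g)) = E f" "F (?m (f, g)) = F g" if "(f, g) \<in> set_pmf (pair_pmf ?P ?Q)" for f g
  proof -
    show "E (?m (f, g)) = E f" using out[OF that] by (intro dependsD[OF E]) auto
    show "F (?m (f, g)) = F g" using out[OF that] AB by (intro dependsD[OF F]) auto
  qed
  \<comment> \<open>Stated for arbitrary \<open>E'\<close> and \<open>F'\<close>, so that putting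
    the constant \<open>True\<close> for one of them yields the marginals.\<close>
  have *: "measure_pmf.prob (Pi_pmf I dflt p) {\<eta>. E' \<eta> \<and> F' \<eta>} = 
      measure_pmf.prob ?P {f. E' f} * measure_pmf.prob ?Q {g. F' g}"
    if h: "\<And>f g. (f, g) \<in> set_pmf (pair_pmf ?P ?Q) \<Longrightarrow> E' (?m (f, g)) = E' f \<and> F' (?m (f, g)) = F' g" for E' F'
  proof -
    have "measure_pmf.prob (Pi_pmf I dflt p) {\<eta>. E' \<eta> \<and> F' \<eta>} =
        measure_pmf.prob (pair_pmf ?P ?Q) (?m -` {\<eta>. E' \<eta> \<and> F' \<eta>})"
      unfolding split by simp
    also have "\<dots> = measure_pmf.prob (pair_pmf ?P ?Q) ({f. E' f} \<times> {g. F' g})"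
      using h by (intro measure_pmf.finite_measure_eq_AE) (auto simp: AE_measure_pmf_iff)
    also have "\<dots> = measure_pmf.prob ?P {f. E' f} * measure_pmf.prob ?Q {g. F' g}"
      by (subst (1 2 3) measure_Int_set_pmf[symmetric], subst measure_pmf_prob_product[symmetric])
        (auto simp: Times_Int_Times countable_set_pmf intro!: countable_Int2)
    finally show ?thesis .
  qed
  have "measure_pmf.prob (Pi_pmf I dflt p) {\<eta>. E \<eta>} = measure_pmf.prob ?P {f. E f}"
    using *[of E "\<lambda>_. True"] e by simp
  moreover have "measure_pmf.prob (Pi_pmf I dflt p) {\<eta>. F \<eta>} = measure_pmf.prob ?Q {f. F f}"
    using *[of "\<lambda>_. True" F] e by simp
  ultimately show ?thesis using *[of E F] e by simp
qed

locale bernoulli_field =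
  fixes I :: "'a set" and p :: real
  assumes finite_I: "finite I" and p0: "0 \<le> p" and p1: "p < 1"
begin

definition pr :: "(('a \<Rightarrow> bool) \<Rightarrow> bool) \<Rightarrow> real" where
  "pr E = measure_pmf.prob (Pi_pmf I False (\<lambda>_. bernoulli_pmf p)) {\<eta>. E \<eta>}"

lemma pr_nonneg [simp]: "0 \<le> pr E" by (simp add: pr_def)

lemma pr_mono: "(\<And>\<eta>. E \<eta> \<Longrightarrow> F \<eta>) \<Longrightarrow> pr E \<le> pr F"
  unfolding pr_def by (intro measure_pmf.finite_measure_mono) auto

lemma pr_disj: "pr (\<lambda>\<eta>. E \<eta> \<or> F \<eta>) \<le> pr E + pr F"
  unfolding pr_def using measure_Un_le[of "{\<eta>. E \<eta>}" "measure_pmf (Pi_pmf I False (\<lambda>_. bernoulli_pmf p))" "{\<eta>. F \<eta>}"]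
  by (simp add: Un_def)

lemma pr_bex: "finite X \<Longrightarrow> pr (\<lambda>\<eta>. \<exists>x\<in>X. E x \<eta>) \<le> (\<Sum>x\<in>X. pr (E x))"
  unfolding pr_def using measure_pmf.finite_measure_subadditive_finite[of X "\<lambda>x. {\<eta>. E x \<eta>}"]
  by (auto simp: Union_eq Bex_def)

lemma pr_bex_disjoint:
  assumes "finite X" "\<And>x y \<eta>. x \<in> X \<Longrightarrow> y \<in> X \<Longrightarrow> E x \<eta> \<Longrightarrow> E y \<eta> \<Longrightarrow> x = y"
  shows "pr (\<lambda>\<eta>. \<exists>x\<in>X. E x \<eta>) = (\<Sum>x\<in>X. pr (E x))"
proof -
  have "disjoint_family_on (\<lambda>x. {\<eta>. E x \<eta>}) X"
    using assms(2) by (auto simp: disjoint_family_on_def)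
  from measure_pmf.finite_measure_finite_Union[OF assms(1) _ this]
  show ?thesis unfolding pr_def by (auto simp: Union_eq Bex_def)
qed

lemma pr_not: "pr (\<lambda>\<eta>. \<not> E \<eta>) = 1 - pr E"
  unfolding pr_def using measure_pmf.prob_compl[of "{\<eta>. E \<eta>}"]
  by (simp add: Compl_eq_Diff_UNIV[symmetric] Collect_neg_eq)

lemma pr_True [simp]: "pr (\<lambda>_. True) = 1" by (simp add: pr_def)

lemma pr_conj: "depends E A \<Longrightarrow> depends F B \<Longrightarrow> A \<inter> B = {} \<Longrightarrow> pr (\<lambda>\<eta>. E \<eta> \<and> F \<eta>) = pr E * pr F"
  unfolding pr_def by (rule Pi_pmf_indep[OF finite_I])

lemma pr_coord: "x \<in> I \<Longrightarrow> pr (\<lambda>\<eta>. \<eta> x) = p"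
proof -
  assume "x \<in> I"
  then have "map_pmf (\<lambda>f. f x) (Pi_pmf I False (\<lambda>_. bernoulli_pmf p)) = bernoulli_pmf p"
    using Pi_pmf_component[OF finite_I, of x False "\<lambda>_. bernoulli_pmf p"] by simp
  then have "measure_pmf.prob (bernoulli_pmf p) {True} =
      measure_pmf.prob (Pi_pmf I False (\<lambda>_. bernoulli_pmf p)) ((\<lambda>f. f x) -` {True})"
    by (simp flip: measure_map_pmf)
  then have "pr (\<lambda>\<eta>. \<eta> x) = measure_pmf.prob (bernoulli_pmf p) {True}"
    by (simp add: pr_def vimage_def)
  then show ?thesis using p0 p1 by (simp add: measure_pmf_single)
qed

lemma pr_all:
  assumes "finite Z" "\<And>z. z \<in> Z \<Longrightarrow> depends (E z) (A z)" "\<And>y z. y \<in> Z \<Longrightarrow> z \<in> Z \<Longrightarrow> y \<noteq> z \<Longrightarrow> A y \<inter> A z = {}"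
  shows "pr (\<lambda>\<eta>. \<forall>z\<in>Z. E z \<eta>) = (\<Prod>z\<in>Z. pr (E z))"
  using assms
proof (induction Z)
  case (insert x Z)
  have "pr (\<lambda>\<eta>. E x \<eta> \<and> (\<forall>z\<in>Z. E z \<eta>)) = pr (E x) * pr (\<lambda>\<eta>. \<forall>z\<in>Z. E z \<eta>)"
    proof (rule pr_conj[of _ "A x" _ "\<Union>z\<in>Z. A z"])
    show "depends (\<lambda>\<eta>. \<forall>z\<in>Z. E z \<eta>) (\<Union>z\<in>Z. A z)" using insert by (intro depends_ball) auto
    show "A x \<inter> \<Union> (A ` Z) = {}" using insert by fastforce
  qed (use insert in auto)
  then show ?case using insert by simp
qed simp

lemma pr_none:
  assumes "Z \<subseteq> I"
  shows "pr (\<lambda>\<eta>. \<forall>z\<in>Z. \<not> \<eta> z) = (1 - p) ^ card Z"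
proof -
  have f: "finite Z" using assms finite_I finite_subset by blast
  have "pr (\<lambda>\<eta>. \<forall>z\<in>Z. \<not> \<eta> z) = (\<Prod>z\<in>Z. pr (\<lambda>\<eta>. \<not> \<eta> z))"
    by (rule pr_all[where A = "\<lambda>z. {z}"]) (auto simp: f intro: depends_not depends_coord)
  also have "\<dots> = (\<Prod>z\<in>Z. 1 - p)"
    using assms by (intro prod.cong) (auto simp: pr_not pr_coord)
  finally show ?thesis by simp
qed

text \<open>Since the coordinate x is independent of an event that does not look at it, such an event may
  be evaluated as if x were occupied.\<close>
lemma pr_force:
  assumes "x \<in> I"
  shows "pr (\<lambda>\<eta>. \<eta> x \<and> E \<eta>) = p * pr (\<lambda>\<eta>. E (\<eta>(x := True)))"
proof -
  have "pr (\<lambda>\<eta>. \<eta> x \<and> E \<eta>) = pr (\<lambda>\<eta>. \<eta> x \<and> E (\<eta>(x := True)))"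
    unfolding pr_def by (rule arg_cong[where f = "measure_pmf.prob _"]) (auto simp: fun_upd_idem)
  also have "\<dots> = pr (\<lambda>\<eta>. \<eta> x) * pr (\<lambda>\<eta>. E (\<eta>(x := True)))"
  proof (rule pr_conj[OF depends_coord, of _ "- {x}"])
    show "depends (\<lambda>\<eta>. E (\<eta>(x := True))) (- {x})"
      unfolding depends_def
    proof (intro allI impI)
      fix \<eta> \<eta>' :: "'a \<Rightarrow> bool" assume "\<forall>y\<in>- {x}. \<eta> y = \<eta>' y"
      then have "\<eta>(x := True) = \<eta>'(x := True)" by (intro ext) auto
      then show "E (\<eta>(x := True)) = E (\<eta>'(x := True))" by simp
    qed
  qed auto
  finally show ?thesis using pr_coord[OF assms] by simp
qed

end

section \<open>Bernoulli fields on the tree and the recursion for few bars\<close>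

definition idx :: "nat \<Rightarrow> nat \<Rightarrow> nat \<Rightarrow> (nat list \<times> nat) set" where
  "idx d K N = {(w, i). tree_vertex d w \<and> length w \<le> N \<and> i < K}"

lemma finite_idx: "finite (idx d K N)"
proof -
  have "finite ({w. set w \<subseteq> {..<d} \<and> length w \<le> N} \<times> {..<K})"
    by (intro finite_cartesian_product finite_lists_length_le) auto
  moreover have "idx d K N \<subseteq> {w. set w \<subseteq> {..<d} \<and> length w \<le> N} \<times> {..<K}"
    by (auto simp: idx_def tree_vertex_def)
  ultimately show ?thesis by (rule rev_finite_subset)
qed

lemma depends_returns:
  assumes "K > 0"
  shows "depends (\<lambda>\<eta>. returns d K \<eta> n v P j i) (below d K n v)"
  unfolding depends_def using returns_cong[OF assms] by metis

lemma below_disjoint: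
  assumes "length v = length v'" "v \<noteq> v'"
  shows "below d K n v \<inter> below d K n v' = {}"
  using assms by (auto simp: below_def)

lemma below_longer: "(u, i) \<in> below d K n v \<Longrightarrow> length v < length u"
  by (auto simp: below_def)

text \<open>For k at most d the square is at most k d, so the bound becomes linear in k. Then only
  the mean number of forced visits matters, not its distribution.\<close>

lemma power_le_quadratic:
  fixes \<delta> :: real
  assumes "0 \<le> \<delta>" "\<delta> \<le> 1"
  shows "(1 - \<delta>) ^ k \<le> 1 - real k * \<delta> + (real k)\<^sup>2 * \<delta>\<^sup>2"
proof (induction k)
  case (Suc k)
  have "(1 - \<delta>) ^ Suc k \<le> (1 - \<delta>) * (1 - real k * \<delta> + (real k)\<^sup>2 * \<delta>\<^sup>2)"
    using Suc assms by (simp add: mult_left_mono)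
  also have "\<dots> = 1 - real (Suc k) * \<delta> + (real (Suc k))\<^sup>2 * \<delta>\<^sup>2 - (real k + 1) * \<delta>\<^sup>2 - (real k)\<^sup>2 * \<delta> ^ 3"
    by (simp add: algebra_simps power2_eq_square power3_eq_cube)
  also have "\<dots> \<le> 1 - real (Suc k) * \<delta> + (real (Suc k))\<^sup>2 * \<delta>\<^sup>2"
  proof -
    have "0 \<le> (real k + 1) * \<delta>\<^sup>2" "0 \<le> (real k)\<^sup>2 * \<delta> ^ 3" using assms by auto
    then show ?thesis by linarith
  qed
  finally show ?case .
qed simp

locale tree_field =
  fixes d K N :: nat and p :: real
  assumes K: "K > 0" and p0: "0 \<le> p" and p1: "p < 1"
begin

sublocale bernoulli_field "idx d K N" p
  by unfold_locales (auto simp: finite_idx p0 p1)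

text \<open>The factor \<open>p * (1 - p) ^ (K - 1)\<close> is the chance that \<open>c\<close> has
  its single bar in the given slot. Each of the other d - 1 children spoils this with probability at
  most p, for a bar in that very slot, plus \<open>p\<^sup>2\<close> for each of the (y - 1)(K - y)
  pairs of slots on its two sides. The children enter by a union bound.\<close>

lemma pr_visited_ge:
  assumes v: "tree_vertex d v" "Suc (length v) \<le> N" and c: "c < d" and j0: "j0 < K" and y: "y \<in> {1..<K}"
  shows "p * (1 - p) ^ (K - 1) * (1 - (real d - 1) * (p + real (y - 1) * real (K - y) * p\<^sup>2)) \<le>
    pr (\<lambda>\<eta>. bars K \<eta> (c # v) = {(j0 + y) mod K} \<and>
      (\<forall>c'\<in>{..<d} - {c}. \<not> \<eta> (c' # v, (j0 + y) mod K) \<and>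
       ((\<forall>x\<in>{1..<y}. \<not> \<eta> (c' # v, (j0 + x) mod K)) \<or> (\<forall>x\<in>{y<..K}. \<not> \<eta> (c' # v, (j0 + x) mod K)))))"
proof -
  let ?o = "\<lambda>x. (j0 + x) mod K"
  let ?L = "\<lambda>c'. {(c' # v, i) | i. i < K}"
  let ?g = "\<lambda>c' \<eta>. \<not> \<eta> (c' # v, ?o y) \<and>
       ((\<forall>x\<in>{1..<y}. \<not> \<eta> (c' # v, ?o x)) \<or> (\<forall>x\<in>{y<..K}. \<not> \<eta> (c' # v, ?o x)))"
  have inI: "(c' # v, i) \<in> idx d K N" if "c' < d" "i < K" for c' i
    using v that by (auto simp: idx_def tree_vertex_def)
  have oK: "?o x < K" for x using K by simp
  have dg: "depends (?g c') (?L c')" for c'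
    by (rule dependsI) (use oK in auto)
  have db: "depends (\<lambda>\<eta>. bars K \<eta> (c # v) = {?o y}) (?L c)"
    by (rule dependsI) (auto simp: bars_def)
  have "pr (\<lambda>\<eta>. bars K \<eta> (c # v) = {?o y}) =
      pr (\<lambda>\<eta>. \<eta> (c # v, ?o y) \<and> (\<forall>z\<in>?L c - {(c # v, ?o y)}. \<not> \<eta> z))"
    using oK by (intro arg_cong[where f = pr] ext) (auto simp: bars_def)
  also have "\<dots> = p * (1 - p) ^ card (?L c - {(c # v, ?o y)})"
  proof (subst pr_conj[OF depends_coord depends_ball])
    show "depends (\<lambda>\<eta>. \<not> \<eta> z) {z}" for z :: "nat list \<times> nat" by (intro depends_not depends_coord)
    have "?L c - {(c # v, ?o y)} \<subseteq> idx d K N" using inI[OF c] by auto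
    then show "pr (\<lambda>\<eta>. \<eta> (c # v, ?o y)) * pr (\<lambda>\<eta>. \<forall>z\<in>?L c - {(c # v, ?o y)}. \<not> \<eta> z) =
        p * (1 - p) ^ card (?L c - {(c # v, ?o y)})"
      using pr_none pr_coord[OF inI[OF c oK]] by simp
  qed auto
  also have "card (?L c - {(c # v, ?o y)}) = K - 1"
  proof -
    have "?L c = Pair (c # v) ` {..<K}" by auto
    then have "card (?L c) = K" by (simp add: card_image inj_on_def)
    then show ?thesis using oK by (subst card_Diff_singleton) auto
  qed
  finally have b: "pr (\<lambda>\<eta>. bars K \<eta> (c # v) = {?o y}) = p * (1 - p) ^ (K - 1)" .
  have bad: "pr (\<lambda>\<eta>. \<not> ?g c' \<eta>) \<le> p + real (y - 1) * real (K - y) * p\<^sup>2" if c': "c' < d" for c'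
  proof -
    have "pr (\<lambda>\<eta>. \<not> ?g c' \<eta>) \<le> pr (\<lambda>\<eta>. \<eta> (c' # v, ?o y) \<or>
        (\<exists>z\<in>{1..<y} \<times> {y<..K}. \<eta> (c' # v, ?o (fst z)) \<and> \<eta> (c' # v, ?o (snd z))))"
      by (rule pr_mono) auto
    also have "\<dots> \<le> pr (\<lambda>\<eta>. \<eta> (c' # v, ?o y)) +
        pr (\<lambda>\<eta>. \<exists>z\<in>{1..<y} \<times> {y<..K}. \<eta> (c' # v, ?o (fst z)) \<and> \<eta> (c' # v, ?o (snd z)))"
      by (rule pr_disj)
    also have "\<dots> \<le> p + (\<Sum>z\<in>{1..<y} \<times> {y<..K}. pr (\<lambda>\<eta>. \<eta> (c' # v, ?o (fst z)) \<and> \<eta> (c' # v, ?o (snd z))))"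
      using pr_coord[OF inI[OF c' oK]] by (intro add_mono pr_bex) auto
    also have "(\<Sum>z\<in>{1..<y} \<times> {y<..K}. pr (\<lambda>\<eta>. \<eta> (c' # v, ?o (fst z)) \<and> \<eta> (c' # v, ?o (snd z)))) =
        (\<Sum>z\<in>{1..<y} \<times> {y<..K}. p\<^sup>2)"
    proof (intro sum.cong refl)
      fix z assume z: "z \<in> {1..<y} \<times> {y<..K}"
      have "?o (fst z) \<noteq> ?o (snd z)" using offset_inj[of j0 "fst z" K "snd z"] z y by fastforce
      then have "pr (\<lambda>\<eta>. \<eta> (c' # v, ?o (fst z)) \<and> \<eta> (c' # v, ?o (snd z))) =
          pr (\<lambda>\<eta>. \<eta> (c' # v, ?o (fst z))) * pr (\<lambda>\<eta>. \<eta> (c' # v, ?o (snd z)))"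
        by (intro pr_conj[OF depends_coord depends_coord]) auto
      then show "pr (\<lambda>\<eta>. \<eta> (c' # v, ?o (fst z)) \<and> \<eta> (c' # v, ?o (snd z))) = p\<^sup>2"
        using pr_coord[OF inI[OF c' oK]] by (simp add: power2_eq_square)
    qed
    also have "\<dots> = real (y - 1) * real (K - y) * p\<^sup>2" by (simp add: card_cartesian_product)
    finally show ?thesis by simp
  qed
  have "1 - pr (\<lambda>\<eta>. \<forall>c'\<in>{..<d} - {c}. ?g c' \<eta>) = pr (\<lambda>\<eta>. \<exists>c'\<in>{..<d} - {c}. \<not> ?g c' \<eta>)"
    by (subst pr_not[symmetric]) (simp add: Bex_def Ball_def)
  also have "\<dots> \<le> (\<Sum>c'\<in>{..<d} - {c}. pr (\<lambda>\<eta>. \<not> ?g c' \<eta>))" by (rule pr_bex) simp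
  also have "\<dots> \<le> (\<Sum>c'\<in>{..<d} - {c}. p + real (y - 1) * real (K - y) * p\<^sup>2)"
    using bad by (intro sum_mono) auto
  also have "\<dots> = (real d - 1) * (p + real (y - 1) * real (K - y) * p\<^sup>2)"
    using c by (simp add: card_Diff_singleton of_nat_diff)
  finally have g: "1 - (real d - 1) * (p + real (y - 1) * real (K - y) * p\<^sup>2) \<le>
      pr (\<lambda>\<eta>. \<forall>c'\<in>{..<d} - {c}. ?g c' \<eta>)" by linarith
  have "pr (\<lambda>\<eta>. bars K \<eta> (c # v) = {?o y} \<and> (\<forall>c'\<in>{..<d} - {c}. ?g c' \<eta>)) =
      pr (\<lambda>\<eta>. bars K \<eta> (c # v) = {?o y}) * pr (\<lambda>\<eta>. \<forall>c'\<in>{..<d} - {c}. ?g c' \<eta>)"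
    by (rule pr_conj[OF db depends_ball[OF dg]]) auto
  also have "\<dots> \<ge> p * (1 - p) ^ (K - 1) * (1 - (real d - 1) * (p + real (y - 1) * real (K - y) * p\<^sup>2))"
    unfolding b using p0 p1 by (intro mult_left_mono[OF g]) simp
  finally show ?thesis .
qed

text \<open>Given the bars at the children of \<open>v\<close>, a return of the walk forces every
  child whose visit is certain to be left again. These returns are independent, so k of them cost at
  most \<open>(1 - \<delta>) ^ k\<close>, which is at most 1 - (\<delta> - d
  \<open>\<delta>\<^sup>2\<close>) k. Averaging over the bars replaces k by its mean, bounded below
  by the sum on the right.\<close>

lemma returns_step_few_bars:
  assumes v: "tree_vertex d v" "Suc (length v) \<le> N" and j0: "j0 < K"
    and \<delta>: "0 \<le> \<delta>" "\<delta> \<le> 1" "real d * \<delta> \<le> 1"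
    and IH: "\<And>c j. c < d \<Longrightarrow> j < K \<Longrightarrow> pr (\<lambda>\<eta>. returns d K \<eta> n (c # v) {j} j j) \<le> 1 - \<delta>"
  shows "pr (\<lambda>\<eta>. \<exists>i. returns d K \<eta> (Suc n) v {j0} j0 i) \<le> 1 - (\<delta> - real d * \<delta>\<^sup>2) *
    (real d * (\<Sum>y\<in>{1..<K}. p * (1 - p) ^ (K - 1) * (1 - (real d - 1) * (p + real (y - 1) * real (K - y) * p\<^sup>2))))"
proof -
  let ?o = "\<lambda>x. (j0 + x) mod K"
  define L where "L = {(c # v, i) | c i. c < d \<and> i < K}"
  have finL: "finite L"
    by (rule finite_subset[OF _ finite_idx[of d K N]]) (use v in \<open>auto simp: L_def idx_def tree_vertex_def\<close>)
  define vis where "vis \<eta> z \<longleftrightarrow> (case z of (c, y) \<Rightarrow> bars K \<eta> (c # v) = {?o y} \<and>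
      (\<forall>c'\<in>{..<d} - {c}. \<not> \<eta> (c' # v, ?o y) \<and>
       ((\<forall>x\<in>{1..<y}. \<not> \<eta> (c' # v, ?o x)) \<or> (\<forall>x\<in>{y<..K}. \<not> \<eta> (c' # v, ?o x)))))" for \<eta> z
  let ?X = "{..<d} \<times> {1..<K}"
  \<comment> \<open>Conditioning is done by summing over the finitely many values \<open>f\<close>
    of the field on \<open>L\<close>; the forced visits are a function of \<open>f\<close>, and the
    excursions read edges outside \<open>L\<close>.\<close>
  define V where "V f = {z \<in> ?X. vis (\<lambda>x. x \<in> f) z}" for f
  define conf where "conf f \<eta> \<longleftrightarrow> (\<forall>x\<in>L. \<eta> x = (x \<in> f))" for f and \<eta> :: "nat list \<times> nat \<Rightarrow> bool"
  let ?R = "\<lambda>z \<eta>. returns d K \<eta> n (fst z # v) {?o (snd z)} (?o (snd z)) (?o (snd z))"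
  have oK: "?o x < K" for x using K by simp
  have finV: "finite (V f)" for f by (simp add: V_def)
  have visL: "vis \<eta> z = vis \<eta>' z" if eq: "\<And>x. x \<in> L \<Longrightarrow> \<eta> x = \<eta>' x" and zX: "z \<in> ?X" for \<eta> \<eta>' z
  proof -
    obtain c y where z: "z = (c, y)" "c < d" using zX by auto
    have e: "\<eta> (c # v, i) = \<eta>' (c # v, i)" if "c < d" "i < K" for c i
      using that by (intro eq) (auto simp: L_def)
    have "bars K \<eta> (c # v) = bars K \<eta>' (c # v)" using e z by (auto simp: bars_def)
    then show ?thesis using z e oK by (auto simp: vis_def)
  qed
  have confV: "V f = {z \<in> ?X. vis \<eta> z}" if "conf f \<eta>" for f \<eta>
    using that visL[of \<eta> "\<lambda>x. x \<in> f"] by (auto simp: V_def conf_def)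
  have ret: "?R z \<eta>" if "returns d K \<eta> (Suc n) v {j0} j0 i" "vis \<eta> z" "z \<in> ?X" for z \<eta> i
    using that returns_visits[OF that(1) j0, of "fst z" "snd z"] by (auto simp: vis_def split: prod.splits)
  \<comment> \<open>A forced child has only one bar, so it occurs in \<open>V f\<close> with a
    single offset. This gives at most \<open>d\<close> elements, and distinct elements have disjoint
    subtrees.\<close>
  have injV: "c = c' \<Longrightarrow> y = y'" if "(c, y) \<in> V f" "(c', y') \<in> V f" for c y c' y' f
    using that offset_inj[of j0 y K y'] by (auto simp: V_def vis_def)
  have cardV: "card (V f) \<le> d" for f
  proof -
    have "inj_on fst (V f)" using injV by (auto simp: inj_on_def)
    moreover have "fst ` V f \<subseteq> {..<d}" by (auto simp: V_def)
    ultimately show ?thesis using card_inj_on_le[of fst "V f" "{..<d}"] by simp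
  qed
  have one: "pr (\<lambda>\<eta>. conf f \<eta> \<and> (\<forall>z\<in>V f. ?R z \<eta>)) \<le>
      pr (conf f) * (1 - (\<delta> - real d * \<delta>\<^sup>2) * real (card (V f)))" for f
  proof -
    let ?A = "\<lambda>z. below d K n (fst z # v)"
    have dis: "?A y \<inter> ?A z = {}" if "y \<in> V f" "z \<in> V f" "y \<noteq> z" for y z
    proof (rule below_disjoint)
      show "fst y # v \<noteq> fst z # v" using that injV[of "fst y" "snd y" f "fst z" "snd z"] unfolding prod_eq_iff prod.collapse by blast
    qed simp
    have "pr (\<lambda>\<eta>. conf f \<eta> \<and> (\<forall>z\<in>V f. ?R z \<eta>)) = pr (conf f) * pr (\<lambda>\<eta>. \<forall>z\<in>V f. ?R z \<eta>)"
    proof (rule pr_conj)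
      show "depends (conf f) L" by (rule dependsI) (auto simp: conf_def)
      show "depends (\<lambda>\<eta>. \<forall>z\<in>V f. ?R z \<eta>) (\<Union>z\<in>V f. ?A z)"
        by (intro depends_ball depends_returns K)
      show "L \<inter> (\<Union>z\<in>V f. ?A z) = {}" by (auto simp: L_def dest: below_longer)
    qed
    also have "pr (\<lambda>\<eta>. \<forall>z\<in>V f. ?R z \<eta>) = (\<Prod>z\<in>V f. pr (?R z))"
      by (intro pr_all[where A = ?A] finV depends_returns K dis)
    also have "\<dots> \<le> (\<Prod>z\<in>V f. 1 - \<delta>)"
      using IH oK by (intro prod_mono) (auto simp: V_def)
    also have "\<dots> = (1 - \<delta>) ^ card (V f)" by simp
    also have "\<dots> \<le> 1 - real (card (V f)) * \<delta> + (real (card (V f)))\<^sup>2 * \<delta>\<^sup>2"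
      by (rule power_le_quadratic[OF \<delta>(1,2)])
    also have "\<dots> \<le> 1 - (\<delta> - real d * \<delta>\<^sup>2) * real (card (V f))"
    proof -
      have "(real (card (V f)))\<^sup>2 * \<delta>\<^sup>2 \<le> real (card (V f)) * real d * \<delta>\<^sup>2"
        using cardV[of f] unfolding power2_eq_square[of "real _"] by (intro mult_mono) auto
      then show ?thesis by (simp add: algebra_simps)
    qed
    finally show ?thesis by (simp add: mult_left_mono)
  qed
  have conf_ex: "\<exists>f\<in>Pow L. conf f \<eta>" for \<eta>
    by (rule bexI[of _ "{x \<in> L. \<eta> x}"]) (auto simp: conf_def)
  have conf_unique: "f = g" if "f \<in> Pow L" "g \<in> Pow L" "conf f \<eta>" "conf g \<eta>" for f g \<eta>
    using that by (auto simp: conf_def)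
  have split: "pr E = (\<Sum>f\<in>Pow L. pr (\<lambda>\<eta>. conf f \<eta> \<and> E \<eta>))" for E
  proof -
    have "pr E = pr (\<lambda>\<eta>. \<exists>f\<in>Pow L. conf f \<eta> \<and> E \<eta>)"
      using conf_ex by (intro arg_cong[where f = pr] ext) blast
    also have "\<dots> = (\<Sum>f\<in>Pow L. pr (\<lambda>\<eta>. conf f \<eta> \<and> E \<eta>))"
      by (rule pr_bex_disjoint) (use conf_unique finL in \<open>auto 4 3\<close>)
    finally show ?thesis .
  qed
  let ?\<kappa> = "\<delta> - real d * \<delta>\<^sup>2"
  have \<kappa>0: "?\<kappa> \<ge> 0" using \<delta> mult_right_mono[OF \<delta>(3) \<delta>(1)] by (simp add: power2_eq_square)
  have mass: "(\<Sum>f\<in>Pow L. pr (conf f)) = 1" using split[of "\<lambda>_. True"] by simp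
  have mean: "(\<Sum>f\<in>Pow L. pr (conf f) * real (card (V f))) = (\<Sum>z\<in>?X. pr (\<lambda>\<eta>. vis \<eta> z))"
  proof -
    have "(\<Sum>z\<in>?X. pr (\<lambda>\<eta>. vis \<eta> z)) = (\<Sum>z\<in>?X. \<Sum>f\<in>Pow L. pr (\<lambda>\<eta>. conf f \<eta> \<and> vis \<eta> z))"
      by (intro sum.cong refl split)
    also have "\<dots> = (\<Sum>f\<in>Pow L. \<Sum>z\<in>?X. pr (\<lambda>\<eta>. conf f \<eta> \<and> vis \<eta> z))" by (rule sum.swap)
    also have "\<dots> = (\<Sum>f\<in>Pow L. pr (conf f) * real (card (V f)))"
    proof (rule sum.cong[OF refl])
      fix f
      have "pr (\<lambda>\<eta>. conf f \<eta> \<and> vis \<eta> z) = (if z \<in> V f then pr (conf f) else 0)" if "z \<in> ?X" for z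
      proof -
        have "conf f \<eta> \<and> vis \<eta> z \<longleftrightarrow> conf f \<eta> \<and> z \<in> V f" for \<eta> using confV[of f \<eta>] that by auto
        then show ?thesis by (simp add: pr_def)
      qed
      then have "(\<Sum>z\<in>?X. pr (\<lambda>\<eta>. conf f \<eta> \<and> vis \<eta> z)) = (\<Sum>z\<in>?X. if z \<in> V f then pr (conf f) else 0)"
        by (rule sum.cong[OF refl])
      also have "\<dots> = (\<Sum>z\<in>?X \<inter> V f. pr (conf f))" by (subst sum.inter_restrict) auto
      also have "?X \<inter> V f = V f" by (auto simp: V_def)
      finally show "(\<Sum>z\<in>?X. pr (\<lambda>\<eta>. conf f \<eta> \<and> vis \<eta> z)) = pr (conf f) * real (card (V f))" by simp
    qed
    finally show ?thesis by simp
  qed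
  have "pr (\<lambda>\<eta>. \<exists>i. returns d K \<eta> (Suc n) v {j0} j0 i) =
      (\<Sum>f\<in>Pow L. pr (\<lambda>\<eta>. conf f \<eta> \<and> (\<exists>i. returns d K \<eta> (Suc n) v {j0} j0 i)))" by (rule split)
  also have "\<dots> \<le> (\<Sum>f\<in>Pow L. pr (\<lambda>\<eta>. conf f \<eta> \<and> (\<forall>z\<in>V f. ?R z \<eta>)))"
    by (intro sum_mono pr_mono) (use confV ret in blast)
  also have "\<dots> \<le> (\<Sum>f\<in>Pow L. pr (conf f) * (1 - ?\<kappa> * real (card (V f))))"
    by (intro sum_mono one)
  also have "\<dots> = 1 - ?\<kappa> * (\<Sum>z\<in>?X. pr (\<lambda>\<eta>. vis \<eta> z))"
    unfolding mean[symmetric] by (simp add: right_diff_distrib sum_subtractf mass sum_distrib_left mult_ac)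
  also have "\<dots> \<le> 1 - ?\<kappa> * (\<Sum>z\<in>?X. p * (1 - p) ^ (K - 1) * (1 - (real d - 1) * (p + real (snd z - 1) * real (K - snd z) * p\<^sup>2)))"
    using pr_visited_ge[OF v _ j0] \<kappa>0
    by (intro diff_left_mono mult_left_mono sum_mono) (auto simp: vis_def)
  also have "(\<Sum>z\<in>?X. p * (1 - p) ^ (K - 1) * (1 - (real d - 1) * (p + real (snd z - 1) * real (K - snd z) * p\<^sup>2))) =
    real d * (\<Sum>y\<in>{1..<K}. p * (1 - p) ^ (K - 1) * (1 - (real d - 1) * (p + real (y - 1) * real (K - y) * p\<^sup>2)))"
    using sum.cartesian_product[of "\<lambda>_ y. p * (1 - p) ^ (K - 1) * (1 - (real d - 1) * (p + real (y - 1) * real (K - y) * p\<^sup>2))" "{1..<K}" "{..<d}"]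
    by (simp add: case_prod_beta)
  finally show ?thesis .
qed

end

section \<open>The recursion for many bars\<close>

context bernoulli_field
begin

lemma pr_bex_le:
  assumes "finite X" "\<And>x. x \<in> X \<Longrightarrow> pr (E x) \<le> f x"
  shows "pr (\<lambda>\<eta>. \<exists>x\<in>X. E x \<eta>) \<le> (\<Sum>x\<in>X. f x)"
  using order_trans[OF pr_bex[OF assms(1)] sum_mono] assms(2) by blast

end

context tree_field
begin

text \<open>The summands on the right bound, in this order, the events E1, ..., E7 of the proof: no bar at a child
  within w slots; a bar to the parent comes first; the first child c has a bar in the last w slots of the cycle;
  after the return from c, no other child has a bar within w slots; the next bar leads
  to the parent; it leads to c again; it leads to a fresh child, which is also left again.\<close>
lemma returns_step_many_bars:
  assumes v: "tree_vertex d v" "Suc (length v) \<le> N" and j0: "j0 < K" and w: "2 * w < K"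
    and q0: "0 \<le> q"
    and IH: "\<And>c j. c < d \<Longrightarrow> j < K \<Longrightarrow>
      pr (\<lambda>\<eta>. \<exists>i. returns d K \<eta> n (c # v) (insert j (bars K \<eta> (c # v))) j i) \<le> q"
  defines "a \<equiv> (1 - p) ^ (d - 2)"
  defines "A \<equiv> (\<Sum>x\<in>{1..w}. p * a ^ (x - 1))"
  shows "pr (\<lambda>\<eta>. \<exists>i. returns d K \<eta> (Suc n) v (insert j0 (bars K \<eta> v)) j0 i) \<le>
    a ^ w + A + real d * (A * (real (w + 1) * p)) +
    real d * (A * (q * a ^ w)) + real d * (A * (A * q)) + real d * (A * (A * (q / (1 - p)))) +
    real d * (real d * (A * (A * q\<^sup>2)))"
proof -
  let ?o = "\<lambda>x. (j0 + x) mod K"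
  \<comment> \<open>\<open>Q S Z\<close> is silence of all children outside \<open>S\<close> during
    the offsets in \<open>Z\<close>; at least d - 2 children are concerned, whence the base
    \<open>a\<close>. The set \<open>D S\<close> collects coordinates that this silence does not
    look at: the children in \<open>S\<close> with what lies below them, and the edge to the
    parent.\<close>
  define Q where "Q S Z \<eta> \<longleftrightarrow> (\<forall>c\<in>{..<d} - S. \<forall>x\<in>Z. \<not> \<eta> (c # v, ?o x))"
    for S Z and \<eta> :: "nat list \<times> nat \<Rightarrow> bool"
  define D where "D S = (\<Union>c\<in>S. {c # v} \<times> UNIV \<union> below d K n (c # v)) \<union> {v} \<times> UNIV" for S
  define Rt where "Rt c x b \<eta> \<longleftrightarrow> returns d K \<eta> n (c # v) (bars K \<eta> (c # v)) (?o x) (?o b)" for c x b \<eta>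
  define Rx where "Rx c x \<eta> \<longleftrightarrow> (\<exists>i. returns d K \<eta> n (c # v) (bars K \<eta> (c # v)) (?o x) i)" for c x \<eta>
  define W where "W c x b \<eta> \<longleftrightarrow> \<eta> (c # v, ?o x) \<and> Rt c x b \<eta>" for c x b \<eta>
  define U where "U c x \<eta> \<longleftrightarrow> \<eta> (c # v, ?o x) \<and> Rx c x \<eta>" for c x \<eta>
  have a: "0 \<le> a" "a \<le> 1" unfolding a_def using p0 p1 by (auto intro: power_le_one)
  have oK: "?o x < K" for x using K by simp
  have inI: "(c # v, i) \<in> idx d K N" if "c < d" "i < K" for c i
    using v that by (auto simp: idx_def tree_vertex_def)
  have inI0: "(v, i) \<in> idx d K N" if "i < K" for i
    using v that by (auto simp: idx_def)
  have pQ: "pr (\<lambda>\<eta>. Q S Z \<eta> \<and> E \<eta>) \<le> a ^ card Z * pr E"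
    if S: "finite S" "card S \<le> 2" and Z: "Z \<subseteq> {1..K}" and E: "depends E (D S)" for S Z E
  proof -
    let ?Y = "(\<lambda>(c, x). (c # v, ?o x)) ` (({..<d} - S) \<times> Z)"
    have Q: "Q S Z = (\<lambda>\<eta>. \<forall>y\<in>?Y. \<not> \<eta> y)" unfolding Q_def by (intro ext) auto
    have "pr (\<lambda>\<eta>. Q S Z \<eta> \<and> E \<eta>) = pr (Q S Z) * pr E"
    proof (rule pr_conj[OF _ E])
      show "depends (Q S Z) ?Y" unfolding Q by (rule dependsI) metis
      show "?Y \<inter> D S = {}" by (auto simp: D_def dest: below_longer)
    qed
    also have "pr (Q S Z) = (1 - p) ^ card ?Y"
      unfolding Q using inI oK by (intro pr_none) auto
    also have "card ?Y = card (({..<d} - S) \<times> Z)"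
    proof (intro card_image inj_onI)
      fix x y assume h: "x \<in> ({..<d} - S) \<times> Z" "y \<in> ({..<d} - S) \<times> Z"
        "(case x of (c, x) \<Rightarrow> (c # v, ?o x)) = (case y of (c, x) \<Rightarrow> (c # v, ?o x))"
      then show "x = y" using offset_inj[of j0 "snd x" K "snd y"] subsetD[OF Z, of "snd x"] subsetD[OF Z, of "snd y"] by auto
    qed
    also have "\<dots> = card ({..<d} - S) * card Z" by (simp add: card_cartesian_product)
    also have "(1 - p) ^ (card ({..<d} - S) * card Z) \<le> (1 - p) ^ ((d - 2) * card Z)"
    proof (rule power_decreasing)
      have "d - 2 \<le> card ({..<d} - S)" using S diff_card_le_card_Diff[of S "{..<d}"] by simp
      then show "(d - 2) * card Z \<le> card ({..<d} - S) * card Z" by simp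
    qed (use p0 p1 in auto)
    finally show ?thesis by (simp add: a_def power_mult mult_right_mono)
  qed
  have upd: "returns d K (\<eta>((c # v, s) := t)) n (c # v) P j i = returns d K \<eta> n (c # v) P j i"
    for \<eta> c s t P j i
    by (rule returns_cong[OF K]) (auto dest: below_longer)
  \<comment> \<open>The bar used for entering is also a stop. Forcing it to be present turns the
    stops into \<open>insert j (bars ...)\<close>, the set in the induction hypothesis; the
    excursion reads the edge \<open>c # v\<close> in no other way.\<close>
  have F1: "pr (U c x) \<le> p * q" if "c < d" for c x
  proof -
    have b: "bars K (\<eta>((c # v, ?o x) := True)) (c # v) = insert (?o x) (bars K \<eta> (c # v))" for \<eta>
      using oK by (auto simp: bars_def)
    have "pr (U c x) = p * pr (\<lambda>\<eta>. Rx c x (\<eta>((c # v, ?o x) := True)))"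
      unfolding U_def by (rule pr_force[OF inI[OF that oK]])
    also have "\<dots> \<le> p * q" unfolding Rx_def b upd by (intro mult_left_mono IH that oK p0)
    finally show ?thesis .
  qed
  \<comment> \<open>The slot of return is unique, so the events for different \<open>b\<close> are
    disjoint and the sum over \<open>b\<close> costs no factor \<open>K\<close>.\<close>
  have F2: "(\<Sum>b\<in>B. pr (W c x b)) \<le> p * q" if "c < d" "B \<subseteq> {1..K}" for c x B
  proof -
    have "(\<Sum>b\<in>B. pr (W c x b)) = pr (\<lambda>\<eta>. \<exists>b\<in>B. W c x b \<eta>)"
    proof (rule pr_bex_disjoint[symmetric])
      show "finite B" using that finite_subset by blast
      fix b b' \<eta> assume "b \<in> B" "b' \<in> B" "W c x b \<eta>" "W c x b' \<eta>"
      then show "b = b'" using offset_inj[of j0 b K b'] that(2) returns_det unfolding W_def Rt_def by blast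
    qed
    also have "\<dots> \<le> pr (U c x)"
      by (rule pr_mono) (auto simp: W_def U_def Rt_def Rx_def)
    finally show ?thesis using F1[OF that(1), of x] by simp
  qed
  \<comment> \<open>A bar that is not used by the excursion may be deleted, which makes it independent of the excursion.\<close>
  have F3: "pr (\<lambda>\<eta>. \<eta> (c # v, ?o z) \<and> W c x b \<eta>) \<le>
      p / (1 - p) * pr (W c x b)"
    if c: "c < d" and z: "z \<in> {1..K}" "x \<in> {1..K}" "b \<in> {1..K}" "z \<noteq> x" "z \<noteq> b" for c x b z
  proof -
    define G where "G \<eta> \<longleftrightarrow> \<eta> (c # v, ?o x) \<and> returns d K \<eta> n (c # v) (bars K \<eta> (c # v) - {?o z}) (?o x) (?o b)" for \<eta>
    have ne: "?o z \<noteq> ?o x" "?o z \<noteq> ?o b" using offset_inj z by metis+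
    have "pr (\<lambda>\<eta>. \<eta> (c # v, ?o z) \<and> W c x b \<eta>) \<le> pr (\<lambda>\<eta>. \<eta> (c # v, ?o z) \<and> G \<eta>)"
      by (rule pr_mono) (use returns_unused_stop[OF _ ne(2)] in \<open>auto simp: W_def Rt_def G_def\<close>)
    also have "\<dots> = pr (\<lambda>\<eta>. \<eta> (c # v, ?o z)) * pr G"
      and "pr (\<lambda>\<eta>. \<not> \<eta> (c # v, ?o z) \<and> G \<eta>) = pr (\<lambda>\<eta>. \<not> \<eta> (c # v, ?o z)) * pr G"
    proof -
      have G: "depends G (- {(c # v, ?o z)})"
      proof (rule dependsI)
        fix \<eta> \<eta>' :: "nat list \<times> nat \<Rightarrow> bool" assume e: "\<And>y. y \<in> - {(c # v, ?o z)} \<Longrightarrow> \<eta> y = \<eta>' y" and "G \<eta>"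
        have "bars K \<eta> (c # v) - {?o z} = bars K \<eta>' (c # v) - {?o z}" using e by (auto simp: bars_def)
        moreover have "returns d K \<eta> n (c # v) P j i = returns d K \<eta>' n (c # v) P j i" for P j i
          by (rule returns_cong[OF K], rule e) (auto dest: below_longer)
        ultimately show "G \<eta>'" using \<open>G \<eta>\<close> e ne unfolding G_def by auto
      qed
      show "pr (\<lambda>\<eta>. \<eta> (c # v, ?o z) \<and> G \<eta>) = pr (\<lambda>\<eta>. \<eta> (c # v, ?o z)) * pr G"
        by (rule pr_conj[OF depends_coord G]) simp
      show "pr (\<lambda>\<eta>. \<not> \<eta> (c # v, ?o z) \<and> G \<eta>) = pr (\<lambda>\<eta>. \<not> \<eta> (c # v, ?o z)) * pr G"
        by (rule pr_conj[OF depends_not[OF depends_coord] G]) simp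
    qed
    moreover have "pr (\<lambda>\<eta>. \<not> \<eta> (c # v, ?o z) \<and> G \<eta>) \<le> pr (W c x b)"
    proof (rule pr_mono)
      fix \<eta> :: "nat list \<times> nat \<Rightarrow> bool" assume h: "\<not> \<eta> (c # v, ?o z) \<and> G \<eta>"
      then have "bars K \<eta> (c # v) - {?o z} = bars K \<eta> (c # v)" by (auto simp: bars_def)
      then show "W c x b \<eta>" using h by (simp add: G_def W_def Rt_def)
    qed
    ultimately have "pr (\<lambda>\<eta>. \<eta> (c # v, ?o z) \<and> W c x b \<eta>) \<le> p * pr G"
      "(1 - p) * pr G \<le> pr (W c x b)"
      using pr_coord[OF inI[OF c oK]] by (auto simp: pr_not)
    moreover have "pr G \<le> pr (W c x b) / (1 - p)"
      using calculation(2) p1 by (simp add: field_simps)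
    then have "p * pr G \<le> p * (pr (W c x b) / (1 - p))"
      by (rule mult_left_mono[OF _ p0])
    ultimately show ?thesis by simp
  qed
  have dW: "depends (W c x b) ({c # v} \<times> UNIV \<union> below d K n (c # v))"
    and dU: "depends (U c x) ({c # v} \<times> UNIV \<union> below d K n (c # v))" for c x b
  proof -
    have r: "returns d K \<eta> n (c # v) (bars K \<eta> (c # v)) j i = returns d K \<eta>' n (c # v) (bars K \<eta>' (c # v)) j i"
      if e: "\<And>y. y \<in> {c # v} \<times> UNIV \<union> below d K n (c # v) \<Longrightarrow> \<eta> y = \<eta>' y" for \<eta> \<eta>' j i
    proof -
      have "bars K \<eta> (c # v) = bars K \<eta>' (c # v)" using e by (auto simp: bars_def)
      then show ?thesis using returns_cong[OF K, of d n "c # v" \<eta> \<eta>'] e by simp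
    qed
    have e: "(c # v, i) \<in> {c # v} \<times> UNIV \<union> below d K n (c # v)" for i by simp
    show "depends (W c x b) ({c # v} \<times> UNIV \<union> below d K n (c # v))"
      unfolding depends_def W_def Rt_def using r e by metis
    show "depends (U c x) ({c # v} \<times> UNIV \<union> below d K n (c # v))"
      unfolding depends_def U_def Rx_def using r e by metis
  qed
  have sub: "{c # v} \<times> UNIV \<union> below d K n (c # v) \<subseteq> D S" if "c \<in> S" for c S
    using that by (auto simp: D_def)
  have edge0: "{(v, i)} \<subseteq> D S" for S i by (auto simp: D_def)
  let ?X = "{1..w}"
  \<comment> \<open>A return before offset \<open>K - w\<close> leaves room for the second window,
    behind \<open>b\<close>, within the cycle; since x \<le> b it is also disjoint from the silent
    part of the first window. Later returns are the event \<open>E3\<close>.\<close>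
  let ?B = "\<lambda>x. {x..<K - w}"
  define E1 where "E1 = (\<lambda>\<eta>. Q {} ?X \<eta>)"
  define E2 where "E2 = (\<lambda>\<eta>. \<exists>x\<in>?X. Q {} {1..<x} \<eta> \<and> \<eta> (v, ?o x))"
  define E3 where "E3 = (\<lambda>\<eta>. \<exists>c\<in>{..<d}. \<exists>x\<in>?X. \<exists>b\<in>{K - w..K}. Q {c} {1..<x} \<eta> \<and> (\<eta> (c # v, ?o x) \<and> \<eta> (c # v, ?o b)))"
  define E4 where "E4 = (\<lambda>\<eta>. \<exists>c\<in>{..<d}. \<exists>x\<in>?X. \<exists>b\<in>?B x. Q {c} ({1..<x} \<union> {b + 1..b + w}) \<eta> \<and>
      W c x b \<eta>)"
  define E5 where "E5 = (\<lambda>\<eta>. \<exists>c\<in>{..<d}. \<exists>x\<in>?X. \<exists>y\<in>?X. \<exists>b\<in>?B x. Q {c} ({1..<x} \<union> {b + 1..<b + y}) \<eta> \<and>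
      (\<eta> (v, ?o (b + y)) \<and> W c x b \<eta>))"
  define E6 where "E6 = (\<lambda>\<eta>. \<exists>c\<in>{..<d}. \<exists>x\<in>?X. \<exists>y\<in>?X. \<exists>b\<in>?B x. Q {c} ({1..<x} \<union> {b + 1..<b + y}) \<eta> \<and>
      (\<eta> (c # v, ?o (b + y)) \<and> W c x b \<eta>))"
  define E7 where "E7 = (\<lambda>\<eta>. \<exists>c\<in>{..<d}. \<exists>c'\<in>{..<d} - {c}. \<exists>x\<in>?X. \<exists>y\<in>?X. \<exists>b\<in>?B x.
      Q {c, c'} ({1..<x} \<union> {b + 1..<b + y}) \<eta> \<and>
      (U c' (b + y) \<eta> \<and> W c x b \<eta>))"
  have card2: "card ({1..<x} \<union> {b + 1..<b + y}) = (x - 1) + (y - 1)" if "x \<le> b" for x b y :: nat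
    using that by (subst card_Un_disjoint) auto
  have card2': "card ({1..<x} \<union> {b + 1..b + w}) = (x - 1) + w" if "x \<le> b" for x b :: nat
    using that by (subst card_Un_disjoint) auto
  have p1': "pr E1 \<le> a ^ w"
    using pQ[of "{}" ?X "\<lambda>_. True"] w unfolding E1_def by (auto simp: depends_def)
  have p2: "pr E2 \<le> A"
    unfolding E2_def A_def
  proof (rule pr_bex_le)
    fix x assume x: "x \<in> ?X"
    show "pr (\<lambda>\<eta>. Q {} {1..<x} \<eta> \<and> \<eta> (v, ?o x)) \<le> p * a ^ (x - 1)"
    proof -
      have "{1..<x} \<subseteq> {1..K}" using x w by auto
      then show ?thesis
        using pQ[of "{}" "{1..<x}" "\<lambda>\<eta>. \<eta> (v, ?o x)", OF _ _ _ depends_mono[OF depends_coord edge0]] pr_coord[OF inI0[OF oK]]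
        by (simp add: mult.commute)
    qed
  qed simp
  have p3: "pr E3 \<le> (\<Sum>c\<in>{..<d}. \<Sum>x\<in>?X. \<Sum>b\<in>{K - w..K}. a ^ (x - 1) * (p * p))"
    unfolding E3_def
  proof (intro pr_bex_le)
    fix c x b assume h: "c \<in> {..<d}" "x \<in> ?X" "b \<in> {K - w..K}"
    have "?o x \<noteq> ?o b" using offset_inj[of j0 x K b] h w by fastforce
    then have "pr (\<lambda>\<eta>. \<eta> (c # v, ?o x) \<and> \<eta> (c # v, ?o b)) = p * p"
      using pr_coord[OF inI[OF _ oK]] h by (subst pr_conj[OF depends_coord depends_coord]) auto
    moreover have "depends (\<lambda>\<eta>. \<eta> (c # v, ?o x) \<and> \<eta> (c # v, ?o b)) (D {c})"
      by (rule depends_mono[OF depends_conj[OF depends_coord depends_coord]]) (auto simp: D_def)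
    ultimately show "pr (\<lambda>\<eta>. Q {c} {1..<x} \<eta> \<and> (\<eta> (c # v, ?o x) \<and> \<eta> (c # v, ?o b))) \<le> a ^ (x - 1) * (p * p)"
      using pQ[of "{c}" "{1..<x}"] h w by fastforce
  qed auto
  have p4: "pr E4 \<le> (\<Sum>c\<in>{..<d}. \<Sum>x\<in>?X. a ^ (x - 1) * a ^ w * (p * q))"
    unfolding E4_def
  proof (intro pr_bex_le)
    fix c x assume h: "c \<in> {..<d}" "x \<in> ?X"
    have "pr (\<lambda>\<eta>. \<exists>b\<in>?B x. Q {c} ({1..<x} \<union> {b + 1..b + w}) \<eta> \<and> W c x b \<eta>)
        \<le> (\<Sum>b\<in>?B x. a ^ (x - 1) * a ^ w * pr (W c x b))"
    proof (rule pr_bex_le)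
      fix b assume b: "b \<in> ?B x"
      show "pr (\<lambda>\<eta>. Q {c} ({1..<x} \<union> {b + 1..b + w}) \<eta> \<and> W c x b \<eta>) \<le>
          a ^ (x - 1) * a ^ w * pr (W c x b)"
      proof -
        have "{1..<x} \<union> {b + 1..b + w} \<subseteq> {1..K}" and x: "x \<le> b" using b h w by auto
        from pQ[OF _ _ this(1) depends_mono[OF dW sub[OF singletonI]], of c x b] show ?thesis
          unfolding card2'[OF x] by (simp add: power_add)
      qed
    qed simp
    also have "\<dots> = a ^ (x - 1) * a ^ w * (\<Sum>b\<in>?B x. pr (W c x b))"
      by (simp add: sum_distrib_left)
    also have "\<dots> \<le> a ^ (x - 1) * a ^ w * (p * q)"
      using h w a by (intro mult_left_mono F2) auto
    finally show "pr (\<lambda>\<eta>. \<exists>b\<in>?B x. Q {c} ({1..<x} \<union> {b + 1..b + w}) \<eta> \<and> W c x b \<eta>)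
        \<le> a ^ (x - 1) * a ^ w * (p * q)" .
  qed auto
  \<comment> \<open>Common estimate for \<open>E5\<close>, \<open>E6\<close> and \<open>E7\<close>:
    the two silences give the powers of \<open>a\<close>, the event ending the second one costs
    \<open>r\<close>, and the sum over the slots of return gives \<open>p * q\<close>.\<close>
  have ret: "pr (\<lambda>\<eta>. \<exists>b\<in>?B x. Q S ({1..<x} \<union> {b + 1..<b + y}) \<eta> \<and> F b \<eta>) \<le> a ^ (x - 1) * a ^ (y - 1) * r * (p * q)"
    if S: "finite S" "card S \<le> 2" and h: "c < d" "x \<in> ?X" "y \<in> ?X" and r: "0 \<le> r"
      and F: "\<And>b. b \<in> ?B x \<Longrightarrow> depends (F b) (D S)" "\<And>b. b \<in> ?B x \<Longrightarrow> pr (F b) \<le> r * pr (W c x b)" for S F c x y r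
  proof -
    have "pr (\<lambda>\<eta>. \<exists>b\<in>?B x. Q S ({1..<x} \<union> {b + 1..<b + y}) \<eta> \<and> F b \<eta>) \<le>
        (\<Sum>b\<in>?B x. a ^ (x - 1) * a ^ (y - 1) * r * pr (W c x b))"
    proof (rule pr_bex_le)
      fix b assume b: "b \<in> ?B x"
      then have "{1..<x} \<union> {b + 1..<b + y} \<subseteq> {1..K}" and x: "x \<le> b" using h w by auto
      from pQ[OF S this(1) F(1)[OF b]]
      have "pr (\<lambda>\<eta>. Q S ({1..<x} \<union> {b + 1..<b + y}) \<eta> \<and> F b \<eta>) \<le> a ^ ((x - 1) + (y - 1)) * pr (F b)"
        unfolding card2[OF x] by simp
      also have "\<dots> \<le> a ^ ((x - 1) + (y - 1)) * (r * pr (W c x b))"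
        using F(2)[OF b] a by (intro mult_left_mono) auto
      finally show "pr (\<lambda>\<eta>. Q S ({1..<x} \<union> {b + 1..<b + y}) \<eta> \<and> F b \<eta>) \<le>
          a ^ (x - 1) * a ^ (y - 1) * r * pr (W c x b)"
        by (simp add: power_add mult.assoc)
    qed simp
    also have "\<dots> = a ^ (x - 1) * a ^ (y - 1) * r * (\<Sum>b\<in>?B x. pr (W c x b))"
      by (simp only: sum_distrib_left)
    also have "\<dots> \<le> a ^ (x - 1) * a ^ (y - 1) * r * (p * q)"
      using h w a r by (intro mult_left_mono F2) auto
    finally show ?thesis .
  qed
  have p5: "pr E5 \<le> (\<Sum>c\<in>{..<d}. \<Sum>x\<in>?X. \<Sum>y\<in>?X. a ^ (x - 1) * a ^ (y - 1) * p * (p * q))"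
    unfolding E5_def
  proof (intro pr_bex_le ret)
    fix c x y b
    show "depends (\<lambda>\<eta>. \<eta> (v, ?o (b + y)) \<and> W c x b \<eta>) (D {c})"
      by (rule depends_mono[OF depends_conj[OF depends_coord dW]]) (auto simp: D_def)
    show "pr (\<lambda>\<eta>. \<eta> (v, ?o (b + y)) \<and> W c x b \<eta>) \<le> p * pr (W c x b)"
      using pr_coord[OF inI0[OF oK]] by (subst pr_conj[OF depends_coord dW]) (auto dest: below_longer)
  qed (use p0 in auto)
  have p6: "pr E6 \<le> (\<Sum>c\<in>{..<d}. \<Sum>x\<in>?X. \<Sum>y\<in>?X. a ^ (x - 1) * a ^ (y - 1) * (p / (1 - p)) * (p * q))"
    unfolding E6_def
  proof (intro pr_bex_le ret)
    fix c x y b assume h: "c \<in> {..<d}" "x \<in> ?X" "y \<in> ?X" "b \<in> ?B x"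
    show "depends (\<lambda>\<eta>. \<eta> (c # v, ?o (b + y)) \<and> W c x b \<eta>) (D {c})"
      by (rule depends_mono[OF depends_conj[OF depends_coord dW]]) (auto simp: D_def)
    show "pr (\<lambda>\<eta>. \<eta> (c # v, ?o (b + y)) \<and> W c x b \<eta>) \<le> p / (1 - p) * pr (W c x b)"
      using h w by (intro F3) auto
  qed (use p0 p1 in auto)
  have p7: "pr E7 \<le> (\<Sum>c\<in>{..<d}. \<Sum>c'\<in>{..<d} - {c}. \<Sum>x\<in>?X. \<Sum>y\<in>?X. a ^ (x - 1) * a ^ (y - 1) * (p * q) * (p * q))"
    unfolding E7_def
  proof (intro pr_bex_le ret)
    fix c c' x y b assume c': "c' \<in> {..<d} - {c}"
    show "depends (\<lambda>\<eta>. U c' (b + y) \<eta> \<and> W c x b \<eta>) (D {c, c'})"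
      by (rule depends_mono[OF depends_conj[OF dU dW]]) (auto simp: D_def)
    have "({c' # v} \<times> UNIV \<union> below d K n (c' # v)) \<inter> ({c # v} \<times> UNIV \<union> below d K n (c # v)) = {}"
      using c' below_disjoint[of "c' # v" "c # v" d K n] by (auto dest: below_longer)
    from pr_conj[OF dU dW this] show "pr (\<lambda>\<eta>. U c' (b + y) \<eta> \<and> W c x b \<eta>) \<le> p * q * pr (W c x b)"
      using mult_right_mono[OF F1[of c' "b + y"] pr_nonneg[of "W c x b"]] c' by simp
    show "card {c, c'} \<le> 2" by (simp add: card_insert_if)
  qed (use p0 q0 in auto)
  have cover: "E1 \<eta> \<or> E2 \<eta> \<or> E3 \<eta> \<or> E4 \<eta> \<or> E5 \<eta> \<or> E6 \<eta> \<or> E7 \<eta>"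
    if ret: "returns d K \<eta> (Suc n) v (insert j0 (bars K \<eta> v)) j0 i" for \<eta> i
  proof -
    let ?P = "insert j0 (bars K \<eta> v)"
    have stop: "\<eta> (v, ?o x)" if "?o x \<in> ?P" "x \<in> {1..<K}" for x
    proof -
      have "?o x \<noteq> ?o K" using offset_inj[of j0 x K K] that(2) by fastforce
      then show ?thesis using that(1) j0 by (auto simp: bars_def)
    qed
    show ?thesis
    proof (rule returns_first_event[OF ret, of w])
      assume "\<forall>x\<in>{1..w}. \<forall>c<d. \<not> \<eta> (c # v, ?o x)"
      then have "E1 \<eta>" unfolding E1_def Q_def by blast
      then show ?thesis by simp
    next
      fix x assume x: "x \<in> {1..w}" "\<forall>y\<in>{1..<x}. \<forall>c<d. \<not> \<eta> (c # v, ?o y)" "?o x \<in> ?P"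
      then have "\<eta> (v, ?o x)" using stop w by auto
      then have "E2 \<eta>" unfolding E2_def Q_def using x by blast
      then show ?thesis by simp
    next
      fix x c i' assume x: "x \<in> {1..w}" "\<forall>y\<in>{1..<x}. \<forall>c<d. \<not> \<eta> (c # v, ?o y)" and c: "c < d" "\<eta> (c # v, ?o x)"
        "returns d K \<eta> n (c # v) (bars K \<eta> (c # v)) (?o x) i'" "returns d K \<eta> (Suc n) v ?P i' i"
      have i': "i' < K" "\<eta> (c # v, i')" using returns_mem[OF c(3)] by (auto simp: bars_def)
      obtain b where b: "b \<in> {1..K}" "?o b = i'" using ex_offset[OF i'(1)] by blast
      \<comment> \<open>No child has a bar before offset \<open>x\<close>, so the bar of return is
        not there either. It may be the entering bar itself, hence b = x is possible.\<close>
      have xb: "x \<le> b" using x(2) c(1) i'(2) b by (metis atLeastAtMost_iff atLeastLessThan_iff not_le)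
      have W: "W c x b \<eta>" using c(2,3) b(2) by (simp add: W_def Rt_def)
      show ?thesis
      proof (cases "b < K - w")
        case False
        then have "b \<in> {K - w..K}" using b by auto
        then have "E3 \<eta>" unfolding E3_def Q_def using c x i'(2) b(2) by blast
        then show ?thesis by simp
      next
        case True
        then have bB: "b \<in> ?B x" using xb by auto
        have o: "(i' + y) mod K = ?o (b + y)" for y
          unfolding b(2)[symmetric] by (simp add: mod_add_left_eq add.assoc)
        have shift: "\<forall>z\<in>{b + 1..<b + y}. \<forall>c<d. \<not> \<eta> (c # v, ?o z)"
          if h: "\<forall>z\<in>{1..<y}. \<forall>c<d. \<not> \<eta> (c # v, ?o (b + z))" for y
        proof
          fix z assume z: "z \<in> {b + 1..<b + y}"
          then have "z - b \<in> {1..<y}" by auto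
          from bspec[OF h this] z show "\<forall>c<d. \<not> \<eta> (c # v, ?o z)" by simp
        qed
        have Q: "Q S ({1..<x} \<union> {b + 1..<b + y}) \<eta>" if "\<forall>z\<in>{1..<y}. \<forall>c<d. \<not> \<eta> (c # v, ?o (b + z))" for S y
          using x(2) shift[OF that] unfolding Q_def by blast
        show ?thesis
        proof (rule returns_first_event[OF c(4), of w, unfolded o])
          assume h: "\<forall>y\<in>{1..w}. \<forall>c<d. \<not> \<eta> (c # v, ?o (b + y))"
          have "Q {c} ({1..<x} \<union> {b + 1..b + w}) \<eta>"
            using Q[of "Suc w" "{c}"] h by (simp add: atLeastLessThanSuc_atLeastAtMost)
          then have "E4 \<eta>" unfolding E4_def using c x(1) bB W by blast
          then show ?thesis by simp
        next
          fix y assume y: "y \<in> {1..w}" "\<forall>z\<in>{1..<y}. \<forall>c<d. \<not> \<eta> (c # v, ?o (b + z))" "?o (b + y) \<in> ?P"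
          have "\<eta> (v, ?o (b + y))" by (rule stop[OF y(3)]) (use y True in auto)
          then have "E5 \<eta>" unfolding E5_def using c x(1) y(1) bB W Q[OF y(2)] by blast
          then show ?thesis by simp
        next
          fix y c' i'' assume y: "y \<in> {1..w}" "\<forall>z\<in>{1..<y}. \<forall>c<d. \<not> \<eta> (c # v, ?o (b + z))" and c': "c' < d"
            "\<eta> (c' # v, ?o (b + y))" "returns d K \<eta> n (c' # v) (bars K \<eta> (c' # v)) (?o (b + y)) i''"
          show ?thesis
          proof (cases "c' = c")
            case True
            then have "E6 \<eta>" unfolding E6_def using c(1) c'(2) x(1) y(1) bB W Q[OF y(2)] by blast
            then show ?thesis by simp
          next
            case False
            then have "c' \<in> {..<d} - {c}" "c \<in> {..<d}" using c c' by auto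
            moreover have "U c' (b + y) \<eta>" using c'(2,3) by (auto simp: U_def Rx_def)
            ultimately have "E7 \<eta>" unfolding E7_def using x(1) y(1) bB W Q[OF y(2)] by blast
            then show ?thesis by simp
          qed
        qed
      qed
    qed
  qed
  have s3: "(\<Sum>c\<in>{..<d}. \<Sum>x\<in>?X. \<Sum>b\<in>{K - w..K}. a ^ (x - 1) * (p * p)) = real d * (A * (real (w + 1) * p))"
  proof -
    have "card {K - w..K} = w + 1" using w by simp
    then have "(\<Sum>b\<in>{K - w..K}. a ^ (x - 1) * (p * p)) = (p * a ^ (x - 1)) * (real (w + 1) * p)" for x
      by (simp only: sum_constant) (simp add: mult_ac)
    then show ?thesis unfolding A_def sum_distrib_right by (simp only: sum_constant card_lessThan)
  qed
  have s4: "(\<Sum>c\<in>{..<d}. \<Sum>x\<in>?X. a ^ (x - 1) * a ^ w * (p * q)) = real d * (A * (q * a ^ w))"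
  proof -
    have "a ^ (x - 1) * a ^ w * (p * q) = (p * a ^ (x - 1)) * (q * a ^ w)" for x by (simp add: mult_ac)
    then show ?thesis unfolding A_def sum_distrib_right by (simp only: sum_constant card_lessThan)
  qed
  have s: "(\<Sum>x\<in>?X. \<Sum>y\<in>?X. a ^ (x - 1) * a ^ (y - 1) * (p * r) * (p * r')) = A * (A * (r * r'))" for r r'
  proof -
    have "(\<Sum>x\<in>?X. \<Sum>y\<in>?X. a ^ (x - 1) * a ^ (y - 1) * (p * r) * (p * r')) =
        (\<Sum>x\<in>?X. \<Sum>y\<in>?X. (p * a ^ (x - 1)) * (p * a ^ (y - 1))) * (r * r')"
      unfolding sum_distrib_right by (intro sum.cong refl) (simp add: mult_ac)
    also have "(\<Sum>x\<in>?X. \<Sum>y\<in>?X. (p * a ^ (x - 1)) * (p * a ^ (y - 1))) = A * A"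
      unfolding A_def by (rule sum_product[symmetric])
    finally show ?thesis by (simp add: mult_ac)
  qed
  have A0: "A \<ge> 0" unfolding A_def using p0 a by (intro sum_nonneg) auto
  have s7: "(\<Sum>c\<in>{..<d}. \<Sum>c'\<in>{..<d} - {c}. A * (A * (q * q))) \<le> real d * (real d * (A * (A * q\<^sup>2)))"
  proof -
    have "(\<Sum>c'\<in>{..<d} - {c}. A * (A * (q * q))) \<le> real d * (A * (A * q\<^sup>2))" if "c < d" for c
      using A0 that by (simp add: power2_eq_square card_Diff_singleton of_nat_diff) (simp add: mult_right_mono)
    then have "(\<Sum>c\<in>{..<d}. \<Sum>c'\<in>{..<d} - {c}. A * (A * (q * q))) \<le> (\<Sum>c\<in>{..<d}. real d * (A * (A * q\<^sup>2)))"
      by (intro sum_mono) simp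
    then show ?thesis by simp
  qed
  have "pr (\<lambda>\<eta>. \<exists>i. returns d K \<eta> (Suc n) v (insert j0 (bars K \<eta> v)) j0 i) \<le>
      pr (\<lambda>\<eta>. E1 \<eta> \<or> (E2 \<eta> \<or> (E3 \<eta> \<or> (E4 \<eta> \<or> (E5 \<eta> \<or> (E6 \<eta> \<or> E7 \<eta>))))))"
    by (rule pr_mono) (use cover in blast)
  also have "\<dots> \<le> pr E1 + (pr E2 + (pr E3 + (pr E4 + (pr E5 + (pr E6 + pr E7)))))"
    by (intro order_trans[OF pr_disj] add_left_mono order_refl)
  finally show ?thesis
    using p1' p2 p3[unfolded s3] p4[unfolded s4] p5 p6 p7[unfolded s] s7 s[of 1 q] s[of "1 / (1 - p)" q]
    by simp
qed

end

section \<open>Uniform bounds on the return probability\<close>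

lemma one_minus_exp_bounds:
  fixes h :: real
  assumes "0 \<le> h"
  shows "1 - exp (- h) \<le> h" "h / (1 + h) \<le> 1 - exp (- h)"
proof -
  show "1 - exp (- h) \<le> h" using exp_ge_add_one_self[of "- h"] by linarith
  have "exp (- h) \<le> 1 / (1 + h)"
    using exp_ge_add_one_self[of h] assms by (simp add: exp_minus field_simps)
  also have "\<dots> = 1 - h / (1 + h)" using assms by (simp add: field_simps)
  finally show "h / (1 + h) \<le> 1 - exp (- h)" by linarith
qed

text \<open>The sum is at most p / (1 - a) with \<open>a = (1 - p) ^ m\<close>. By Bernoulli's
  inequality a (1 + m p) is at most \<open>((1 - p) * (1 + p)) ^ m\<close>, hence at most 1; so m p
  \<le> (1 - a)(1 + m p), and dividing by m (1 - a) gives the claim.\<close>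

lemma geometric_sum_le:
  fixes p :: real
  assumes "0 \<le> p" "p < 1" "m > 0"
  shows "(\<Sum>x\<in>{1..w}. p * ((1 - p) ^ m) ^ (x - 1)) \<le> 1 / real m + p"
proof (cases "p = 0")
  case False
  define a where "a = (1 - p) ^ m"
  have "a * (1 + real m * p) \<le> a * (1 + p) ^ m"
    using assms by (intro mult_left_mono) (auto simp: a_def Bernoulli_inequality)
  also have "\<dots> = (1 - p\<^sup>2) ^ m"
    by (simp add: a_def flip: power_mult_distrib) (simp add: algebra_simps power2_eq_square)
  also have "\<dots> \<le> 1" using assms by (intro power_le_one) (auto simp: power_le_one)
  finally have a: "real m * p \<le> (1 - a) * (1 + real m * p)" by (simp add: algebra_simps)
  have mp: "real m * p > 0" using assms False by simp
  have a0: "a \<ge> 0" using assms by (simp add: a_def)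
  have "a < 1"
  proof (rule ccontr)
    assume "\<not> a < 1"
    then have "(1 - a) * (1 + real m * p) \<le> 0" using mp by (intro mult_nonpos_nonneg) auto
    then show False using a mp by linarith
  qed
  have "(\<Sum>x\<in>{1..w}. p * a ^ (x - 1)) = p * (\<Sum>i<w. a ^ i)"
    by (simp add: sum_distrib_left sum.atLeast1_atMost_eq)
  also have "\<dots> = p * ((1 - a ^ w) / (1 - a))"
    using \<open>a < 1\<close> by (simp add: sum_gp_strict)
  also have "\<dots> \<le> p * (1 / (1 - a))"
    using assms \<open>a < 1\<close> a0 by (intro mult_left_mono divide_right_mono) auto
  also have "\<dots> \<le> (1 + real m * p) / real m"
    using a \<open>a < 1\<close> assms by (simp add: field_simps)
  also have "\<dots> = 1 / real m + p" using assms by (simp add: field_simps)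
  finally show ?thesis by (simp add: a_def)
qed simp

text \<open>For K \<ge> 1 the sum equals the binomial coefficient K choose 3, a discrete form of the
  integral of y (1 - y) over [0, 1]; the 1/6 of 7/6 arises here. Since \<open>K\<close> occurs in
  the summand as well, the induction keeps a separate \<open>M\<close> there.\<close>

lemma sum_triangle: "(\<Sum>y\<in>{1..<K}. real (y - 1) * real (K - y)) \<le> (real K) ^ 3 / 6"
proof -
  have "6 * (\<Sum>y\<in>{1..<K}. real (y - 1) * real (M - y)) =
      (real K - 1) * (real K - 2) * (3 * real M - 2 * real K)" if "K \<le> M" "K \<ge> 1" for M K
    using that(2,1)
  proof (induction K rule: dec_induct)
    case (step k)
    then have "{1..<Suc k} = insert k {1..<k}" by auto
    then have "6 * (\<Sum>y\<in>{1..<Suc k}. real (y - 1) * real (M - y)) =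
       6 * ((real k - 1) * (real M - real k)) + (real k - 1) * (real k - 2) * (3 * real M - 2 * real k)"
      using step by (simp add: of_nat_diff algebra_simps)
    also have "\<dots> = (real (Suc k) - 1) * (real (Suc k) - 2) * (3 * real M - 2 * real (Suc k))"
      by (simp add: algebra_simps)
    finally show ?case .
  qed simp
  note h = this[of K K]
  show ?thesis
  proof (cases "K \<ge> 2")
    case True
    then have "(real K - 1) * (real K - 2) * real K \<le> real K * real K * real K"
      by (intro mult_mono) auto
    moreover have "6 * (\<Sum>y\<in>{1..<K}. real (y - 1) * real (K - y)) = (real K - 1) * (real K - 2) * real K"
      using h True by (simp del: of_nat_diff)
    ultimately show ?thesis unfolding power3_eq_cube by linarith
  next
    case False
    then have "{1..<K} = {}" by auto
    then show ?thesis by simp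
  qed
qed

text \<open>The slot of entrance is the only stop. This fits a vertex with a single bar towards its
  parent, and equally a starting vertex whose parent edge is silent, with \<open>j\<close> marking
  the end of a turn of the cycle. The same \<open>s\<close> must serve all depths \<open>n\<close>
  and all fine meshes \<open>K\<close>.\<close>

definition return_prob_le :: "nat \<Rightarrow> real \<Rightarrow> real \<Rightarrow> bool" where
  "return_prob_le d T s \<longleftrightarrow> (\<exists>K0. \<forall>K\<ge>K0. \<forall>N n v j. tree_vertex d v \<longrightarrow> length v + n \<le> N \<longrightarrow> j < K \<longrightarrow>
    bernoulli_field.pr (idx d K N) (1 - exp (- T / real K)) (\<lambda>\<eta>. \<exists>i. returns d K \<eta> n v {j} j i) \<le> s)"

text \<open>Supercritical branching: with mean M > 1 the map \<delta> to (\<delta> - d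
  \<open>\<delta>\<^sup>2\<close>) M does not decrease a small \<delta>, so a non-return probability
  of at least \<delta> is passed on from one depth to the next.\<close>

lemma returns_bound_few_bars:
  fixes T :: real
  assumes T: "T > 0" and d: "d \<ge> 1" and mean: "real d * T * exp (- T) * (1 - (real d - 1) * T\<^sup>2 / 6) > 1"
  shows "\<exists>s<1. return_prob_le d T s"
proof -
  define P where "P K = 1 - exp (- T / real K)" for K
  define M where "M K = real d * (\<Sum>y\<in>{1..<K}. P K * (1 - P K) ^ (K - 1) *
      (1 - (real d - 1) * (P K + real (y - 1) * real (K - y) * (P K)\<^sup>2)))" for K
  have P: "0 \<le> P K" "P K < 1" for K using T by (auto simp: P_def)
  have Plim: "(\<lambda>K. real K * P K) \<longlonglongrightarrow> T"
  proof (rule tendsto_sandwich)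
    show "\<forall>\<^sub>F K in sequentially. T / (1 + T / real K) \<le> real K * P K"
    proof (intro eventually_sequentiallyI[of 1])
      fix K :: nat assume K: "K \<ge> 1"
      have "T / (1 + T / real K) = real K * ((T / real K) / (1 + T / real K))" using K by simp
      also have "\<dots> \<le> real K * P K"
        unfolding P_def using one_minus_exp_bounds(2)[of "T / real K"] T by (intro mult_left_mono) auto
      finally show "T / (1 + T / real K) \<le> real K * P K" .
    qed
    show "\<forall>\<^sub>F K in sequentially. real K * P K \<le> T"
    proof (intro eventually_sequentiallyI[of 1])
      fix K :: nat assume K: "K \<ge> 1"
      have "real K * P K \<le> real K * (T / real K)"
        unfolding P_def using one_minus_exp_bounds(1)[of "T / real K"] T by (intro mult_left_mono) auto
      then show "real K * P K \<le> T" using K by simp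
    qed
    have "(\<lambda>K. T / (1 + T / real K)) \<longlonglongrightarrow> T / (1 + 0)"
      by (intro tendsto_intros lim_const_over_n) simp
    then show "(\<lambda>K. T / (1 + T / real K)) \<longlonglongrightarrow> T" by simp
  qed simp
  have P0: "P \<longlonglongrightarrow> 0"
  proof (rule tendsto_sandwich[where f = "\<lambda>_. 0" and h = "\<lambda>K. T / real K"])
    show "\<forall>\<^sub>F K in sequentially. P K \<le> T / real K"
      unfolding P_def using one_minus_exp_bounds(1)[of "T / real K" for K] T by (intro always_eventually) auto
  qed (use P lim_const_over_n[of T] in auto)
  \<comment> \<open>A lower bound for \<open>M K\<close> whose limit can be read off. The
    exponential is \<open>(1 - P K) ^ (K - 1)\<close>, and the last term comes from
    \<open>sum_triangle\<close>.\<close>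
  define L where "L K = real d * exp (- (T - T / real K)) * (real K * P K * (1 - (real d - 1) * P K) - P K * (1 - (real d - 1) * P K) -
     (real d - 1) * (real K * P K) ^ 3 / 6)" for K
  have LM: "L K \<le> M K" if K: "K \<ge> 1" for K
  proof -
    have e: "(1 - P K) ^ (K - 1) = exp (- (T - T / real K))"
      using K by (simp add: P_def of_nat_diff field_simps flip: exp_of_nat_mult)
    let ?C = "real d * exp (- (T - T / real K))"
    have M: "M K = ?C * (\<Sum>y\<in>{1..<K}. P K * (1 - (real d - 1) * P K) -
        (real d - 1) * (P K) ^ 3 * (real (y - 1) * real (K - y)))"
      unfolding M_def e by (simp add: sum_distrib_left algebra_simps power2_eq_square power3_eq_cube)
    have "(\<Sum>y\<in>{1..<K}. P K * (1 - (real d - 1) * P K) - (real d - 1) * (P K) ^ 3 * (real (y - 1) * real (K - y))) =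
      real (K - 1) * (P K * (1 - (real d - 1) * P K)) - (real d - 1) * (P K) ^ 3 * (\<Sum>y\<in>{1..<K}. real (y - 1) * real (K - y))"
      by (simp add: sum_subtractf sum_distrib_left)
    also have "\<dots> \<ge> real (K - 1) * (P K * (1 - (real d - 1) * P K)) - (real d - 1) * (P K) ^ 3 * (real K ^ 3 / 6)" (is "?l \<le> ?r")
      using P d by (intro diff_left_mono mult_left_mono sum_triangle) auto
    finally have "M K \<ge> ?C * ?l"
      unfolding M by (intro mult_left_mono) auto
    also have "?l = real K * P K * (1 - (real d - 1) * P K) - P K * (1 - (real d - 1) * P K) -
     (real d - 1) * (real K * P K) ^ 3 / 6"
    proof -
      have "real (K - 1) * Z = real K * Z - Z" for Z using K by (simp add: of_nat_diff left_diff_distrib)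
      moreover have "(real d - 1) * P K ^ 3 * (real K ^ 3 / 6) = (real d - 1) * (real K * P K) ^ 3 / 6"
        unfolding power_mult_distrib by (simp only: times_divide_eq_right mult_ac)
      ultimately show ?thesis by (simp only: mult.assoc)
    qed
    finally show ?thesis by (simp add: L_def)
  qed
  have "L \<longlonglongrightarrow> real d * exp (- (T - 0)) * (T * (1 - (real d - 1) * 0) - 0 * (1 - (real d - 1) * 0) - (real d - 1) * T ^ 3 / 6)"
    unfolding L_def by (intro tendsto_intros Plim P0 lim_const_over_n) simp
  also have "real d * exp (- (T - 0)) * (T * (1 - (real d - 1) * 0) - 0 * (1 - (real d - 1) * 0) - (real d - 1) * T ^ 3 / 6) =
      real d * T * exp (- T) * (1 - (real d - 1) * T\<^sup>2 / 6)"
    by (simp add: algebra_simps power2_eq_square power3_eq_cube)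
  finally have lim: "L \<longlonglongrightarrow> real d * T * exp (- T) * (1 - (real d - 1) * T\<^sup>2 / 6)" .
  define \<gamma> where "\<gamma> = (real d * T * exp (- T) * (1 - (real d - 1) * T\<^sup>2 / 6) - 1) / 2"
  have \<gamma>: "\<gamma> > 0" "1 + \<gamma> < real d * T * exp (- T) * (1 - (real d - 1) * T\<^sup>2 / 6)"
    using mean by (auto simp: \<gamma>_def field_simps)
  from order_tendstoD(1)[OF lim \<gamma>(2)] obtain K1 where K1: "\<And>K. K \<ge> K1 \<Longrightarrow> 1 + \<gamma> < L K"
    unfolding eventually_sequentially by blast
  \<comment> \<open>Chosen so that 1 - d \<delta> = 1 / (1 + \<gamma>), which exactly compensates
    the lower bound 1 + \<gamma> for the mean.\<close>
  define \<delta> where "\<delta> = \<gamma> / ((1 + \<gamma>) * real d)"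
  have d\<delta>: "real d * \<delta> = \<gamma> / (1 + \<gamma>)" using d by (simp add: \<delta>_def)
  have \<delta>: "0 < \<delta>" "real d * \<delta> \<le> 1" using \<gamma> d unfolding d\<delta> by (auto simp: \<delta>_def)
  have \<delta>1: "\<delta> \<le> 1" using order_trans[OF mult_right_mono[of 1 "real d" \<delta>] \<delta>(2)] \<delta>(1) d by simp
  have \<delta>M: "(\<delta> - real d * \<delta>\<^sup>2) * M K \<ge> \<delta>" if "K \<ge> max 1 K1" for K
  proof -
    have "\<delta> = \<delta> * ((1 - real d * \<delta>) * (1 + \<gamma>))" unfolding d\<delta> using \<gamma> by (simp add: field_simps)
    also have "\<dots> \<le> \<delta> * ((1 - real d * \<delta>) * M K)"
      using \<delta> K1[of K] LM[of K] that by (intro mult_left_mono) auto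
    finally show ?thesis by (simp add: algebra_simps power2_eq_square)
  qed
  show ?thesis unfolding return_prob_le_def
  proof (intro exI[of _ "1 - \<delta>"] exI[of _ "max 1 K1"] conjI allI impI)
    fix K N n v j
    assume KK: "max 1 K1 \<le> K" and v: "tree_vertex d v" "length v + n \<le> N" and j: "j < K"
    interpret tree_field d K N "P K" using KK P by unfold_locales auto
    show "bernoulli_field.pr (idx d K N) (1 - exp (- T / real K)) (\<lambda>\<eta>. \<exists>i. returns d K \<eta> n v {j} j i) \<le> 1 - \<delta>"
      unfolding P_def[symmetric] using v j
    proof (induction n arbitrary: v j)
      case 0
      then show ?case using \<delta>1 by (simp add: pr_def)
    next
      case (Suc n)
      have "pr (\<lambda>\<eta>. \<exists>i. returns d K \<eta> (Suc n) v {j} j i) \<le> 1 - (\<delta> - real d * \<delta>\<^sup>2) * M K"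
        unfolding M_def
      proof (rule returns_step_few_bars)
        fix c i assume c: "c < d" "i < K"
        have "pr (\<lambda>\<eta>. returns d K \<eta> n (c # v) {i} i i) \<le> pr (\<lambda>\<eta>. \<exists>i'. returns d K \<eta> n (c # v) {i} i i')"
          by (rule pr_mono) blast
        also have "\<dots> \<le> 1 - \<delta>"
          by (rule Suc.IH) (use Suc.prems c in \<open>auto simp: tree_vertex_def\<close>)
        finally show "pr (\<lambda>\<eta>. returns d K \<eta> n (c # v) {i} i i) \<le> 1 - \<delta>" .
      qed (use Suc.prems \<delta> \<delta>1 in auto)
      then show ?case using \<delta>M[OF KK] by linarith
    qed
  qed (use \<delta> in simp)
qed

text \<open>The recursion is about q = small + small q + \<open>(d A)\<^sup>2\<close>
  \<open>q\<^sup>2\<close> with d A \<le> 11/10. Any value well between its small fixed point and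
  the one near 1 is preserved; at q = 1/4 the right side is about 1/10.\<close>

lemma returns_bound_many_bars:
  fixes T :: real
  assumes d: "d \<ge> 10 ^ 6" and T: "T * sqrt (real d) \<ge> 1"
  shows "\<exists>s<1. return_prob_le d T s"
proof -
  define S where "S = sqrt (real d)"
  have "sqrt (1000\<^sup>2) \<le> S" unfolding S_def using d by (intro real_sqrt_le_mono) simp
  then have S: "S \<ge> 1000" by simp
  have SS: "S * S = real d" by (simp add: S_def)
  have T0: "T > 0" using T S zero_less_mult_pos2[of T S] unfolding S_def[symmetric] by linarith
  have dr: "real d \<ge> 10 ^ 6" using d by (metis of_nat_le_iff of_nat_numeral of_nat_power)
  show ?thesis unfolding return_prob_le_def
  \<comment> \<open>With K at least T d^2 the slots have length at most 1/d^2, so p is negligible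
    even after multiplication by d.\<close>
  proof (intro exI[of _ "1/4"] exI[of _ "nat \<lceil>T * (real d)\<^sup>2\<rceil> + 1"] conjI allI impI)
    fix K N n v j
    assume K0: "nat \<lceil>T * (real d)\<^sup>2\<rceil> + 1 \<le> K" and v: "tree_vertex d v" "length v + n \<le> N" and j: "j < K"
    have K: "K > 0" "T * (real d)\<^sup>2 \<le> real K" using K0 by linarith+
    define h where "h = T / real K"
    define p where "p = 1 - exp (- T / real K)"
    \<comment> \<open>Length of the window in time. The edges to the children ring about d r = sqrt
      d / 4 times in it, so silence is unlikely; a given edge rings with probability at most about
      r; and r \<le> T/4 makes room for two windows.\<close>
    define r where "r = 1 / (4 * S)"
    define w where "w = nat \<lfloor>r / h\<rfloor>"
    have h0: "h > 0" using T0 K by (simp add: h_def)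
    have hd: "h \<le> 1 / (real d)\<^sup>2" using K dr unfolding h_def by (simp add: field_simps)
    have p: "0 \<le> p" "p < 1" "p \<le> h"
      using h0 one_minus_exp_bounds(1)[of h] by (auto simp: p_def h_def)
    have p12: "p \<le> 1 / 10 ^ 12"
    proof -
      have "(10 ^ 6)\<^sup>2 \<le> (real d)\<^sup>2" using dr by (intro power_mono) auto
      then have "1 / (real d)\<^sup>2 \<le> 1 / 10 ^ 12" using dr by (intro divide_left_mono) auto
      then show ?thesis using p hd by linarith
    qed
    have r0: "r > 0" using S by (simp add: r_def)
    have w1: "real w \<le> r / h" "r / h < real w + 1" using r0 h0 unfolding w_def by auto
    have wh: "real w * h \<le> r" using w1(1) h0 by (simp add: field_simps)
    have wh': "r - h \<le> real w * h" using w1(2) h0 by (simp add: field_simps)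
    have "r \<le> T / 4" using T S unfolding r_def S_def[symmetric] by (simp add: field_simps)
    then have "real w * (T / real K) \<le> T / 4" using wh unfolding h_def by linarith
    then have "T * real w \<le> T * (real K / 4)" using K by (simp add: field_simps)
    then have "real w \<le> real K / 4" using T0 by (simp only: mult_le_cancel_left_pos)
    then have w: "2 * w < K" using K by linarith
    have rS: "r \<le> 1 / 4000" using S by (simp add: r_def field_simps)
    define a where "a = (1 - p) ^ (d - 2)"
    define A where "A = (\<Sum>x\<in>{1..w}. p * a ^ (x - 1))"
    have aw: "a ^ w \<le> 1 / 60"
    proof -
      have "a ^ w = exp (- (real (d - 2) * (real w * h)))"
        unfolding a_def p_def h_def by (simp add: mult.assoc flip: exp_of_nat_mult power_mult)
      \<comment> \<open>From d - 2 \<ge> d/2 and w h \<ge> r/2 the exponent is at least S/16, and S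
        \<ge> 1000.\<close>
      also have "\<dots> \<le> exp (- 60)"
      proof -
        have h2: "h \<le> r / 2"
        proof -
          have "8 * S \<le> (real d)\<^sup>2"
          proof -
            have "8 * S \<le> (S * S) * S" using S by (intro mult_right_mono) (auto intro: order_trans[OF _ mult_mono[of 1000 S 1000 S]])
            also have "\<dots> \<le> (S * S) * (S * S)" using S by (intro mult_left_mono) auto
            finally show ?thesis by (simp add: SS power2_eq_square)
          qed
          then have "1 / (real d)\<^sup>2 \<le> 1 / (8 * S)" using S dr by (intro divide_left_mono) auto
          then show ?thesis using hd S by (simp add: r_def)
        qed
        have "60 \<le> S / 16" using S by simp
        also have "\<dots> = (real d / 2) * (r / 2)" using S by (simp add: r_def flip: SS)
        also have "\<dots> \<le> real (d - 2) * (real w * h)"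
          using wh' h2 r0 dr by (intro mult_mono) auto
        finally show ?thesis by (simp del: of_nat_diff)
      qed
      also have "\<dots> \<le> 1 / (1 + 60)" using one_minus_exp_bounds(2)[of 60] by simp
      finally show ?thesis by simp
    qed
    have a0: "0 \<le> a" using p by (simp add: a_def)
    have dA: "real d * A \<le> 11 / 10"
    proof -
      have "A \<le> 1 / real (d - 2) + p"
        unfolding A_def a_def using p d by (intro geometric_sum_le) auto
      then have "real d * A \<le> real d * (1 / real (d - 2)) + real d * p"
        unfolding distrib_left[symmetric] by (intro mult_left_mono) auto
      moreover have "real d * (1 / real (d - 2)) \<le> 105 / 100"
        using d dr by (simp add: of_nat_diff field_simps)
      moreover have "real d * p \<le> 1 / 10 ^ 6"
      proof -
        have "real d * p \<le> real d * (1 / (real d)\<^sup>2)" using p hd by (intro mult_left_mono) auto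
        also have "\<dots> = 1 / real d" using dr by (simp add: power2_eq_square)
        also have "\<dots> \<le> 1 / 10 ^ 6" using dr by (intro divide_left_mono) auto
        finally show ?thesis .
      qed
      ultimately have "real d * A \<le> 105 / 100 + 1 / 10 ^ 6" by (rule order_trans[OF _ add_mono])
      then show ?thesis by simp
    qed
    have A0: "A \<ge> 0" unfolding A_def using p a0 by (intro sum_nonneg) auto
    have A: "A \<le> 1 / 100000"
    proof -
      have "10 ^ 6 * A \<le> real d * A" using dr A0 by (intro mult_right_mono) auto
      then have "1000000 * A \<le> 11 / 10" using dA by simp
      then show ?thesis by simp
    qed
    interpret tree_field d K N p using K p by unfold_locales auto
    have "pr (\<lambda>\<eta>. \<exists>i. returns d K \<eta> n v (insert j (bars K \<eta> v)) j i) \<le> 1/4"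
      using v j
    proof (induction n arbitrary: v j)
      case 0
      then show ?case by (simp add: pr_def)
    next
      case (Suc n)
      have "pr (\<lambda>\<eta>. \<exists>i. returns d K \<eta> (Suc n) v (insert j (bars K \<eta> v)) j i) \<le>
        a ^ w + A + real d * (A * (real (w + 1) * p)) +
        real d * (A * (1/4 * a ^ w)) + real d * (A * (A * (1/4))) + real d * (A * (A * (1/4 / (1 - p)))) +
        real d * (real d * (A * (A * (1/4)\<^sup>2)))"
        unfolding A_def a_def
      proof (rule returns_step_many_bars)
        fix c i assume "c < d" "i < K"
        then show "pr (\<lambda>\<eta>. \<exists>i'. returns d K \<eta> n (c # v) (insert i (bars K \<eta> (c # v))) i i') \<le> 1/4"
          using Suc.prems by (intro Suc.IH) (auto simp: tree_vertex_def)
      qed (use Suc.prems w in auto)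
      also have "\<dots> = a ^ w + A + (real d * A) * (real (w + 1) * p) + (real d * A) * (1/4 * a ^ w) +
          (real d * A) * (A * (1/4)) + (real d * A) * (A * (1/4 / (1 - p))) + (real d * A) * (real d * A) * (1/16)"
        by (simp add: power2_eq_square mult_ac)
      also have "\<dots> \<le> 1/60 + 1/100000 + 11/10 * (1/1000) + 11/10 * (1/4 * (1/60)) +
          11/10 * (1/100000 * (1/4)) + 11/10 * (1/100000 * (1/2)) + 11/10 * (11/10) * (1/16)"
      proof (intro add_mono mult_mono dA A aw)
        have "real (w + 1) * p \<le> real w * h + p" using mult_left_mono[OF p(3), of "real w"] by (simp add: algebra_simps)
        then show "real (w + 1) * p \<le> 1/1000" using wh rS p12 by simp
        show "1/4 / (1 - p) \<le> 1/2" using p12 by (simp add: field_simps)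
      qed (use A0 a0 p in auto)
      also have "\<dots> \<le> 1/4" by simp
      finally show ?case .
    qed
    moreover have "pr (\<lambda>\<eta>. \<exists>i. returns d K \<eta> n v {j} j i) \<le> pr (\<lambda>\<eta>. \<exists>i. returns d K \<eta> n v (insert j (bars K \<eta> v)) j i)"
      by (rule pr_mono) (use returns_more_stops[of d K _ n v "{j}" j _ "insert j _"] in blast)
    ultimately show "bernoulli_field.pr (idx d K N) (1 - exp (- T / real K)) (\<lambda>\<eta>. \<exists>i. returns d K \<eta> n v {j} j i) \<le> 1/4"
      unfolding p_def by linarith
  qed simp
qed

text \<open>Put \<theta> = d T and u = 1/d. Since exp (-T) \<ge> 1 - T, the mean is at least
  \<theta> - (\<open>\<theta>\<^sup>2\<close> + \<open>\<theta> ^ 3\<close> / 6) u. At \<theta> = 1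
  the coefficient of u is 1 + 1/6; the surplus \<epsilon> u in \<theta> pays for its growth when
  \<theta> exceeds 1.\<close>

lemma mean_visited_gt_1:
  fixes T \<epsilon> :: real
  assumes \<epsilon>: "0 < \<epsilon>" "\<epsilon> \<le> 1" and d: "real d \<ge> 1000" "real d * \<epsilon> \<ge> 1000"
    and T: "1 / real d + (7/6 + \<epsilon>) / (real d)\<^sup>2 \<le> T" "T * sqrt (real d) \<le> 1"
  shows "real d * T * exp (- T) * (1 - (real d - 1) * T\<^sup>2 / 6) > 1"
proof -
  define u where "u = 1 / real d"
  define \<theta> where "\<theta> = real d * T"
  have u: "0 < u" "u \<le> 1/1000" using d by (auto simp: u_def field_simps)
  have u\<epsilon>: "1000 * u \<le> \<epsilon>" using d by (simp add: u_def field_simps)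
  have Tu: "T = \<theta> * u" using d by (simp add: u_def \<theta>_def)
  have \<theta>1: "1 + (7/6 + \<epsilon>) * u \<le> \<theta>"
  proof -
    have "1 + (7/6 + \<epsilon>) * u = real d * (1 / real d + (7/6 + \<epsilon>) / (real d)\<^sup>2)"
      using d unfolding u_def power2_eq_square distrib_left by simp
    also have "\<dots> \<le> \<theta>" unfolding \<theta>_def using T(1) by (intro mult_left_mono) auto
    finally show ?thesis .
  qed
  have "(7/6 + \<epsilon>) * u > 0" using u \<epsilon> by (intro mult_pos_pos) auto
  then have \<theta>0: "\<theta> > 0" using \<theta>1 by linarith
  have dT: "real d * T\<^sup>2 \<le> 1"
  proof -
    have "(T * sqrt (real d))\<^sup>2 \<le> 1\<^sup>2" using T(2) Tu \<theta>0 u by (intro power_mono) auto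
    then show ?thesis by (simp add: power_mult_distrib mult.commute)
  qed
  have dT': "real d * T\<^sup>2 = \<theta>\<^sup>2 * u" using d by (simp add: \<theta>_def u_def power2_eq_square)
  have T0: "T > 0" using Tu \<theta>0 u by simp
  have f: "0 \<le> 1 - \<theta>\<^sup>2 * u / 6" "1 - \<theta>\<^sup>2 * u / 6 \<le> 1 - (real d - 1) * T\<^sup>2 / 6"
    using dT dT' by (auto simp: algebra_simps)
  have "T \<le> 1/30"
  proof -
    have "30 \<le> sqrt (real d)" using d by (intro real_le_rsqrt) simp
    then have "T * 30 \<le> T * sqrt (real d)" using T0 by (intro mult_left_mono) auto
    then show ?thesis using T(2) by simp
  qed
  have e: "1 - T \<le> exp (- T)" using exp_ge_add_one_self[of "- T"] by simp
  have low: "\<theta> * (1 - T) * (1 - \<theta>\<^sup>2 * u / 6) \<le> real d * T * exp (- T) * (1 - (real d - 1) * T\<^sup>2 / 6)"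
    unfolding \<theta>_def[symmetric] using \<theta>0 e f \<open>T \<le> 1/30\<close> by (intro mult_mono) auto
  show ?thesis
  \<comment> \<open>For larger \<theta> the crude bounds T \<le> 1/30 and d T^2 \<le> 1 suffice: 3/2
    * 29/30 * 5/6 > 1.\<close>
  proof (cases "\<theta> \<le> 3/2")
    case False
    have "1 < 3/2 * (29/30) * (5/6 :: real)" by simp
    also have "\<dots> \<le> \<theta> * (1 - T) * (1 - \<theta>\<^sup>2 * u / 6)"
      using False \<open>T \<le> 1/30\<close> dT dT' by (intro mult_mono) auto
    finally show ?thesis using low by linarith
  next
    case True
    define x where "x = \<theta> - 1"
    have x: "(7/6 + \<epsilon>) * u \<le> x" "0 \<le> x" "x \<le> 1/2"
      using \<theta>1 True \<open>(7/6 + \<epsilon>) * u > 0\<close> by (auto simp: x_def)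
    have "u * (4 * (7/6 + \<epsilon>)) < \<epsilon>"
    proof -
      have "u * (4 * (7/6 + \<epsilon>)) \<le> u * (26/3)" using u \<epsilon> by (intro mult_left_mono) auto
      then show ?thesis using u\<epsilon> u by linarith
    qed
    then have "u * (u * (4 * (7/6 + \<epsilon>))) < u * \<epsilon>" using u by (intro mult_strict_left_mono) auto
    moreover have "(7/6 + \<epsilon>) * u * (1 - 4 * u) \<le> x * (1 - 4 * u)" using x u by (intro mult_right_mono) auto
    moreover have "(7/6 + \<epsilon>) * u * (1 - 4 * u) = 7/6 * u + u * \<epsilon> - u * (u * (4 * (7/6 + \<epsilon>)))"
      by (simp add: field_simps)
    ultimately have 1: "7/6 * u < x * (1 - 4 * u)" by linarith
    have xx: "x * x \<le> x / 2" "x * (x * x) \<le> x / 4"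
      using x mult_left_mono[of x "1/2" x] mult_mono[of "x * x" "1/4" x x] mult_mono[of x "1/2" x "1/2"] by auto
    \<comment> \<open>Expansion in x = \<theta> - 1. For 0 \<le> x \<le> 1/2 the terms beyond 7/6
      sum to at most (5/2 + 3/4 + 1/24) x, which is below 4 x.\<close>
    have "(\<theta>\<^sup>2 + \<theta> ^ 3 / 6) * u \<le> (7/6 + 4 * x) * u"
    proof (rule mult_right_mono)
      have "\<theta>\<^sup>2 + \<theta> ^ 3 / 6 = 7/6 + 5/2 * x + 3/2 * (x * x) + (x * (x * x)) / 6"
        by (simp add: x_def field_simps power2_eq_square power3_eq_cube)
      also have "\<dots> \<le> 7/6 + 4 * x" using xx x(2) by linarith
      finally show "\<theta>\<^sup>2 + \<theta> ^ 3 / 6 \<le> 7/6 + 4 * x" .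
    qed (use u in simp)
    then have "1 < \<theta> - (\<theta>\<^sup>2 + \<theta> ^ 3 / 6) * u" using 1 by (simp add: x_def algebra_simps)
    also have "\<dots> \<le> \<theta> * (1 - T) * (1 - \<theta>\<^sup>2 * u / 6)"
    proof -
      have "\<theta> * (1 - T) * (1 - \<theta>\<^sup>2 * u / 6) = \<theta> - (\<theta>\<^sup>2 + \<theta> ^ 3 / 6) * u + \<theta> ^ 4 * u\<^sup>2 / 6"
        unfolding Tu by (simp add: field_simps power2_eq_square power3_eq_cube power4_eq_xxxx)
      moreover have "0 \<le> \<theta> ^ 4 * u\<^sup>2 / 6" using \<theta>0 by simp
      ultimately show ?thesis by linarith
    qed
    finally show ?thesis using low by linarith
  qed
qed

section \<open>The Poisson process of rings\<close>

text \<open>To be applied with f s the probability that the process started at time s avoids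
  \<open>U\<close>. In terms of H s = exp (-s) f s the equation says that H is the integral of
  itself over the part of [s, \<infinity>) outside \<open>U\<close>. Hence H is constant along
  \<open>U\<close>, and off \<open>U\<close> it solves H' = -H, so that f is constant.\<close>

lemma renewal_solution:
  fixes f :: "real \<Rightarrow> real"
  assumes eq: "\<And>s. ((\<lambda>u. if u \<in> U then 0 else exp (- u) * f u) has_integral exp (- s) * f s) {s..}"
    and ab: "a \<le> b"
  shows "{a<..b} \<subseteq> U \<Longrightarrow> f a = exp (- (b - a)) * f b"
    and "{a<..b} \<inter> U = {} \<Longrightarrow> f a = f b"
proof -
  define G where "G u = (if u \<in> U then 0 else exp (- u) * f u)" for u
  define H where "H u = exp (- u) * f u" for u
  have G: "(G has_integral H s) {s..}" for s unfolding G_def H_def by (rule eq)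
  have GH: "(G has_integral H s - H t) {s..t}" if "s \<le> t" for s t
  proof -
    have "((\<lambda>u. (if u \<in> {s..} then G u else 0) - (if u \<in> {t..} then G u else 0)) has_integral H s - H t) UNIV"
      by (intro has_integral_diff has_integral_restrict_UNIV[THEN iffD2] G)
    moreover have "(if u \<in> {s..} then G u else 0) - (if u \<in> {t..} then G u else 0) = (if u \<in> {s..<t} then G u else 0)" for u
      using that by auto
    ultimately have "(G has_integral H s - H t) {s..<t}" by (simp only: has_integral_restrict_UNIV)
    then show ?thesis
      by (subst (asm) has_integral_spike_set_eq[of _ "{s..t}"]) (auto intro: negligible_subset[of "{t}"])
  qed
  have Hf: "H u * exp u = f u" for u by (simp add: H_def mult.assoc flip: exp_add)
  show "f a = exp (- (b - a)) * f b" if "{a<..b} \<subseteq> U"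
  proof -
    have "((\<lambda>_. 0) has_integral H a - H b) {a..b}"
      by (rule has_integral_spike[OF negligible_sing[of a] _ GH[OF ab]]) (use that in \<open>force simp: G_def\<close>)
    then have "H a = H b" using has_integral_unique[OF has_integral_0] by fastforce
    then show ?thesis by (simp add: H_def exp_diff exp_minus field_simps)
  qed
  show "f a = f b" if "{a<..b} \<inter> U = {}"
  proof -
    \<comment> \<open>Nothing is known about the regularity of \<open>f\<close>. The integral
      equation first makes H continuous, being an indefinite integral, and then
      differentiable.\<close>
    have HH: "(H has_integral H u - H b) {u..b}" if "u \<in> {a..b}" for u
    proof (rule has_integral_spike[OF negligible_sing[of u] _ GH])
      show "H x = G x" if "x \<in> {u..b} - {u}" for x
      proof -
        have "x \<in> {a<..b}" using that \<open>u \<in> {a..b}\<close> by auto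
        then show ?thesis using \<open>{a<..b} \<inter> U = {}\<close> by (auto simp: G_def H_def)
      qed
    qed (use that in auto)
    then have e: "H u = H b + integral {u..b} H" if "u \<in> {a..b}" for u
      using that by (simp add: integral_unique[OF HH[OF that]])
    have "H integrable_on {a..b}" using HH[of a] ab by (auto simp: integrable_on_def)
    then have "continuous_on {a..b} (\<lambda>u. H b + integral {u..b} H)"
      by (intro continuous_intros indefinite_integral_continuous_1')
    then have c: "continuous_on {a..b} H"
      by (rule continuous_on_eq) (rule e[symmetric])
    have d1: "((\<lambda>u. H b + integral {u..b} H) has_real_derivative 0 - H x) (at x within {a..b})" if "x \<in> {a..b}" for x
      unfolding has_real_derivative_iff_has_vector_derivative diff_0
      using has_vector_derivative_add[OF has_vector_derivative_const integral_has_vector_derivative'[OF c that], of "H b"] by simp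
    have der: "(H has_real_derivative - H x) (at x within {a..b})" if "x \<in> {a..b}" for x
      using has_derivative_transform[OF that e d1[OF that, unfolded has_field_derivative_def]]
      by (simp add: has_field_derivative_def)
    have "((\<lambda>u. H u * exp u) has_real_derivative 0) (at x within {a..b})" if "x \<in> {a..b}" for x
      using that by (auto intro!: derivative_eq_intros der)
    then have "\<exists>c. \<forall>x\<in>{a..b}. H x * exp x = c"
      by (intro has_field_derivative_zero_constant) auto
    then have "H a * exp a = H b * exp b" using ab by fastforce
    then show ?thesis by (simp only: Hf)
  qed
qed

section \<open>Avoidance probabilities of one rate-one Poisson process\<close>

definition exp1 :: "real measure" where "exp1 = density lborel (exponential_density 1)"

lemma sets_exp1 [simp, measurable_cong]: "sets exp1 = sets borel"
  by (simp add: exp1_def)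

lemma space_exp1 [simp]: "space exp1 = UNIV"
  by (simp add: exp1_def)

interpretation exp1: prob_space exp1
  unfolding exp1_def by (rule prob_space_exponential_density) simp

abbreviation seq_space :: "(nat \<Rightarrow> real) measure" where
  "seq_space \<equiv> PiM UNIV (\<lambda>_. exp1)"

lemma sequence_space_exp1: "sequence_space exp1"
  by unfold_locales

lemma prob_space_seq: "prob_space seq_space"
  by (intro prob_space_PiM exp1.prob_space_axioms)

lemma AE_exp1_pos: "AE x in exp1. x > 0"
proof -
  have "AE x in lborel. x \<noteq> (0::real)" by (rule AE_lborel_singleton)
  then show ?thesis unfolding exp1_def
    by (subst AE_density) (auto simp: exponential_density_def)
qed

text \<open>The starting time \<open>s\<close> is a parameter so that the family is stable under
  removal of the first gap, which merely shifts \<open>s\<close>.\<close>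

definition avoids :: "real set \<Rightarrow> real \<Rightarrow> (nat \<Rightarrow> real) \<Rightarrow> bool" where
  "avoids U s x \<longleftrightarrow> (\<forall>n. s + (\<Sum>k\<le>n. x k) \<notin> U)"

lemma avoids_case_nat: "avoids U s (case_nat t x) \<longleftrightarrow> s + t \<notin> U \<and> avoids U (s + t) x"
proof -
  have "(\<Sum>k\<le>Suc n. case_nat t x k) = t + (\<Sum>k\<le>n. x k)" for n
    by (simp add: sum.atMost_Suc_shift del: sum.atMost_Suc)
  then have "avoids U s (case_nat t x) \<longleftrightarrow> s + (\<Sum>k\<le>0. case_nat t x k) \<notin> U \<and> (\<forall>n. s + (t + (\<Sum>k\<le>n. x k)) \<notin> U)"
    unfolding avoids_def by (metis not0_implies_Suc)
  then show ?thesis by (simp add: avoids_def add.assoc)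
qed

lemma measurable_avoids [measurable]:
  assumes [measurable]: "U \<in> sets borel"
  shows "Measurable.pred (borel \<Otimes>\<^sub>M seq_space) (\<lambda>(s, x). avoids U s x)"
  unfolding avoids_def by measurable

text \<open>Condition on the first gap t and substitute u = s + t; the density becomes exp (s) exp
  (-u).\<close>

lemma avoids_renewal:
  assumes U[measurable]: "U \<in> sets borel"
  defines "f \<equiv> \<lambda>s. measure seq_space {x \<in> space seq_space. avoids U s x}"
  shows "((\<lambda>u. if u \<in> U then 0 else exp (- u) * f u) has_integral exp (- s) * f s) {s..}"
proof -
  interpret S: prob_space seq_space by (rule prob_space_seq)
  let ?Q = "{z \<in> space (exp1 \<Otimes>\<^sub>M seq_space). s + fst z \<notin> U \<and> avoids U (s + fst z) (snd z)}"
  have [measurable]: "?Q \<in> sets (exp1 \<Otimes>\<^sub>M seq_space)" by measurable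
  have av[measurable]: "{x \<in> space seq_space. avoids U s x} \<in> sets seq_space" for s
    by measurable
  have em: "emeasure seq_space {x \<in> space seq_space. avoids U s x} = ennreal (f s)" for s
    by (simp add: f_def S.emeasure_eq_measure)
  have fm[measurable]: "f \<in> borel_measurable borel"
    unfolding f_def measure_def by measurable
  have "ennreal (f s) = emeasure (distr (exp1 \<Otimes>\<^sub>M seq_space) seq_space (\<lambda>(t, x). case_nat t x)) {x \<in> space seq_space. avoids U s x}"
    by (simp add: em sequence_space.PiM_iter[OF sequence_space_exp1])
  also have "\<dots> = emeasure (exp1 \<Otimes>\<^sub>M seq_space) ?Q"
    by (subst emeasure_distr[OF _ av]) (auto intro!: arg_cong2[where f = emeasure] simp: avoids_case_nat space_pair_measure space_PiM)
  also have "\<dots> = (\<integral>\<^sup>+ t. \<integral>\<^sup>+ x. indicator ?Q (t, x) \<partial>seq_space \<partial>exp1)"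
    by (rule S.emeasure_pair_measure) fact
  also have "\<dots> = (\<integral>\<^sup>+ t. (if s + t \<in> U then 0 else ennreal (f (s + t))) \<partial>exp1)"
  proof (rule nn_integral_cong)
    fix t
    have "(\<integral>\<^sup>+ x. indicator ?Q (t, x) \<partial>seq_space) =
      (\<integral>\<^sup>+ x. (if s + t \<in> U then 0 else indicator {x \<in> space seq_space. avoids U (s + t) x} x) \<partial>seq_space)"
      by (intro nn_integral_cong) (auto simp: space_pair_measure indicator_def)
    also have "\<dots> = (if s + t \<in> U then 0 else ennreal (f (s + t)))" by (simp add: em)
    finally show "(\<integral>\<^sup>+ x. indicator ?Q (t, x) \<partial>seq_space) =
      (if s + t \<in> U then 0 else ennreal (f (s + t)))" .
  qed
  also have "\<dots> = (\<integral>\<^sup>+ t. ennreal (exponential_density 1 t) * (if s + t \<in> U then 0 else ennreal (f (s + t))) \<partial>lborel)"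
    unfolding exp1_def by (rule nn_integral_density) measurable
  finally have 1: "ennreal (f s) = (\<integral>\<^sup>+ t. ennreal (exponential_density 1 t) * (if s + t \<in> U then 0 else ennreal (f (s + t))) \<partial>lborel)" .
  define G where "G u = (if u \<in> {s..} then if u \<in> U then 0 else exp (- u) * f u else 0)" for u
  have Gm[measurable]: "G \<in> borel_measurable borel" unfolding G_def by measurable
  have G0: "G u \<ge> 0" for u by (simp add: G_def f_def)
  have "(\<integral>\<^sup>+ u. ennreal (G u) \<partial>lborel) = (\<integral>\<^sup>+ t. ennreal (G (s + t)) \<partial>lborel)"
    using nn_integral_real_affine[of "\<lambda>u. ennreal (G u)" 1 s] by simp
  also have "\<dots> = (\<integral>\<^sup>+ t. ennreal (exp (- s)) * (ennreal (exponential_density 1 t) * (if s + t \<in> U then 0 else ennreal (f (s + t)))) \<partial>lborel)"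
  proof (rule nn_integral_cong)
    fix t
    have f0: "f (s + t) \<ge> 0" by (simp add: f_def)
    show "ennreal (G (s + t)) = ennreal (exp (- s)) * (ennreal (exponential_density 1 t) * (if s + t \<in> U then 0 else ennreal (f (s + t))))"
      using f0 by (auto simp: G_def exponential_density_def mult.assoc exp_diff exp_minus divide_inverse simp flip: ennreal_mult)
  qed
  also have "\<dots> = ennreal (exp (- s)) * ennreal (f s)"
    unfolding 1 by (rule nn_integral_cmult) measurable
  also have "\<dots> = ennreal (exp (- s) * f s)" by (simp add: ennreal_mult f_def)
  finally have "(\<integral>\<^sup>+ u. ennreal (G u) \<partial>lborel) = ennreal (exp (- s) * f s)" .
  then have "(G has_integral exp (- s) * f s) UNIV"
    by (intro nn_integral_has_integral) (auto simp: G0 f_def)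
  then show ?thesis unfolding G_def by (subst (asm) has_integral_restrict_UNIV)
qed

lemma AE_seq_pos: "AE x in seq_space. \<forall>n. x n > 0"
  unfolding AE_all_countable
  by (intro allI AE_PiM_component exp1.prob_space_axioms AE_exp1_pos) simp

text \<open>Void probabilities determine the joint law of the occupied slots. They are computed
  backwards in time from K h: by \<open>renewal_solution\<close> each slot in \<open>J\<close>
  contributes a factor exp (-h), each other slot the factor 1.\<close>

lemma void_probability_seq:
  assumes h: "h > 0" and J: "J \<subseteq> {..<K}"
  shows "measure seq_space {x \<in> space seq_space. avoids (\<Union>j\<in>J. {real j * h<..real (Suc j) * h}) 0 x} = exp (- h) ^ card J"
proof -
  define U where "U = (\<Union>j\<in>J. {real j * h<..real (Suc j) * h})"
  have finJ: "finite J" using J finite_subset by blast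
  have U[measurable]: "U \<in> sets borel" unfolding U_def using finJ by measurable
  interpret S: prob_space seq_space by (rule prob_space_seq)
  define f where "f s = measure seq_space {x \<in> space seq_space. avoids U s x}" for s
  note ren = renewal_solution[OF avoids_renewal[OF U], folded f_def]
  have slot: "i = j" if "u \<in> {real i * h<..real (Suc i) * h}" "u \<in> {real j * h<..real (Suc j) * h}" for u i j
  proof -
    have "real i * h < real (Suc j) * h" "real j * h < real (Suc i) * h" using that by auto
    then show ?thesis using h by simp
  qed
  have step: "f (real j * h) = (if j \<in> J then exp (- h) else 1) * f (real (Suc j) * h)" for j
  proof (cases "j \<in> J")
    case True
    then have "{real j * h<..real (Suc j) * h} \<subseteq> U" by (auto simp: U_def)
    from ren(1)[OF _ this] h True show ?thesis by (simp add: algebra_simps)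
  next
    case False
    then have "{real j * h<..real (Suc j) * h} \<inter> U = {}" using slot unfolding U_def by blast
    from ren(2)[OF _ this] h False show ?thesis by (simp add: algebra_simps)
  qed
  \<comment> \<open>All gaps are positive, so a process started at the end of the last slot never
    meets \<open>U\<close>.\<close>
  have fK: "f (real K * h) = 1"
    unfolding f_def
  proof (rule S.prob_Collect_eq_1[THEN iffD2])
    show "{x \<in> space seq_space. avoids U (real K * h) x} \<in> S.events" by measurable
    show "AE x in seq_space. avoids U (real K * h) x"
      using AE_seq_pos
    proof eventually_elim
      case (elim x)
      show ?case unfolding avoids_def
      proof (intro allI notI)
        fix n assume "real K * h + (\<Sum>k\<le>n. x k) \<in> U"
        then obtain j where j: "j \<in> J" "real K * h + (\<Sum>k\<le>n. x k) \<le> real (Suc j) * h" by (auto simp: U_def)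
        have "0 < (\<Sum>k\<le>n. x k)" using elim by (intro sum_pos) auto
        then have "real K * h < real (Suc j) * h" using j by linarith
        then have "K < Suc j" using h by simp
        then show False using j J by auto
      qed
    qed
  qed
  have "f (real (K - i) * h) = exp (- h) ^ card (J \<inter> {K - i..})" if "i \<le> K" for i
    using that
  proof (induction i)
    case 0
    have "J \<inter> {K..} = {}" using J by auto
    then show ?case using fK by simp
  next
    case (Suc i)
    define j where "j = K - Suc i"
    have j: "K - i = Suc j" using Suc.prems by (simp add: j_def)
    have "J \<inter> {j..} = (if j \<in> J then insert j (J \<inter> {Suc j..}) else J \<inter> {Suc j..})"
      by (auto simp: Suc_le_eq le_less)
    then have "card (J \<inter> {j..}) = (if j \<in> J then Suc (card (J \<inter> {Suc j..})) else card (J \<inter> {Suc j..}))"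
      using finJ by simp
    then show ?case using Suc.IH Suc.prems step[of j] by (simp add: j flip: j_def)
  qed
  from this[of K] have "f 0 = exp (- h) ^ card J" by simp
  then show ?thesis by (simp add: f_def U_def)
qed

section \<open>The occupied slots of the stirring space form a Bernoulli field\<close>

lemma stir_space_eq: "stir_space = PiM UNIV (\<lambda>_. exp1)"
  by (simp add: stir_space_def exp1_def)

lemma space_stir_space [simp]: "space stir_space = UNIV"
  by (simp add: stir_space_eq space_PiM)

interpretation stir: prob_space stir_space
  unfolding stir_space_eq by (intro prob_space_PiM exp1.prob_space_axioms)

definition arrival :: "(nat list \<times> nat \<Rightarrow> real) \<Rightarrow> nat list \<Rightarrow> nat \<Rightarrow> real" where
  "arrival \<omega> c n = (\<Sum>k\<le>n. \<omega> (c, k))"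

definition slot :: "real \<Rightarrow> nat \<Rightarrow> real set" where
  "slot h j = {real j * h<..real (Suc j) * h}"

definition occ :: "real \<Rightarrow> (nat list \<times> nat \<Rightarrow> real) \<Rightarrow> nat list \<times> nat \<Rightarrow> bool" where
  "occ h \<omega> z \<longleftrightarrow> (\<exists>n. arrival \<omega> (fst z) n \<in> slot h (snd z))"

lemma measurable_coordinate [measurable]: "(\<lambda>\<omega>. \<omega> z) \<in> borel_measurable stir_space"
  using measurable_component_singleton[of z UNIV "\<lambda>_. exp1"] by (simp add: stir_space_eq cong: measurable_cong_sets)

lemma measurable_arrival [measurable]: "(\<lambda>\<omega>. arrival \<omega> c n) \<in> borel_measurable stir_space"
  unfolding arrival_def by measurable

lemma measurable_occ [measurable]: "Measurable.pred stir_space (\<lambda>\<omega>. occ h \<omega> z)"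
  unfolding occ_def slot_def by measurable

lemma not_occ_iff_avoids:
  "(\<forall>j\<in>J. \<not> occ h \<omega> (c, j)) \<longleftrightarrow> avoids (\<Union>j\<in>J. slot h j) 0 (\<lambda>k. \<omega> (c, k))"
  by (auto simp: occ_def avoids_def arrival_def)

lemma void_probability_edge:
  assumes h: "h > 0" and J: "finite J"
  shows "stir.prob {\<omega>. \<forall>j\<in>J. \<not> occ h \<omega> (c, j)} = exp (- h) ^ card J"
proof -
  obtain K where K: "J \<subseteq> {..<K}" using finite_nat_iff_bounded J by blast
  let ?U = "\<Union>j\<in>J. slot h j"
  have [measurable]: "?U \<in> sets borel" using J unfolding slot_def by measurable
  have av: "{x \<in> space seq_space. avoids ?U 0 x} \<in> sets seq_space" by measurable
  let ?r = "\<lambda>\<omega> n. \<omega> (c, n)"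
  have d: "distr stir_space seq_space ?r = seq_space"
    using distr_PiM_reindex[of UNIV "\<lambda>_. exp1" "Pair c" UNIV] exp1.prob_space_axioms
    by (simp add: stir_space_eq inj_on_def restrict_UNIV)
  have m: "?r \<in> measurable stir_space seq_space"
    using measurable_restrict[of UNIV "\<lambda>n \<omega>. \<omega> (c, n)" stir_space "\<lambda>_. exp1"]
    by (simp add: restrict_UNIV stir_space_eq measurable_component_singleton)
  have "stir.prob {\<omega>. \<forall>j\<in>J. \<not> occ h \<omega> (c, j)} = measure (distr stir_space seq_space ?r) {x \<in> space seq_space. avoids ?U 0 x}"
    by (subst measure_distr[OF m av]) (auto intro!: arg_cong[where f = stir.prob] simp: not_occ_iff_avoids space_PiM)
  also have "\<dots> = exp (- h) ^ card J"
    unfolding d using void_probability_seq[OF h K] by (simp add: slot_def)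
  finally show ?thesis .
qed

text \<open>Different edges read disjoint blocks of coordinates, so their void events are
  independent.\<close>

lemma void_probability:
  assumes h: "h > 0" and Z: "finite Z"
  shows "stir.prob {\<omega>. \<forall>z\<in>Z. \<not> occ h \<omega> z} = exp (- h) ^ card Z"
proof (cases "Z = {}")
  case True
  then show ?thesis using stir.prob_space by simp
next
  case False
  define C where "C = fst ` Z"
  define J where "J c = {j. (c, j) \<in> Z}" for c
  have finC: "finite C" using Z by (simp add: C_def)
  have finJ: "finite (J c)" for c
    by (rule finite_subset[of _ "snd ` Z"]) (use Z in \<open>force simp: J_def image_iff\<close>)+
  have Zeq: "Z = Sigma C J" by (force simp: C_def J_def)
  have "stir.indep_vars (\<lambda>_. exp1) (\<lambda>i \<omega>. \<omega> i) UNIV"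
  proof (subst stir.indep_vars_iff_distr_eq_PiM)
    show "distr stir_space (PiM UNIV (\<lambda>_. exp1)) (\<lambda>x. \<lambda>i\<in>UNIV. x i) =
      PiM UNIV (\<lambda>i. distr stir_space exp1 (\<lambda>\<omega>. \<omega> i))"
      unfolding stir_space_eq restrict_UNIV
      using distr_PiM_component[of "UNIV :: (nat list \<times> nat) set" "\<lambda>_. exp1"]
      by (simp add: exp1.prob_space_axioms distr_id[unfolded id_def])
  qed (auto simp: stir_space_eq)
  from stir.indep_vars_restrict[OF this, of C "\<lambda>c. {c} \<times> UNIV"]
  have ind: "stir.indep_vars (\<lambda>c. PiM ({c} \<times> UNIV) (\<lambda>_. exp1)) (\<lambda>c \<omega>. restrict \<omega> ({c} \<times> UNIV)) C"
    by (auto simp: disjoint_family_on_def)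
  let ?A = "\<lambda>c. {x \<in> space (PiM ({c} \<times> UNIV) (\<lambda>_. exp1)). avoids (\<Union>j\<in>J c. slot h j) 0 (\<lambda>k. x (c, k))}"
  have A: "?A c \<in> sets (PiM ({c} \<times> UNIV) (\<lambda>_. exp1))" for c
  proof -
    have [measurable]: "(\<Union>j\<in>J c. slot h j) \<in> sets borel" using finJ[of c] unfolding slot_def by measurable
    have [measurable]: "(\<lambda>x. x (c, k)) \<in> borel_measurable (PiM ({c} \<times> UNIV) (\<lambda>_. exp1))" for k
      using measurable_component_singleton[of "(c, k)" "{c} \<times> UNIV" "\<lambda>_. exp1"] by (simp cong: measurable_cong_sets)
    show ?thesis unfolding avoids_def by measurable
  qed
  have pre: "(\<lambda>\<omega>. restrict \<omega> ({c} \<times> UNIV)) -` ?A c \<inter> space stir_space = {\<omega>. \<forall>j\<in>J c. \<not> occ h \<omega> (c, j)}" for c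
    by (auto simp: not_occ_iff_avoids space_PiM PiE_def extensional_def)
  have "stir.prob (\<Inter>c\<in>C. (\<lambda>\<omega>. restrict \<omega> ({c} \<times> UNIV)) -` ?A c \<inter> space stir_space) =
    (\<Prod>c\<in>C. stir.prob ((\<lambda>\<omega>. restrict \<omega> ({c} \<times> UNIV)) -` ?A c \<inter> space stir_space))"
    by (rule stir.indep_varsD[OF ind]) (use False finC A in \<open>auto simp: C_def\<close>)
  also have "(\<Inter>c\<in>C. (\<lambda>\<omega>. restrict \<omega> ({c} \<times> UNIV)) -` ?A c \<inter> space stir_space) = {\<omega>. \<forall>z\<in>Z. \<not> occ h \<omega> z}"
    unfolding pre by (auto simp: Zeq)
  also have "(\<Prod>c\<in>C. stir.prob ((\<lambda>\<omega>. restrict \<omega> ({c} \<times> UNIV)) -` ?A c \<inter> space stir_space)) = (\<Prod>c\<in>C. exp (- h) ^ card (J c))"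
    unfolding pre using void_probability_edge[OF h finJ] by simp
  also have "\<dots> = exp (- h) ^ card Z"
    using finC finJ by (simp add: Zeq card_SigmaI flip: power_sum)
  finally show ?thesis .
qed

text \<open>Inclusion and exclusion, one slot at a time: requiring \<open>y\<close> to be occupied
  gives the pattern that ignores \<open>y\<close> minus the pattern with \<open>y\<close>
  empty.\<close>

lemma prob_occ_pattern:
  assumes h: "h > 0" and X: "finite X" and Y: "finite Y" "X \<inter> Y = {}"
  shows "stir.prob {\<omega>. (\<forall>z\<in>X. \<not> occ h \<omega> z) \<and> (\<forall>z\<in>Y. occ h \<omega> z)} = exp (- h) ^ card X * (1 - exp (- h)) ^ card Y"
  using Y(1) X Y(2)
proof (induction Y arbitrary: X)
  case empty
  then show ?case using void_probability[OF h] by simp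
next
  case (insert y Y)
  note [measurable] = insert.prems(1) insert.hyps(1)
  let ?P = "\<lambda>X \<omega>. (\<forall>z\<in>X. \<not> occ h \<omega> z) \<and> (\<forall>z\<in>Y. occ h \<omega> z)"
  have m: "{\<omega>. ?P X' \<omega>} \<in> stir.events" if [measurable]: "finite X'" for X'
  proof -
    have "{\<omega> \<in> space stir_space. ?P X' \<omega>} \<in> stir.events" by measurable
    then show ?thesis by simp
  qed
  have "{\<omega>. (\<forall>z\<in>X. \<not> occ h \<omega> z) \<and> (\<forall>z\<in>insert y Y. occ h \<omega> z)} = {\<omega>. ?P X \<omega>} - {\<omega>. ?P (insert y X) \<omega>}"
    by auto
  then have "stir.prob {\<omega>. (\<forall>z\<in>X. \<not> occ h \<omega> z) \<and> (\<forall>z\<in>insert y Y. occ h \<omega> z)} =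
      stir.prob {\<omega>. ?P X \<omega>} - stir.prob {\<omega>. ?P (insert y X) \<omega>}"
    using m[of X] m[of "insert y X"] insert.prems(1)
    by (simp only: finite_insert) (intro stir.finite_measure_Diff, auto)
  also have "stir.prob {\<omega>. ?P X \<omega>} = exp (- h) ^ card X * (1 - exp (- h)) ^ card Y"
    using insert.prems by (intro insert.IH) auto
  also have "stir.prob {\<omega>. ?P (insert y X) \<omega>} = exp (- h) ^ card (insert y X) * (1 - exp (- h)) ^ card Y"
    using insert.prems insert.hyps by (intro insert.IH) auto
  finally show ?case using insert.prems insert.hyps by (simp add: algebra_simps)
qed

text \<open>The bridge from the Bernoulli estimates to the stirring space. An event about finitely
  many slots is a finite disjoint union of patterns, and patterns have the same probability on both
  sides.\<close>

lemma occ_event_law: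
  assumes I: "finite I" and E: "depends E I"
  shows "{\<omega>. E (occ h \<omega>)} \<in> stir.events"
    and "h > 0 \<Longrightarrow> stir.prob {\<omega>. E (occ h \<omega>)} = bernoulli_field.pr I (1 - exp (- h)) E"
proof -
  let ?F = "{S \<in> Pow I. E (\<lambda>x. x \<in> S)}"
  let ?p = "\<lambda>S \<eta>. (\<forall>z\<in>I - S. \<not> \<eta> z) \<and> (\<forall>z\<in>S. \<eta> z)"
  have F: "finite ?F" using I by simp
  have Eq: "E \<eta> \<longleftrightarrow> (\<exists>S\<in>?F. ?p S \<eta>)" for \<eta>
  proof
    assume e: "E \<eta>"
    have "E (\<lambda>x. x \<in> {x \<in> I. \<eta> x})" using e dependsD[OF E, of \<eta> "\<lambda>x. x \<in> {x \<in> I. \<eta> x}"] by blast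
    then have "{x \<in> I. \<eta> x} \<in> ?F" by blast
    moreover have "?p {x \<in> I. \<eta> x} \<eta>" by blast
    ultimately show "\<exists>S\<in>?F. ?p S \<eta>" by (rule bexI[rotated])
  next
    assume "\<exists>S\<in>?F. ?p S \<eta>"
    then obtain S where S: "S \<subseteq> I" "E (\<lambda>x. x \<in> S)" "?p S \<eta>" by auto
    have "E (\<lambda>x. x \<in> S) = E \<eta>" by (rule dependsD[OF E]) (use S in auto)
    then show "E \<eta>" using S by simp
  qed
  have disj: "S = S'" if "S \<in> ?F" "S' \<in> ?F" "?p S \<eta>" "?p S' \<eta>" for S S' \<eta>
  proof -
    have "S \<subseteq> I" "S' \<subseteq> I" using that by auto
    then show ?thesis using that(3,4) by blast
  qed
  have un: "{\<omega>. E (occ h \<omega>)} = (\<Union>S\<in>?F. {\<omega>. ?p S (occ h \<omega>)})"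
    by (intro set_eqI, unfold mem_Collect_eq UN_iff, rule Eq)
  have m: "{\<omega>. ?p S (occ h \<omega>)} \<in> stir.events" if "S \<in> ?F" for S
  proof -
    have [measurable]: "finite S" "finite (I - S)" using that I finite_subset by auto
    have "{\<omega> \<in> space stir_space. ?p S (occ h \<omega>)} \<in> stir.events" by measurable
    then show ?thesis by simp
  qed
  show "{\<omega>. E (occ h \<omega>)} \<in> stir.events" unfolding un using m F by auto
  assume h: "h > 0"
  interpret bernoulli_field I "1 - exp (- h)" using I h by unfold_locales auto
  have "stir.prob {\<omega>. E (occ h \<omega>)} = (\<Sum>S\<in>?F. stir.prob {\<omega>. ?p S (occ h \<omega>)})"
    unfolding un using m F disj by (intro stir.finite_measure_finite_Union) (auto simp: disjoint_family_on_def)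
  also have "\<dots> = (\<Sum>S\<in>?F. pr (?p S))"
  proof (rule sum.cong[OF refl])
    fix S assume S: "S \<in> ?F"
    then have fin: "finite S" "S \<subseteq> I" using I finite_subset by auto
    have "pr (?p S) = pr (\<lambda>\<eta>. \<forall>z\<in>I - S. \<not> \<eta> z) * pr (\<lambda>\<eta>. \<forall>z\<in>S. \<eta> z)"
      by (rule pr_conj[of _ "I - S" _ S]) (auto intro!: dependsI)
    also have "pr (\<lambda>\<eta>. \<forall>z\<in>S. \<eta> z) = (\<Prod>z\<in>S. pr (\<lambda>\<eta>. \<eta> z))"
      by (rule pr_all[where A = "\<lambda>z. {z}"]) (auto simp: fin intro: depends_coord)
    also have "\<dots> = (\<Prod>z\<in>S. 1 - exp (- h))" by (rule prod.cong) (use fin pr_coord in auto)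
    also have "\<dots> = (1 - exp (- h)) ^ card S" by simp
    also have "pr (\<lambda>\<eta>. \<forall>z\<in>I - S. \<not> \<eta> z) = exp (- h) ^ card (I - S)" by (subst pr_none) auto
    finally show "stir.prob {\<omega>. ?p S (occ h \<omega>)} = pr (?p S)"
      using prob_occ_pattern[OF h, of "I - S" S] I fin by auto
  qed
  also have "\<dots> = pr (\<lambda>\<eta>. \<exists>S\<in>?F. ?p S \<eta>)" by (rule pr_bex_disjoint[symmetric]) (use F disj in auto)
  also have "\<dots> = pr E" by (intro arg_cong[where f = pr] ext Eq[symmetric])
  finally show "stir.prob {\<omega>. E (occ h \<omega>)} = pr E" .
qed

section \<open>Stirring paths and slots\<close>

lemma tree_edge_iff:
  "tree_edge d u w c \<longleftrightarrow> tree_vertex d c \<and> c \<noteq> [] \<and> (c = u \<and> w = tl c \<or> c = w \<and> u = tl c)"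
  by (auto simp: tree_edge_def)

lemma rings_edge:
  "rings d \<omega> u w t \<longleftrightarrow> (\<exists>c n. tree_edge d u w c \<and> t = arrival \<omega> c n)"
  by (auto simp: rings_def arrival_def)

lemma stir_path_refl: "tree_vertex d x \<Longrightarrow> stir_path d \<omega> 0 x x"
  unfolding stir_path_def
  by (intro conjI exI[of _ 0] exI[of _ "\<lambda>_. x"] exI[of _ "\<lambda>_. 0"]) auto

lemma stir_path_stay:
  assumes "stir_path d \<omega> a x y" "a \<le> b" "\<And>s w. a < s \<Longrightarrow> s \<le> b \<Longrightarrow> \<not> rings d \<omega> y w s"
  shows "stir_path d \<omega> b x y"
proof -
  obtain k vs ts where h: "vs 0 = x" "vs k = y" "ts 0 = 0" "ts k \<le> a"
    "\<forall>i<k. ts i < ts (Suc i) \<and> rings d \<omega> (vs i) (vs (Suc i)) (ts (Suc i)) \<and>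
               (\<forall>s w. ts i < s \<and> s < ts (Suc i) \<longrightarrow> \<not> rings d \<omega> (vs i) w s)"
    "\<forall>s w. ts k < s \<and> s \<le> a \<longrightarrow> \<not> rings d \<omega> (vs k) w s"
    using assms(1) unfolding stir_path_def by blast
  have "\<forall>s w. ts k < s \<and> s \<le> b \<longrightarrow> \<not> rings d \<omega> (vs k) w s"
    using h(2,6) assms(3) by (metis not_le)
  then show ?thesis unfolding stir_path_def using h assms(1,2)
    by (intro conjI exI[of _ k] exI[of _ vs] exI[of _ ts]) (auto simp: stir_path_def)
qed

lemma stir_path_jump:
  assumes "stir_path d \<omega> a x y" "a < t" "t \<le> b" "rings d \<omega> y z t"
    "\<And>s w. a < s \<Longrightarrow> s < t \<Longrightarrow> \<not> rings d \<omega> y w s" "\<And>s w. t < s \<Longrightarrow> s \<le> b \<Longrightarrow> \<not> rings d \<omega> z w s"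
  shows "stir_path d \<omega> b x z"
proof -
  obtain k vs ts where h: "vs 0 = x" "vs k = y" "ts 0 = 0" "ts k \<le> a"
    "\<forall>i<k. ts i < ts (Suc i) \<and> rings d \<omega> (vs i) (vs (Suc i)) (ts (Suc i)) \<and>
               (\<forall>s w. ts i < s \<and> s < ts (Suc i) \<longrightarrow> \<not> rings d \<omega> (vs i) w s)"
    "\<forall>s w. ts k < s \<and> s \<le> a \<longrightarrow> \<not> rings d \<omega> (vs k) w s"
    using assms(1) unfolding stir_path_def by blast
  let ?vs = "vs(Suc k := z)" and ?ts = "ts(Suc k := t)"
  have "\<forall>s w. ts k < s \<and> s < t \<longrightarrow> \<not> rings d \<omega> (vs k) w s"
    using h(2,6) assms(5) by (metis not_le)
  then have "\<forall>i<Suc k. ?ts i < ?ts (Suc i) \<and> rings d \<omega> (?vs i) (?vs (Suc i)) (?ts (Suc i)) \<and>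
               (\<forall>s w. ?ts i < s \<and> s < ?ts (Suc i) \<longrightarrow> \<not> rings d \<omega> (?vs i) w s)"
    using h assms(2,4) by (auto simp: less_Suc_eq)
  moreover have "?vs 0 = x" "?ts 0 = 0" "?vs (Suc k) = z" "?ts (Suc k) \<le> b"
    "\<forall>s w. ?ts (Suc k) < s \<and> s \<le> b \<longrightarrow> \<not> rings d \<omega> (?vs (Suc k)) w s"
    using h assms(3,6) by auto
  moreover have "tree_vertex d x" using assms(1) by (simp add: stir_path_def)
  ultimately show ?thesis unfolding stir_path_def by blast
qed

text \<open>The last clause says that the edges ringing in one of M time windows percolate subcritically;
  it excludes infinitely many jumps in finite time.\<close>
definition regular :: "nat \<Rightarrow> real \<Rightarrow> nat \<Rightarrow> (nat list \<times> nat \<Rightarrow> real) \<Rightarrow> bool" where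
  "regular d T M \<omega> \<longleftrightarrow> (\<forall>z. \<omega> z > 0) \<and> (\<forall>c. \<exists>n. arrival \<omega> c n > T) \<and>
     (\<forall>c c' n m. c \<noteq> c' \<longrightarrow> arrival \<omega> c n = arrival \<omega> c' m \<longrightarrow> arrival \<omega> c n > T) \<and>
     (\<forall>c n. arrival \<omega> c n \<noteq> T) \<and>
     (\<forall>v j. \<exists>m. \<forall>w. tree_vertex d w \<longrightarrow> length w = m \<longrightarrow> (\<exists>i<m. \<not> occ (T / real M) \<omega> (drop i w @ v, j)))"

lemma regularD:
  assumes "regular d T M \<omega>"
  shows regular_pos: "\<omega> z > 0"
    and regular_unbounded: "\<exists>n. arrival \<omega> c n > T"
    and regular_distinct: "c \<noteq> c' \<Longrightarrow> arrival \<omega> c n = arrival \<omega> c' m \<Longrightarrow> arrival \<omega> c n > T"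
    and regular_neq: "arrival \<omega> c n \<noteq> T"
    and regular_subcritical: "\<exists>m. \<forall>w. tree_vertex d w \<longrightarrow> length w = m \<longrightarrow> (\<exists>i<m. \<not> occ (T / real M) \<omega> (drop i w @ v, j))"
  using assms unfolding regular_def by metis+

text \<open>This gives the \<open>THE\<close> in \<open>stir_perm\<close> its meaning. Two paths
  agree jump by jump because up to time T no two edges ring together, and neither can stop earlier
  than the other, since its last vertex would ring afterwards.\<close>

lemma stir_path_unique:
  assumes r: "regular d T M \<omega>" and p: "stir_path d \<omega> T x y" "stir_path d \<omega> T x y'"
  shows "y = y'"
proof -
  obtain k vs ts where h: "vs 0 = x" "vs k = y" "ts 0 = 0" "ts k \<le> T"
    "\<And>i. i < k \<Longrightarrow> ts i < ts (Suc i) \<and> rings d \<omega> (vs i) (vs (Suc i)) (ts (Suc i)) \<and>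
               (\<forall>s w. ts i < s \<and> s < ts (Suc i) \<longrightarrow> \<not> rings d \<omega> (vs i) w s)"
    "\<And>s w. ts k < s \<Longrightarrow> s \<le> T \<Longrightarrow> \<not> rings d \<omega> (vs k) w s"
    using p(1) unfolding stir_path_def by metis
  obtain k' vs' ts' where h': "vs' 0 = x" "vs' k' = y'" "ts' 0 = 0" "ts' k' \<le> T"
    "\<And>i. i < k' \<Longrightarrow> ts' i < ts' (Suc i) \<and> rings d \<omega> (vs' i) (vs' (Suc i)) (ts' (Suc i)) \<and>
               (\<forall>s w. ts' i < s \<and> s < ts' (Suc i) \<longrightarrow> \<not> rings d \<omega> (vs' i) w s)"
    "\<And>s w. ts' k' < s \<Longrightarrow> s \<le> T \<Longrightarrow> \<not> rings d \<omega> (vs' k') w s"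
    using p(2) unfolding stir_path_def by metis
  have le: "ts i \<le> T" if "i \<le> k" for i
    using that h(4) h(5) by (induction rule: inc_induct) force+
  have le': "ts' i \<le> T" if "i \<le> k'" for i
    using that h'(4) h'(5) by (induction rule: inc_induct) force+
  have ru: "w = w'" if r1: "rings d \<omega> u w t" and r2: "rings d \<omega> u w' t" and tT: "t \<le> T" for u w w' t
  proof -
    obtain c n where c: "tree_edge d u w c" "t = arrival \<omega> c n" using r1 unfolding rings_edge by blast
    obtain c' n' where c': "tree_edge d u w' c'" "t = arrival \<omega> c' n'" using r2 unfolding rings_edge by blast
    have "c = c'" using regular_distinct[OF r, of c c' n n'] c(2) c'(2) tT by fastforce
    moreover have "tl c \<noteq> c" using c(1) by (cases c) (auto simp: tree_edge_iff)
    ultimately show ?thesis using c(1) c'(1) by (auto simp: tree_edge_iff)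
  qed
  have same: "vs i = vs' i \<and> ts i = ts' i" if "i \<le> k" "i \<le> k'" for i
    using that
  proof (induction i)
    case (Suc i)
    then have e: "vs i = vs' i" "ts i = ts' i" and i: "i < k" "i < k'" by auto
    note a = h(5)[OF i(1)] and b = h'(5)[OF i(2)]
    have t: "ts (Suc i) = ts' (Suc i)" using a b e by (metis linorder_neqE_linordered_idom)
    then show ?case using ru[of "vs i" "vs (Suc i)" "ts (Suc i)" "vs' (Suc i)"] a b e le[of "Suc i"] Suc.prems by auto
  qed (use h h' in auto)
  have "\<not> k < k'"
  proof
    assume k: "k < k'"
    then have "ts k < ts' (Suc k)" "rings d \<omega> (vs k) (vs' (Suc k)) (ts' (Suc k))" "ts' (Suc k) \<le> T"
      using h'(5)[OF k] same[of k] le'[of "Suc k"] by auto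
    then show False using h(6) by blast
  qed
  moreover have "\<not> k' < k"
  proof
    assume k: "k' < k"
    then have "ts' k' < ts (Suc k')" "rings d \<omega> (vs' k') (vs (Suc k')) (ts (Suc k'))" "ts (Suc k') \<le> T"
      using h(5)[OF k] same[of k'] le[of "Suc k'"] by auto
    then show False using h'(6) by blast
  qed
  ultimately have "k = k'" by simp
  then show ?thesis using same[of k] h(2) h'(2) by simp
qed

text \<open>The last slot is kept empty so that a closed walk re-enters its starting point in slot
  K - 1, the slot of arrival in \<^term>\<open>returns\<close>.\<close>
definition separated :: "nat \<Rightarrow> real \<Rightarrow> nat \<Rightarrow> nat \<Rightarrow> (nat list \<times> nat \<Rightarrow> real) \<Rightarrow> bool" where
  "separated d T N K \<omega> \<longleftrightarrow>
     (\<forall>j<K. \<forall>c c' n n'. tree_vertex d c \<longrightarrow> tree_vertex d c' \<longrightarrow> length c \<le> N \<longrightarrow> length c' \<le> N \<longrightarrow>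
        arrival \<omega> c n \<in> slot (T / real K) j \<longrightarrow> arrival \<omega> c' n' \<in> slot (T / real K) j \<longrightarrow> c = c' \<and> n = n') \<and>
     (\<forall>c. tree_vertex d c \<longrightarrow> length c \<le> N \<longrightarrow> \<not> occ (T / real K) \<omega> (c, K - 1))"

lemma arrival_strict_mono: "(\<And>z. \<omega> z > 0) \<Longrightarrow> strict_mono (arrival \<omega> c)"
  by (rule strict_mono_Suc_iff[THEN iffD2]) (simp add: arrival_def)

lemma slot_le: "0 < T \<Longrightarrow> j < K \<Longrightarrow> t \<in> slot (T / real K) j \<Longrightarrow> 0 < t \<and> t \<le> T"
proof -
  assume T: "0 < T" and j: "j < K" and t: "t \<in> slot (T / real K) j"
  have "0 \<le> real j * (T / real K)" using T by simp
  moreover have "real (Suc j) * (T / real K) \<le> real K * (T / real K)"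
    using T j by (intro mult_right_mono) auto
  ultimately show ?thesis using t j by (auto simp: slot_def)
qed

text \<open>Only finitely many arrivals up to T occur on edges of bounded depth. They are distinct
  and differ from T, so there is a least distance among them and to T, and slots shorter than that
  separate them.\<close>

lemma eventually_separated:
  assumes r: "regular d T M \<omega>" and T: "T > 0"
  shows "\<exists>K0. \<forall>K\<ge>K0. separated d T N K \<omega>"
proof -
  define A where "A = {(c, n). tree_vertex d c \<and> length c \<le> N \<and> arrival \<omega> c n \<le> T}"
  let ?a = "\<lambda>z. arrival \<omega> (fst z) (snd z)"
  have pos: "\<And>z. \<omega> z > 0" by (rule regular_pos[OF r])
  note mono = arrival_strict_mono[of \<omega>, OF pos]
  have finV: "finite {c. tree_vertex d c \<and> length c \<le> N}"
    by (rule finite_subset[OF _ finite_lists_length_le[of "{..<d}" N]]) (auto simp: tree_vertex_def)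
  have finA: "finite A"
  proof -
    have "finite {n. arrival \<omega> c n \<le> T}" for c
    proof -
      obtain m where m: "arrival \<omega> c m > T" using regular_unbounded[OF r] by blast
      have "{n. arrival \<omega> c n \<le> T} \<subseteq> {..<m}"
      proof
        fix n assume "n \<in> {n. arrival \<omega> c n \<le> T}"
        then have "arrival \<omega> c n < arrival \<omega> c m" using m by simp
        then show "n \<in> {..<m}" using strict_mono_less[OF mono] by simp
      qed
      then show ?thesis using finite_subset by blast
    qed
    moreover have "A = Sigma {c. tree_vertex d c \<and> length c \<le> N} (\<lambda>c. {n. arrival \<omega> c n \<le> T})"
      by (auto simp: A_def)
    ultimately show ?thesis using finV by simp
  qed
  have inj: "y = z" if "y \<in> A" "z \<in> A" "?a y = ?a z" for y z
  proof -
    have "fst y = fst z" using that regular_distinct[OF r, of "fst y" "fst z" "snd y" "snd z"] by (fastforce simp: A_def)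
    moreover have "snd y = snd z" using that(3) calculation strict_mono_eq[OF mono] by metis
    ultimately show ?thesis by (simp add: prod_eq_iff)
  qed
  \<comment> \<open>The element 1 keeps the minimum meaningful when there are no arrivals; the
    distances to T are included to keep the last slot empty.\<close>
  define S where "S = insert 1 ((\<lambda>(y, z). \<bar>?a y - ?a z\<bar>) ` {(y, z) \<in> A \<times> A. y \<noteq> z} \<union> (\<lambda>z. T - ?a z) ` A)"
  have "finite {(y, z) \<in> A \<times> A. y \<noteq> z}" by (rule finite_subset[of _ "A \<times> A"]) (use finA in auto)
  then have finS: "finite S" using finA by (simp add: S_def)
  have Spos: "\<forall>s\<in>S. s > 0"
  proof -
    have "?a z \<noteq> T" for z by (rule regular_neq[OF r])
    then have "T - ?a z > 0" if "z \<in> A" for z using that by (force simp: A_def less_le)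
    then show ?thesis using inj by (auto simp: S_def)
  qed
  define \<delta> where "\<delta> = Min S"
  have Sne: "S \<noteq> {}" by (simp add: S_def)
  have \<delta>: "\<delta> > 0" using Spos Min_in[OF finS Sne] by (simp add: \<delta>_def)
  have \<delta>le: "\<delta> \<le> s" if "s \<in> S" for s using that finS by (simp add: \<delta>_def)
  show ?thesis
  proof (intro exI[of _ "nat \<lceil>T / \<delta>\<rceil> + 1"] allI impI)
    fix K assume K: "nat \<lceil>T / \<delta>\<rceil> + 1 \<le> K"
    then have "T / \<delta> < real K" by linarith
    then have h: "T / real K < \<delta>" using \<delta> K by (simp add: field_simps)
    have K0: "K > 0" using K by simp
    show "separated d T N K \<omega>" unfolding separated_def
    proof (intro conjI allI impI)
      fix j c c' n n' assume j: "j < K" "tree_vertex d c" "tree_vertex d c'" "length c \<le> N" "length c' \<le> N"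
        and a: "arrival \<omega> c n \<in> slot (T / real K) j" "arrival \<omega> c' n' \<in> slot (T / real K) j"
      have A: "(c, n) \<in> A" "(c', n') \<in> A" using slot_le[OF T j(1)] a j by (auto simp: A_def)
      have "\<bar>arrival \<omega> c n - arrival \<omega> c' n'\<bar> < T / real K"
        using a by (auto simp: slot_def abs_if algebra_simps add_divide_distrib)
      moreover have "\<delta> \<le> \<bar>arrival \<omega> c n - arrival \<omega> c' n'\<bar>" if "(c, n) \<noteq> (c', n')"
        using that A by (intro \<delta>le) (force simp: S_def)
      ultimately have "(c, n) = (c', n')" using h by fastforce
      then show "c = c'" "n = n'" by auto
    next
      fix c assume c: "tree_vertex d c" "length c \<le> N"
      show "\<not> occ (T / real K) \<omega> (c, K - 1)"
      proof
        assume "occ (T / real K) \<omega> (c, K - 1)"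
        then obtain n where n: "arrival \<omega> c n \<in> slot (T / real K) (K - 1)" by (auto simp: occ_def)
        then have A: "(c, n) \<in> A" using slot_le[OF T _ n] K0 c by (auto simp: A_def)
        have "T - arrival \<omega> c n < T / real K"
          using n K0 by (auto simp: slot_def of_nat_diff field_simps)
        moreover have "\<delta> \<le> T - arrival \<omega> c n" using A by (intro \<delta>le) (force simp: S_def)
        ultimately show False using h by linarith
      qed
    qed
  qed
qed

section \<open>The walk through the slots and its agreement with stirring paths\<close>

definition slot_step :: "nat \<Rightarrow> (nat list \<times> nat \<Rightarrow> bool) \<Rightarrow> nat \<Rightarrow> nat list \<Rightarrow> nat list" where
  "slot_step d \<eta> j v = (if v \<noteq> [] \<and> \<eta> (v, j) then tl v
     else if \<exists>c<d. \<eta> (c # v, j) then (LEAST c. c < d \<and> \<eta> (c # v, j)) # v else v)"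

lemma slot_step_cases:
  obtains (up) "v \<noteq> []" "\<eta> (v, j)" "slot_step d \<eta> j v = tl v"
  | (down) c where "v = [] \<or> \<not> \<eta> (v, j)" "c < d" "\<eta> (c # v, j)" "slot_step d \<eta> j v = c # v"
  | (stay) "v = [] \<or> \<not> \<eta> (v, j)" "\<forall>c<d. \<not> \<eta> (c # v, j)" "slot_step d \<eta> j v = v"
proof (cases "v \<noteq> [] \<and> \<eta> (v, j)")
  case True
  then show ?thesis using up by (auto simp: slot_step_def)
next
  case F: False
  show ?thesis
  proof (cases "\<exists>c<d. \<eta> (c # v, j)")
    case True
    then have "(LEAST c. c < d \<and> \<eta> (c # v, j)) < d \<and> \<eta> ((LEAST c. c < d \<and> \<eta> (c # v, j)) # v, j)"
      by (auto intro: LeastI2_ex)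
    then show ?thesis using down[of "LEAST c. c < d \<and> \<eta> (c # v, j)"] F True by (auto simp: slot_step_def)
  next
    case False
    then show ?thesis using stay F by (auto simp: slot_step_def)
  qed
qed

lemma tree_vertex_slot_step: "tree_vertex d v \<Longrightarrow> tree_vertex d (slot_step d \<eta> j v)"
  by (rule slot_step_cases[of v \<eta> j d]) (auto simp: tree_vertex_def dest: list.set_sel(2))

text \<open>In a separated slot at most one ring occurs on the edges touching \<open>v\<close> or
  the next vertex, so the path jumps at most once. Both depths must be strictly below
  \<open>N\<close>, because the edge to a child is indexed by the child, one level deeper.\<close>

lemma stir_path_slot:
  assumes s: "separated d T N K \<omega>" and T: "T > 0" and j: "j < K"
    and p: "stir_path d \<omega> (real j * (T / real K)) x v" and v: "tree_vertex d v" "length v < N"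
    and z: "length (slot_step d (occ (T / real K) \<omega>) j v) < N"
  shows "stir_path d \<omega> (real (Suc j) * (T / real K)) x (slot_step d (occ (T / real K) \<omega>) j v)"
proof -
  let ?h = "T / real K" let ?\<eta> = "occ ?h \<omega>"
  have h: "?h > 0" using T j by simp
  have sep: "c = c' \<and> n = n'" if "tree_vertex d c" "tree_vertex d c'" "length c \<le> N" "length c' \<le> N"
    "arrival \<omega> c n \<in> slot ?h j" "arrival \<omega> c' n' \<in> slot ?h j" for c c' n n'
    using s j that unfolding separated_def by blast
  have ring: "\<exists>c n. (c = u \<or> c = w \<and> u = tl w \<and> w \<noteq> []) \<and> tree_vertex d c \<and> c \<noteq> [] \<and> length c \<le> N \<and> arrival \<omega> c n = t \<and> arrival \<omega> c n \<in> slot ?h j"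
    if "rings d \<omega> u w t" "real j * ?h < t" "t \<le> real (Suc j) * ?h" "length u < N" for u w t
    using that by (auto simp: rings_edge tree_edge_iff slot_def)
  have jump: "stir_path d \<omega> (real (Suc j) * ?h) x z" if e: "tree_edge d v z c" "length c \<le> N" "?\<eta> (c, j)" "length z < N" for c z
  proof -
    obtain n where n: "arrival \<omega> c n \<in> slot ?h j" using e(3) by (auto simp: occ_def)
    let ?t = "arrival \<omega> c n"
    have c: "tree_vertex d c" using e(1) by (simp add: tree_edge_def)
    have t: "real j * ?h < ?t" "?t \<le> real (Suc j) * ?h" using n by (auto simp: slot_def)
    have only: "t = ?t" if r: "rings d \<omega> u w t" "real j * ?h < t" "t \<le> real (Suc j) * ?h" "length u < N" for u w t
      using ring[OF r] sep[OF c _ e(2) _ n] by metis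
    show ?thesis
    proof (rule stir_path_jump[OF p t])
      show "rings d \<omega> v z ?t" using e(1) by (auto simp: rings_edge)
      show "\<not> rings d \<omega> v w s" if "real j * ?h < s" "s < ?t" for s w
        using only[of v w s] that t v(2) by force
      show "\<not> rings d \<omega> z w s" if "?t < s" "s \<le> real (Suc j) * ?h" for s w
        using only[of z w s] that t e(4) by force
    qed
  qed
  show ?thesis
  proof (rule slot_step_cases[of v ?\<eta> j d])
    assume up: "v \<noteq> []" "?\<eta> (v, j)" "slot_step d ?\<eta> j v = tl v"
    then show ?thesis using jump[of "tl v" v] v z by (simp add: tree_edge_iff)
  next
    fix c assume down: "c < d" "?\<eta> (c # v, j)" "slot_step d ?\<eta> j v = c # v"
    then show ?thesis using jump[of "c # v" "c # v"] v z by (simp add: tree_edge_iff tree_vertex_def)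
  next
    assume stay: "v = [] \<or> \<not> ?\<eta> (v, j)" "\<forall>c<d. \<not> ?\<eta> (c # v, j)" "slot_step d ?\<eta> j v = v"
    have "\<not> rings d \<omega> v w t" if t: "real j * ?h < t" "t \<le> real (Suc j) * ?h" for t w
    proof
      assume "rings d \<omega> v w t"
      then obtain c n where c: "c = v \<or> c = w \<and> v = tl w \<and> w \<noteq> []" "tree_vertex d c" "c \<noteq> []" "arrival \<omega> c n \<in> slot ?h j"
        using ring[OF _ t v(2)] by blast
      have occ: "?\<eta> (c, j)" using c(4) by (auto simp: occ_def)
      from c(1) show False
      proof
        assume "c = v" then show False using stay(1) occ c(3) by auto
      next
        assume h: "c = w \<and> v = tl w \<and> w \<noteq> []"
        then have "c = hd w # v" "hd w < d" using c(2) by (auto simp: tree_vertex_def)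
        then show False using stay(2) occ by auto
      qed
    qed
    then show ?thesis unfolding stay(3) using h by (intro stir_path_stay[OF p] mult_right_mono) auto
  qed
qed

primrec walk :: "nat \<Rightarrow> nat \<Rightarrow> (nat list \<times> nat \<Rightarrow> bool) \<Rightarrow> nat list \<Rightarrow> nat \<Rightarrow> nat list" where
  "walk d K \<eta> x 0 = x"
| "walk d K \<eta> x (Suc s) = slot_step d \<eta> (s mod K) (walk d K \<eta> x s)"

lemma tree_vertex_walk: "tree_vertex d x \<Longrightarrow> tree_vertex d (walk d K \<eta> x s)"
  by (induction s) (auto intro: tree_vertex_slot_step)

lemma walk_add: "walk d K \<eta> x (K * n + s) = walk d K \<eta> (walk d K \<eta> x (K * n)) s"
  by (induction s) auto

lemma stir_path_walk:
  assumes "separated d T N K \<omega>" "T > 0" "K > 0" "tree_vertex d x"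
    and "\<And>i. i \<le> K \<Longrightarrow> length (walk d K (occ (T / real K) \<omega>) x i) < N"
  shows "stir_path d \<omega> T x (walk d K (occ (T / real K) \<omega>) x K)"
proof -
  have "stir_path d \<omega> (real i * (T / real K)) x (walk d K (occ (T / real K) \<omega>) x i)" if "i \<le> K" for i
    using that
  proof (induction i)
    case 0 then show ?case using assms(4) stir_path_refl by simp
  next
    case (Suc i)
    have "stir_path d \<omega> (real (Suc i) * (T / real K)) x (slot_step d (occ (T / real K) \<omega>) i (walk d K (occ (T / real K) \<omega>) x i))"
      using assms(5)[of i] assms(5)[of "Suc i"] Suc assms(4)
      by (intro stir_path_slot[OF assms(1,2)] tree_vertex_walk) auto
    then show ?case using Suc.prems by simp
  qed
  from this[of K] show ?thesis using assms(3) by simp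
qed

text \<open>Under separation, a slot acts on shallow vertices as a single transposition.\<close>
lemma slot_step_inj:
  assumes u: "\<And>c c'. tree_vertex d c \<Longrightarrow> tree_vertex d c' \<Longrightarrow> length c \<le> N \<Longrightarrow> length c' \<le> N \<Longrightarrow>
      \<eta> (c, j) \<Longrightarrow> \<eta> (c', j) \<Longrightarrow> c = c'"
    and x: "tree_vertex d x" "length x < N" and y: "tree_vertex d y" "length y < N"
    and eq: "slot_step d \<eta> j x = slot_step d \<eta> j y"
  shows "x = y"
proof -
  have ch: "tree_vertex d (c # v)" if "tree_vertex d v" "c < d" for c v
    using that by (simp add: tree_vertex_def)
  have up_down: "tl v \<noteq> c # w" if "v \<noteq> []" "\<eta> (v, j)" "c < d" "\<eta> (c # w, j)"
    "tree_vertex d v" "length v < N" "tree_vertex d w" "length w < N" for v w c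
  proof -
    have "v = c # w" using u[of v "c # w"] that ch by simp
    then show ?thesis by (metis list.sel(3) not_Cons_self2)
  qed
  have up_stay: "tl v \<noteq> w" if "v \<noteq> []" "\<eta> (v, j)" "\<forall>c<d. \<not> \<eta> (c # w, j)" "tree_vertex d v" for v w
    using that by (cases v) (auto simp: tree_vertex_def)
  have down_stay: "c # v \<noteq> w" if "\<eta> (c # v, j)" "w = [] \<or> \<not> \<eta> (w, j)" for c v w
    using that by auto
  show ?thesis
  proof (rule slot_step_cases[of x \<eta> j d])
    assume 1: "x \<noteq> []" "\<eta> (x, j)" "slot_step d \<eta> j x = tl x"
    show ?thesis
    proof (rule slot_step_cases[of y \<eta> j d])
      assume "y \<noteq> []" "\<eta> (y, j)" then show ?thesis using u[of x y] 1 x y by simp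
    next
      fix c assume "c < d" "\<eta> (c # y, j)" "slot_step d \<eta> j y = c # y"
      then show ?thesis using up_down[OF 1(1,2)] 1 eq x y by metis
    next
      assume "\<forall>c<d. \<not> \<eta> (c # y, j)" "slot_step d \<eta> j y = y"
      then show ?thesis using up_stay[OF 1(1,2)] 1 eq x by metis
    qed
  next
    fix c assume 1: "c < d" "\<eta> (c # x, j)" "slot_step d \<eta> j x = c # x"
    show ?thesis
    proof (rule slot_step_cases[of y \<eta> j d])
      assume "y \<noteq> []" "\<eta> (y, j)" "slot_step d \<eta> j y = tl y"
      then show ?thesis using up_down[of y c x] 1 eq x y by metis
    next
      fix c' assume "slot_step d \<eta> j y = c' # y" then show ?thesis using 1 eq by simp
    next
      assume "y = [] \<or> \<not> \<eta> (y, j)" "slot_step d \<eta> j y = y"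
      then show ?thesis using down_stay[of c x y] 1 eq by metis
    qed
  next
    assume 1: "x = [] \<or> \<not> \<eta> (x, j)" "\<forall>c<d. \<not> \<eta> (c # x, j)" "slot_step d \<eta> j x = x"
    show ?thesis
    proof (rule slot_step_cases[of y \<eta> j d])
      assume "y \<noteq> []" "\<eta> (y, j)" "slot_step d \<eta> j y = tl y"
      then show ?thesis using up_stay[of y x] 1 eq y by metis
    next
      fix c' assume "\<eta> (c' # y, j)" "slot_step d \<eta> j y = c' # y"
      then show ?thesis using down_stay[of c' y x] 1 eq by metis
    next
      assume "slot_step d \<eta> j y = y" then show ?thesis using 1 eq by simp
    qed
  qed
qed

text \<open>Through this, subcriticality of the \<open>M\<close> fixed windows controls walks at all
  finer meshes simultaneously.\<close>

lemma occ_coarsen: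
  assumes "occ (T / real (M * l)) \<omega> (c, j)" "T > 0" "l > 0" "M > 0"
  shows "occ (T / real M) \<omega> (c, j div l)"
proof -
  obtain n where n: "arrival \<omega> c n \<in> slot (T / real (M * l)) j" using assms(1) by (auto simp: occ_def)
  have e: "T / real M = real l * (T / real (M * l))" using assms by simp
  have h: "T / real (M * l) > 0" using assms by simp
  have "real (j div l) * real l \<le> real j" by (metis of_nat_le_iff of_nat_mult div_times_less_eq_dividend)
  then have "real (j div l) * (T / real M) \<le> real j * (T / real (M * l))"
    unfolding e using h by (simp only: mult.assoc[symmetric]) (rule mult_right_mono, auto)
  moreover have "real (Suc j) * (T / real (M * l)) \<le> real (Suc (j div l)) * (T / real M)"
  proof -
    have "j < Suc (j div l) * l" using assms(3) by (metis dividend_less_div_times mult_Suc)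
    then have "real (Suc j) \<le> real (Suc (j div l)) * real l" by (metis Suc_leI of_nat_le_iff of_nat_mult)
    then show ?thesis unfolding e using h by (simp only: mult.assoc[symmetric]) (rule mult_right_mono, auto)
  qed
  ultimately have "arrival \<omega> c n \<in> slot (T / real M) (j div l)" using n by (auto simp: slot_def)
  then show ?thesis by (auto simp: occ_def)
qed

text \<open>Within one coarse slot the walk moves along open edges only, hence stays on open paths that
  descend from an ancestor of its starting point; these are of bounded length.\<close>
lemma walk_bounded:
  assumes r: "regular d T M \<omega>" and T: "T > 0" and M: "M > 0" and x: "tree_vertex d x"
  shows "\<exists>D. \<forall>l>0. \<forall>s\<le>M * l. length (walk d (M * l) (occ (T / real (M * l)) \<omega>) x s) \<le> D"
proof -
  let ?\<eta> = "\<lambda>l. occ (T / real (M * l)) \<omega>"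
  let ?X = "\<lambda>l. walk d (M * l) (?\<eta> l) x"
  define op where "op a J w \<longleftrightarrow> (\<forall>i<length w. occ (T / real M) \<omega> (drop i w @ a, J))" for a J w
  \<comment> \<open>Induction over the coarse windows; the essential point is that \<open>D\<close>
    does not depend on the refinement \<open>l\<close>.\<close>
  have "\<exists>D. \<forall>l>0. \<forall>s\<le>J * l. length (?X l s) \<le> D" if "J \<le> M" for J
    using that
  proof (induction J)
    case 0 then show ?case by auto
  next
    case (Suc J)
    then obtain D where D: "\<And>l s. l > 0 \<Longrightarrow> s \<le> J * l \<Longrightarrow> length (?X l s) \<le> D" by auto
    define m where "m a = (SOME m. \<forall>w. tree_vertex d w \<longrightarrow> length w = m \<longrightarrow> (\<exists>i<m. \<not> occ (T / real M) \<omega> (drop i w @ a, J)))" for a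
    have m: "\<exists>i<m a. \<not> occ (T / real M) \<omega> (drop i w @ a, J)" if "tree_vertex d w" "length w = m a" for a w
      using someI_ex[OF regular_subcritical[OF r, of a J], folded m_def] that by blast
    have len: "length w < m a" if "op a J w" "tree_vertex d w" for a w
    proof (rule ccontr)
      assume n: "\<not> length w < m a"
      \<comment> \<open>Addresses grow at the head of the list, so dropping \<open>?k\<close>
        entries keeps the uppermost \<open>m a\<close> edges of the path, those next to
        \<open>a\<close>.\<close>
      let ?k = "length w - m a"
      have tv: "tree_vertex d (drop ?k w)" using that(2) by (auto simp: tree_vertex_def dest: in_set_dropD)
      have lw: "length (drop ?k w) = m a" using n by simp
      obtain i where i: "i < m a" "\<not> occ (T / real M) \<omega> (drop i (drop ?k w) @ a, J)"
        using m[OF tv lw] by blast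
      have "i + ?k < length w" using i(1) n by linarith
      then show False using that(1) i(2) unfolding op_def drop_drop by blast
    qed
    let ?A = "{a. tree_vertex d a \<and> length a \<le> D}"
    have finA: "finite ?A"
      by (rule finite_subset[OF _ finite_lists_length_le[of "{..<d}" D]]) (auto simp: tree_vertex_def)
    define B where "B = Max (insert 0 (m ` ?A))"
    have B: "m a \<le> B" if "a \<in> ?A" for a using that finA by (simp add: B_def)
    have "length (?X l s) \<le> D + B" if l: "l > 0" and s: "s \<le> Suc J * l" for l s
    proof (cases "s \<le> J * l")
      case True
      then show ?thesis using D[OF l] by (meson le_add1 order_trans)
    next
      case False
      let ?y = "?X l (J * l)"
      \<comment> \<open>Here \<open>a\<close> is the highest vertex reached since the window began,
        a common ancestor of \<open>?y\<close> and of the current position, and \<open>w\<close> is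
        the open path down from it. It moves up only when \<open>w\<close> is empty.\<close>
      have inv: "\<exists>w a b. ?X l (J * l + i) = w @ a \<and> ?y = b @ a \<and> op a J w \<and> tree_vertex d (w @ a)" if "i \<le> l" for i
        using that
      proof (induction i)
        case 0
        have "?X l (J * l + 0) = [] @ ?y \<and> ?y = [] @ ?y \<and> op ?y J [] \<and> tree_vertex d ([] @ ?y)"
          using tree_vertex_walk[OF x] by (simp add: op_def)
        then show ?case by blast
      next
        case (Suc i)
        then obtain w a b where w: "?X l (J * l + i) = w @ a" "?y = b @ a" "op a J w" "tree_vertex d (w @ a)" by auto
        have "J * l + i < M * l"
        proof -
          have "Suc J * l \<le> M * l" using \<open>Suc J \<le> M\<close> by (rule mult_le_mono1)
          then show ?thesis using Suc.prems by simp
        qed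
        then have sm: "(J * l + i) mod (M * l) = J * l + i" by simp
        have dv: "(J * l + i) div l = J" using Suc.prems l by simp
        have step: "?X l (J * l + Suc i) = slot_step d (?\<eta> l) (J * l + i) (w @ a)"
          using w(1) sm by simp
        show ?case
        proof (rule slot_step_cases[of "w @ a" "?\<eta> l" "J * l + i" d])
          assume up: "w @ a \<noteq> []" "slot_step d (?\<eta> l) (J * l + i) (w @ a) = tl (w @ a)"
          show ?thesis
          proof (cases w)
            case Nil
            then have "?X l (J * l + Suc i) = [] @ tl a" using step up by simp
            moreover have "?y = (b @ [hd a]) @ tl a" using w(2) up(1) Nil by simp
            moreover have "op (tl a) J []" by (simp add: op_def)
            moreover have "tree_vertex d ([] @ tl a)" using w(4) Nil up(1) by (auto simp: tree_vertex_def dest: list.set_sel(2))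
            ultimately show ?thesis by blast
          next
            case (Cons c w')
            have "op a J w'" unfolding op_def
            proof (intro allI impI)
              fix i assume "i < length w'"
              then have "Suc i < length w" using Cons by simp
              then show "occ (T / real M) \<omega> (drop i w' @ a, J)" using w(3) Cons unfolding op_def by fastforce
            qed
            moreover have "?X l (J * l + Suc i) = w' @ a" using step up Cons by simp
            moreover have "tree_vertex d (w' @ a)" using w(4) Cons by (simp add: tree_vertex_def)
            ultimately show ?thesis using w(2) by blast
          qed
        next
          fix c assume c: "c < d" "?\<eta> l (c # w @ a, J * l + i)"
            "slot_step d (?\<eta> l) (J * l + i) (w @ a) = c # w @ a"
          have "occ (T / real M) \<omega> (c # w @ a, J)" using occ_coarsen[OF c(2) T l M] by (simp add: dv)
          then have "op a J (c # w)" using w(3) unfolding op_def by (auto simp: less_Suc_eq_0_disj)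
          moreover have "?X l (J * l + Suc i) = (c # w) @ a" using step c by simp
          moreover have "tree_vertex d ((c # w) @ a)" using w(4) c by (simp add: tree_vertex_def)
          ultimately show ?thesis using w(2) by blast
        next
          assume "slot_step d (?\<eta> l) (J * l + i) (w @ a) = w @ a"
          then show ?thesis using step w by auto
        qed
      qed
      have "s - J * l \<le> l" using s by simp
      from inv[OF this] obtain w a b where w: "?X l s = w @ a" "?y = b @ a" "op a J w" "tree_vertex d (w @ a)"
        using False by auto
      have "length a \<le> D" using D[OF l, of "J * l"] w(2) by simp
      moreover have "length w < m a" using w(3,4) by (intro len) (auto simp: tree_vertex_def)
      moreover have "m a \<le> B" using w(4) calculation(1) by (intro B) (auto simp: tree_vertex_def)
      ultimately show ?thesis using w(1) by simp
    qed
    then show ?case by blast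
  qed
  then show ?thesis by blast
qed

text \<open>The bound \<open>D\<close> comes before \<open>N\<close> and \<open>l\<close>: the image
  of \<open>x\<close> is read off the walk at every mesh that separates some depth beyond
  \<open>D\<close>.\<close>

lemma stir_perm_walk:
  assumes r: "regular d T M \<omega>" and T: "T > 0" and M: "M > 0" and x: "tree_vertex d x"
  shows "\<exists>D. \<forall>N>D. \<forall>l>0. separated d T N (M * l) \<omega> \<longrightarrow>
    stir_perm d \<omega> T x = walk d (M * l) (occ (T / real (M * l)) \<omega>) x (M * l) \<and>
    (\<forall>s\<le>M * l. length (walk d (M * l) (occ (T / real (M * l)) \<omega>) x s) < N)"
proof -
  let ?w = "\<lambda>l. walk d (M * l) (occ (T / real (M * l)) \<omega>) x"
  obtain D where D: "\<And>l s. l > 0 \<Longrightarrow> s \<le> M * l \<Longrightarrow> length (?w l s) \<le> D"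
    using walk_bounded[OF assms] by blast
  show ?thesis
  proof (intro exI[of _ D] allI impI)
    fix N l assume N: "D < N" and l: "0 < l" and s: "separated d T N (M * l) \<omega>"
    have len: "\<forall>s\<le>M * l. length (?w l s) < N"
      using D[OF l] N by (meson le_less_trans)
    have "stir_path d \<omega> T x (?w l (M * l))"
      using len l M by (intro stir_path_walk[OF s T _ x]) auto
    then have "stir_perm d \<omega> T x = ?w l (M * l)"
      unfolding stir_perm_def using stir_path_unique[OF r] by (intro the_equality) auto
    then show "stir_perm d \<omega> T x = ?w l (M * l) \<and>
      (\<forall>s\<le>M * l. length (?w l s) < N)" using len by blast
  qed
qed

text \<open>Induction on the duration t - s. \<open>X s\<close> is the position before slot
  \<open>s\<close> is read, so the slot of arrival \<open>j\<close> is the one preceding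
  \<open>s\<close>. If a child is entered, the stretch up to the next visit to \<open>u\<close> is
  an excursion and the rest a shorter instance. Bars on the edge above \<open>u\<close> belong to
  \<open>P\<close>, so the walk does not leave \<open>u\<close> upwards before \<open>t\<close>; and
  as it stays above depth \<open>N\<close>, the budget \<open>n\<close> suffices.\<close>

lemma walk_returns:
  assumes K: "K > 0"
    and X: "\<And>s. X (Suc s) = slot_step d \<eta> (s mod K) (X s)"
    and len: "\<And>s. length (X s) < N" and tv: "\<And>s. tree_vertex d (X s)"
    and sep: "\<And>c c' j. tree_vertex d c \<Longrightarrow> tree_vertex d c' \<Longrightarrow> length c \<le> N \<Longrightarrow> length c' \<le> N \<Longrightarrow>
      \<eta> (c, j) \<Longrightarrow> \<eta> (c', j) \<Longrightarrow> j < K \<Longrightarrow> c = c'"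
  shows "s \<le> t \<Longrightarrow> X s = u \<Longrightarrow> X t = u \<Longrightarrow> t mod K \<in> P \<Longrightarrow>
    (\<And>r. s \<le> r \<Longrightarrow> r < t \<Longrightarrow> X r = u \<Longrightarrow> r mod K \<notin> P) \<Longrightarrow>
    (\<And>i. u \<noteq> [] \<Longrightarrow> i < K \<Longrightarrow> \<eta> (u, i) \<Longrightarrow> i \<in> P) \<Longrightarrow> N \<le> length u + n \<Longrightarrow>
    Suc j mod K = s mod K \<Longrightarrow> returns d K \<eta> n u P j (t mod K)"
proof (induction "t - s" arbitrary: s t u P n j rule: less_induct)
  case less
  have lu: "length u < N" using len[of s] less.prems by simp
  then obtain n' where n: "n = Suc n'" using less.prems(7) by (cases n) auto
  have tu: "tree_vertex d u" using tv[of s] less.prems by simp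
  let ?\<phi> = "hop d \<eta> (\<lambda>c. returns d K \<eta> n' c (bars K \<eta> c)) u"
  show ?case
  proof (cases "s = t")
    case True
    then show ?thesis unfolding n returns.simps using scan.stop[of j K P ?\<phi>] less.prems(4,8) by simp
  next
    case False
    then have st: "s < t" using less.prems(1) by simp
    have sP: "s mod K \<notin> P" using less.prems(2,5) st by blast
    have smK: "s mod K < K" using K by simp
    have nou: "u = [] \<or> \<not> \<eta> (u, s mod K)" using less.prems(6)[OF _ smK] sP by blast
    show ?thesis
    proof (cases "\<exists>c<d. \<eta> (c # u, s mod K)")
      case no: False
      then have "X (Suc s) = u" using X[of s] less.prems(2) nou by (auto simp: slot_step_def)
      then have "returns d K \<eta> n u P (s mod K) (t mod K)"
        using st less.prems by (intro less.hyps[of t "Suc s"]) (auto simp: mod_Suc_eq)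
      then show ?thesis unfolding n returns.simps
        using no sP less.prems(8) by (intro scan.step[of j K P ?\<phi> "s mod K"]) (auto simp: hop_def)
    next
      case True
      then obtain c where c: "c < d" "\<eta> (c # u, s mod K)" by blast
      have tch: "tree_vertex d (c' # u)" if "c' < d" for c' using that tu by (simp add: tree_vertex_def)
      have uniq: "c' = c" if "c' < d" "\<eta> (c' # u, s mod K)" for c'
        using sep[OF tch[OF that(1)] tch[OF c(1)] _ _ that(2) c(2) smK] lu by simp
      have "(LEAST c'. c' < d \<and> \<eta> (c' # u, s mod K)) = c"
      proof (rule Least_equality)
        show "c < d \<and> \<eta> (c # u, s mod K)" using c by blast
        show "c \<le> y" if "y < d \<and> \<eta> (y # u, s mod K)" for y using uniq[of y] that by blast
      qed
      moreover have "\<not> (u \<noteq> [] \<and> \<eta> (u, s mod K))" using nou by blast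
      ultimately have "slot_step d \<eta> (s mod K) u = c # u" using c unfolding slot_step_def by metis
      then have Xs: "X (Suc s) = c # u" using X[of s] less.prems(2) by simp
      \<comment> \<open>First time back at \<open>u\<close>. Until then the walk is in the subtree
        of \<open>c # u\<close>, and its last step crosses the edge \<open>c # u\<close>, in slot
        \<open>t2 mod K\<close>.\<close>
      define r where "r = (LEAST r. s < r \<and> X r = u)"
      have r: "s < r" "X r = u" using LeastI[of "\<lambda>r. s < r \<and> X r = u" t] st less.prems(3) by (auto simp: r_def)
      have rmin: "X q \<noteq> u" if "s < q" "q < r" for q using not_less_Least[of q "\<lambda>r. s < r \<and> X r = u"] that by (auto simp: r_def)
      have rt: "r \<le> t" using Least_le[of "\<lambda>r. s < r \<and> X r = u" t] st less.prems(3) by (simp add: r_def)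
      have r2: "Suc s < r" using r Xs by (metis Suc_lessI not_Cons_self2)
      have up: "w = [] \<and> \<eta> (c # u, q mod K)" if q: "X q = w @ c # u" "X (Suc q) = u" for q w
      proof -
        have e: "u = slot_step d \<eta> (q mod K) (w @ c # u)" using X[of q] q by simp
        show ?thesis
        proof (rule slot_step_cases[of "w @ c # u" \<eta> "q mod K" d])
          assume 1: "\<eta> (w @ c # u, q mod K)" "slot_step d \<eta> (q mod K) (w @ c # u) = tl (w @ c # u)"
          have "length u = length (tl (w @ c # u))" using e 1(2) by simp
          then have "w = []" by simp
          then show ?thesis using 1(1) by simp
        next
          fix c' assume "slot_step d \<eta> (q mod K) (w @ c # u) = c' # w @ c # u"
          then have "length u = length (c' # w @ c # u)" using e by simp
          then show ?thesis by simp
        next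
          assume "slot_step d \<eta> (q mod K) (w @ c # u) = w @ c # u"
          then have "length u = length (w @ c # u)" using e by simp
          then show ?thesis by simp
        qed
      qed
      have sub: "\<exists>w. X (Suc s + i) = w @ c # u" if "Suc s + i < r" for i
        using that
      proof (induction i)
        case 0 then show ?case using Xs by auto
      next
        case (Suc i)
        then obtain w where w: "X (Suc s + i) = w @ c # u" by auto
        have ne: "X (Suc (Suc s + i)) \<noteq> u" using Suc.prems by (intro rmin) auto
        have e: "X (Suc s + Suc i) = slot_step d \<eta> ((Suc s + i) mod K) (w @ c # u)" using X[of "Suc s + i"] w by simp
        show ?case
        proof (rule slot_step_cases[of "w @ c # u" \<eta> "(Suc s + i) mod K" d])
          assume "slot_step d \<eta> ((Suc s + i) mod K) (w @ c # u) = tl (w @ c # u)"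
          then show ?thesis using e ne by (cases w) auto
        next
          fix c' assume "slot_step d \<eta> ((Suc s + i) mod K) (w @ c # u) = c' # w @ c # u"
          then show ?thesis using e by (metis append_Cons)
        next
          assume "slot_step d \<eta> ((Suc s + i) mod K) (w @ c # u) = w @ c # u"
          then show ?thesis using e by metis
        qed
      qed
      define t2 where "t2 = r - 1"
      have t2: "Suc t2 = r" "Suc s \<le> t2" using r2 by (auto simp: t2_def)
      obtain w where w: "X t2 = w @ c # u" using sub[of "t2 - Suc s"] t2 by auto
      have wN: "X t2 = c # u" "\<eta> (c # u, t2 mod K)" using up[OF w] r(2) t2(1) w by auto
      \<comment> \<open>\<open>t2\<close> is the first time at which the walk is at
        \<open>c # u\<close> in a slot with a bar of that edge: an earlier one would have brought it
        back to \<open>u\<close> before \<open>r\<close>.\<close>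
      have inner: "returns d K \<eta> n' (c # u) (bars K \<eta> (c # u)) (s mod K) (t2 mod K)"
      proof (rule less.hyps[of t2 "Suc s"])
        show "t2 mod K \<in> bars K \<eta> (c # u)" using wN(2) K by (simp add: bars_def)
        fix q assume q: "Suc s \<le> q" "q < t2" "X q = c # u"
        show "q mod K \<notin> bars K \<eta> (c # u)"
        proof
          assume "q mod K \<in> bars K \<eta> (c # u)"
          then have "X (Suc q) = u" using X[of q] q(3) by (simp add: slot_step_def bars_def)
          then show False using rmin[of "Suc q"] q t2 by auto
        qed
      qed (use Xs wN t2 rt st less.prems n in \<open>auto simp: bars_def mod_Suc_eq\<close>)
      have outer: "returns d K \<eta> n u P (t2 mod K) (t mod K)"
        using r rt t2 less.prems st by (intro less.hyps[of t r]) (auto simp: mod_Suc_eq)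
      have "?\<phi> (s mod K) (t2 mod K)" unfolding hop_def using c uniq inner by blast
      then show ?thesis using outer unfolding n returns.simps
        using sP less.prems(8) by (intro scan.step[of j K P ?\<phi> "t2 mod K"]) auto
    qed
  qed
qed

text \<open>On a finite orbit the permutation is injective, so the cycle through \<open>v\<close>
  closes; with the edge above \<open>v\<close> silent, the closed walk is a return in the sense of
  \<open>returns\<close>. The depth \<open>N\<close> is quantified before the mesh \<open>l\<close>,
  since \<open>separated\<close> holds at a given depth once the mesh is fine enough.\<close>

lemma returns_of_finite_orbit:
  assumes r: "regular d T M \<omega>" and T: "T > 0" and M: "M > 0" and v: "tree_vertex d v"
    and iso: "v \<noteq> [] \<Longrightarrow> \<not> occ T \<omega> (v, 0)"
    and fin: "finite (range (\<lambda>n. (stir_perm d \<omega> T ^^ n) v))"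
  shows "\<exists>N0. \<forall>N\<ge>N0. \<exists>l0. \<forall>l\<ge>l0. \<exists>i.
    returns d (M * l) (occ (T / real (M * l)) \<omega>) N v {M * l - 1} (M * l - 1) i"
proof -
  let ?\<sigma> = "stir_perm d \<omega> T"
  let ?O = "range (\<lambda>n. (?\<sigma> ^^ n) v)"
  let ?w = "\<lambda>l. walk d (M * l) (occ (T / real (M * l)) \<omega>)"
  define D where "D x = (SOME D. \<forall>N>D. \<forall>l>0. separated d T N (M * l) \<omega> \<longrightarrow>
    ?\<sigma> x = ?w l x (M * l) \<and> (\<forall>s\<le>M * l. length (?w l x s) < N))" for x
  have D: "?\<sigma> x = ?w l x (M * l)" "s \<le> M * l \<Longrightarrow> length (?w l x s) < N"
    if "tree_vertex d x" "N > D x" "l > 0" "separated d T N (M * l) \<omega>" for x N l s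
    using someI_ex[OF stir_perm_walk[OF r T M that(1)], folded D_def] that by blast+
  have sepM: "\<exists>l1. \<forall>l\<ge>l1. l > 0 \<and> separated d T N (M * l) \<omega>" for N
  proof -
    obtain K0 where K0: "\<forall>K\<ge>K0. separated d T N K \<omega>" using eventually_separated[OF r T] by blast
    have "l > 0 \<and> separated d T N (M * l) \<omega>" if "l \<ge> Suc K0" for l
    proof -
      have "l \<le> M * l" using M by simp
      then have "K0 \<le> M * l" using that by linarith
      then show ?thesis using K0 that by simp
    qed
    then show ?thesis by blast
  qed
  have tvO: "tree_vertex d x" if "x \<in> ?O" for x
  proof -
    have "tree_vertex d ((?\<sigma> ^^ n) v)" for n
    proof (induction n)
      case (Suc n)
      let ?x = "(?\<sigma> ^^ n) v"
      obtain l where l: "l > 0" "separated d T (Suc (D ?x)) (M * l) \<omega>" using sepM by blast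
      show ?case using D(1)[OF Suc _ l] tree_vertex_walk[OF Suc] by simp
    qed (simp add: v)
    then show ?thesis using that by auto
  qed
  define N0 where "N0 = Suc (Max (insert (length v) (D ` ?O)))"
  have N0: "D x < N" if "x \<in> ?O" "N \<ge> N0" for x N
  proof -
    have "D x \<le> Max (insert (length v) (D ` ?O))" using that fin by (intro Max_ge) auto
    then show ?thesis using that(2) by (simp add: N0_def)
  qed
  have "\<exists>k>0. (?\<sigma> ^^ k) v = v"
  proof -
    obtain l where l: "l > 0" "separated d T N0 (M * l) \<omega>" using sepM by blast
    let ?K = "M * l"
    have K: "?K > 0" using M l by simp
    \<comment> \<open>The slots are undone one by one from the last to the first; the finite orbit
      gives one depth bound for all its points.\<close>
    have step_inj: "x = y" if xy: "x \<in> ?O" "y \<in> ?O" "?\<sigma> x = ?\<sigma> y" for x y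
    proof -
      have e: "?w l x ?K = ?w l y ?K" using D(1)[OF tvO N0 l] xy by auto
      have "?w l x (?K - i) = ?w l y (?K - i)" if "i \<le> ?K" for i
        using that
      proof (induction i)
        case 0 then show ?case using e by simp
      next
        case (Suc i)
        let ?j = "?K - Suc i"
        have j: "?K - i = Suc ?j" "?j < ?K" using Suc.prems by auto
        show ?case
        proof (rule slot_step_inj[of d N0 "occ (T / real ?K) \<omega>" ?j])
          show "slot_step d (occ (T / real ?K) \<omega>) ?j (?w l x ?j) = slot_step d (occ (T / real ?K) \<omega>) ?j (?w l y ?j)"
            using Suc j by simp
          show "c = c'" if "tree_vertex d c" "tree_vertex d c'" "length c \<le> N0" "length c' \<le> N0"
            "occ (T / real ?K) \<omega> (c, ?j)" "occ (T / real ?K) \<omega> (c', ?j)" for c c'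
            using l(2) j(2) that unfolding separated_def occ_def by fastforce
        qed (use D(2)[OF tvO N0 l, of x] D(2)[OF tvO N0 l, of y] xy tree_vertex_walk tvO in auto)
      qed
      from this[of ?K] show ?thesis by simp
    qed
    have "\<not> inj (\<lambda>n. (?\<sigma> ^^ n) v)" using fin finite_imageD[of "\<lambda>n. (?\<sigma> ^^ n) v" UNIV] by auto
    then obtain a b where "a \<noteq> b" "(?\<sigma> ^^ a) v = (?\<sigma> ^^ b) v" by (auto simp: inj_on_def)
    then obtain a k where "k > 0" "(?\<sigma> ^^ a) v = (?\<sigma> ^^ (a + k)) v"
      by (cases "a < b") (metis add_diff_inverse_nat less_imp_not_less zero_less_diff, metis add_diff_inverse_nat nat_neq_iff zero_less_diff)
    then have "(?\<sigma> ^^ k) v = v"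
    proof (induction a)
      case (Suc a)
      have "?\<sigma> ((?\<sigma> ^^ a) v) = ?\<sigma> ((?\<sigma> ^^ (a + k)) v)" using Suc.prems by simp
      from step_inj[OF rangeI rangeI this] have "(?\<sigma> ^^ a) v = (?\<sigma> ^^ (a + k)) v" .
      then show ?case using Suc.prems(1) Suc.IH by blast
    qed simp
    then show ?thesis using \<open>k > 0\<close> by blast
  qed
  then obtain k where k: "k > 0" "(?\<sigma> ^^ k) v = v" by blast
  have main: "\<exists>i. returns d (M * l) (occ (T / real (M * l)) \<omega>) N v {M * l - 1} (M * l - 1) i"
    if N: "N \<ge> N0" and l: "l > 0" "separated d T N (M * l) \<omega>" for N l
  proof -
    let ?K = "M * l" let ?\<eta> = "occ (T / real (M * l)) \<omega>"
    let ?X = "?w l v"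
    have K: "?K > 0" using M l by simp
    have X: "?X (Suc s) = slot_step d ?\<eta> (s mod ?K) (?X s)" for s by simp
    have XK: "?X (?K * n) = (?\<sigma> ^^ n) v" for n
    proof (induction n)
      case (Suc n)
      have "?X (?K * Suc n) = ?w l (?X (?K * n)) ?K" using walk_add[of d ?K ?\<eta> v n ?K] by (simp add: add.commute)
      also have "\<dots> = ?\<sigma> ((?\<sigma> ^^ n) v)" unfolding Suc using D(1)[OF tvO N0[OF _ N] l] by auto
      finally show ?case by simp
    qed simp
    have len: "length (?X s) < N" for s
    proof -
      have "?X s = ?w l (?X (?K * (s div ?K))) (s mod ?K)"
        using walk_add[of d ?K ?\<eta> v "s div ?K" "s mod ?K"] by simp
      also have "length \<dots> < N" unfolding XK using K by (intro D(2)[OF tvO N0[OF _ N] l]) auto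
      finally show ?thesis .
    qed
    have sep: "c = c'" if "tree_vertex d c" "tree_vertex d c'" "length c \<le> N" "length c' \<le> N"
        "?\<eta> (c, j)" "?\<eta> (c', j)" "j < ?K" for c c' j
      using l(2) that unfolding separated_def occ_def by fastforce
    have last: "\<not> ?\<eta> (c, ?K - 1)" if "tree_vertex d c" "length c \<le> N" for c
      using l(2) that unfolding separated_def by blast
    have tv: "tree_vertex d (?X s)" for s by (rule tree_vertex_walk[OF v])
    \<comment> \<open>The last slot of a turn is empty, so a walk that is at \<open>v\<close> after
      \<open>k\<close> turns is there already before that slot is read.\<close>
    define t0 where "t0 = ?K * k - 1"
    have t0: "Suc t0 = ?K * k" using K k by (simp add: t0_def)
    have t0m: "t0 mod ?K = ?K - 1"
    proof -
      obtain k' where "k = Suc k'" using k(1) by (cases k) auto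
      then have "t0 = (?K - 1) + ?K * k'" using K by (simp add: t0_def algebra_simps)
      then have "t0 mod ?K = (?K - 1) mod ?K" by (simp only: mod_mult_self2)
      then show ?thesis using K by simp
    qed
    have Xt0: "?X t0 = v"
    proof -
      have "v = slot_step d ?\<eta> (?K - 1) (?X t0)" using X[of t0] XK[of k] k(2) t0 t0m by simp
      moreover have "slot_step d ?\<eta> (?K - 1) (?X t0) = ?X t0"
        by (rule slot_step_cases[of "?X t0" ?\<eta> "?K - 1" d])
          (use last[OF tv[of t0]] last[of "_ # ?X t0"] len[of t0] tv[of t0] in \<open>auto simp: tree_vertex_def\<close>)
      ultimately show ?thesis by simp
    qed
    \<comment> \<open>\<open>k\<close> need not be the least period, while \<open>returns\<close>
      stops at the first visit to \<open>v\<close> in slot K - 1.\<close>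
    define t where "t = (LEAST t. ?X t = v \<and> t mod ?K = ?K - 1)"
    have t: "?X t = v" "t mod ?K = ?K - 1" using LeastI[of "\<lambda>t. ?X t = v \<and> t mod ?K = ?K - 1" t0] Xt0 t0m by (auto simp: t_def)
    have "returns d ?K ?\<eta> N v {?K - 1} (?K - 1) (t mod ?K)"
    proof (rule walk_returns[where X = ?X and s = 0 and N = N, OF K X len tv])
      show "r mod ?K \<notin> {?K - 1}" if "r < t" "?X r = v" for r
        using not_less_Least[of r "\<lambda>t. ?X t = v \<and> t mod ?K = ?K - 1"] that by (auto simp: t_def)
      show "i \<in> {?K - 1}" if "v \<noteq> []" "i < ?K" "?\<eta> (v, i)" for i
        using occ_coarsen[of T 1 ?K \<omega> v i] that iso T K by simp
      show "c = c'" if "tree_vertex d c" "tree_vertex d c'" "length c \<le> N" "length c' \<le> N"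
        "?\<eta> (c, j)" "?\<eta> (c', j)" "j < ?K" for c c' j using sep that by blast
    qed (use t K in auto)
    then show ?thesis by blast
  qed
  show ?thesis
  proof (rule exI[of _ N0], intro allI impI)
    fix N assume "N0 \<le> N"
    then show "\<exists>l1. \<forall>l\<ge>l1. \<exists>i. returns d (M * l) (occ (T / real (M * l)) \<omega>) N v {M * l - 1} (M * l - 1) i"
      using sepM[of N] main by metis
  qed
qed

section \<open>Almost sure regularity and independent trials\<close>

text \<open>Covering the exceptional set by events of arbitrarily small probability makes it null
  without asking for its measurability. This is how \<open>has_infinite_cycle\<close> is treated at
  the end.\<close>

lemma AE_if_small:
  assumes "\<And>e. e > 0 \<Longrightarrow> \<exists>A\<in>stir.events. stir.prob A \<le> e \<and> {\<omega>. \<not> P \<omega>} \<subseteq> A"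
  shows "AE \<omega> in stir_space. P \<omega>"
proof -
  have "\<exists>A. \<forall>n. A n \<in> stir.events \<and> stir.prob (A n) \<le> 1 / real (Suc n) \<and> {\<omega>. \<not> P \<omega>} \<subseteq> A n"
    using assms by (intro choice allI) (metis of_nat_0_less_iff zero_less_Suc zero_less_divide_1_iff)
  then obtain A where A: "\<And>n. A n \<in> stir.events" "\<And>n. stir.prob (A n) \<le> 1 / real (Suc n)" "\<And>n. {\<omega>. \<not> P \<omega>} \<subseteq> A n" by blast
  let ?N = "\<Inter>n. A n"
  have N: "?N \<in> stir.events" using A(1) by auto
  have "stir.prob ?N \<le> 1 / real (Suc n)" for n
    using stir.finite_measure_mono[of ?N "A n"] A(1,2) by (meson INT_lower UNIV_I order_trans)
  then have "stir.prob ?N \<le> 0"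
    by (intro LIMSEQ_le_const[OF LIMSEQ_inverse_real_of_nat]) (auto simp: inverse_eq_divide)
  then have "emeasure stir_space ?N = 0" by (simp add: stir.emeasure_eq_measure measure_nonneg antisym)
  then show ?thesis using N A(3) by (intro AE_I[of _ _ ?N]) auto
qed

lemma AE_coordinates_pos: "AE \<omega> in stir_space. \<forall>z. \<omega> z > 0"
  unfolding AE_all_countable stir_space_eq
  by (intro allI AE_PiM_component exp1.prob_space_axioms AE_exp1_pos) simp

text \<open>If all arrivals stay below T, then, gaps being positive, every gap is at most T; for the
  first n gaps this has probability q^n with q < 1.\<close>

lemma AE_arrival_unbounded:
  assumes T: "T > 0"
  shows "AE \<omega> in stir_space. \<forall>c. \<exists>n. arrival \<omega> c n > T"
proof -
  interpret product_prob_space "\<lambda>_. exp1" "UNIV :: (nat list \<times> nat) set" by unfold_locales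
  define q where "q = exp1.prob {..T}"
  have "emeasure exp1 {..T} = ennreal (1 - exp (- T))"
    using emeasure_erlang_density[where l = 1 and k = 0 and a = T] T unfolding exp1_def by (simp add: erlang_CDF_def)
  then have q: "q = 1 - exp (- T)" using T by (simp add: q_def measure_def)
  have q01: "0 \<le> q" "q < 1" using T by (auto simp: q)
  have "AE \<omega> in stir_space. (\<forall>z. \<omega> z > 0) \<longrightarrow> (\<exists>n. arrival \<omega> c n > T)" (is "AE \<omega> in _. ?P \<omega>") for c
  proof (rule AE_if_small)
    fix e :: real assume "e > 0"
    then obtain n where n: "q ^ n < e" using q01 real_arch_pow_inv by blast
    let ?J = "Pair c ` {..<n}"
    let ?A = "{\<omega> \<in> space stir_space. \<forall>z\<in>?J. \<omega> z \<in> {..T}}"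
    have "emeasure stir_space ?A = (\<Prod>z\<in>?J. emeasure exp1 {..T})"
      unfolding stir_space_eq by (rule emeasure_PiM_Collect) auto
    also have "\<dots> = ennreal (q ^ n)"
      by (simp add: card_image inj_on_def q_def exp1.emeasure_eq_measure ennreal_power)
    finally have "stir.prob ?A = q ^ n" using q01 by (simp add: measure_def)
    moreover have "?A \<in> stir.events" by measurable
    moreover have "{\<omega>. \<not> ?P \<omega>} \<subseteq> ?A"
    proof
      fix \<omega> assume h: "\<omega> \<in> {\<omega>. \<not> ?P \<omega>}"
      have "\<omega> (c, k) \<le> T" for k
      proof -
        have "\<omega> (c, k) \<le> arrival \<omega> c k"
          unfolding arrival_def by (rule member_le_sum) (use h in \<open>auto intro: less_imp_le\<close>)
        then show ?thesis using h by (auto simp: not_less intro: order_trans)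
      qed
      then show "\<omega> \<in> ?A" by auto
    qed
    ultimately show "\<exists>A\<in>stir.events. stir.prob A \<le> e \<and> {\<omega>. \<not> ?P \<omega>} \<subseteq> A"
      using n by (intro bexI[of _ ?A]) auto
  qed
  then have "AE \<omega> in stir_space. \<forall>c. (\<forall>z. \<omega> z > 0) \<longrightarrow> (\<exists>n. arrival \<omega> c n > T)"
    unfolding AE_all_countable by blast
  with AE_coordinates_pos show ?thesis by eventually_elim auto
qed

lemma ex_slot:
  assumes "K > 0" "T > 0" "0 < t" "t \<le> T"
  shows "\<exists>j<K. t \<in> slot (T / real K) j"
proof -
  let ?h = "T / real K"
  have h: "?h > 0" using assms by simp
  define j where "j = nat (\<lceil>t / ?h\<rceil> - 1)"
  have "0 < t / ?h" using assms h by simp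
  then have c: "\<lceil>t / ?h\<rceil> \<ge> 1" by linarith
  have j: "real j = of_int \<lceil>t / ?h\<rceil> - 1" using c by (simp add: j_def)
  have "real j < t / ?h" "t / ?h \<le> real (Suc j)" using j by (auto; linarith)+
  then have "real j * ?h < t" "t \<le> real (Suc j) * ?h"
    using h by (simp_all only: pos_less_divide_eq pos_divide_le_eq)
  then have s: "t \<in> slot ?h j" by (simp add: slot_def)
  have "t / ?h \<le> real K" using assms by (simp add: field_simps)
  then have "real j < real K" using \<open>real j < t / ?h\<close> by linarith
  then show ?thesis using s by auto
qed

lemma prob_occ_le:
  assumes "T > 0" "K > 0" and Z: "finite Z"
  shows "stir.prob {\<omega>. \<forall>z\<in>Z. occ (T / real K) \<omega> z} \<le> (T / real K) ^ card Z"
proof -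
  have h: "T / real K > 0" using assms by simp
  have "stir.prob {\<omega>. \<forall>z\<in>Z. occ (T / real K) \<omega> z} = (1 - exp (- (T / real K))) ^ card Z"
    using prob_occ_pattern[OF h, of "{}" Z] Z by simp
  also have "\<dots> \<le> (T / real K) ^ card Z"
    using h one_minus_exp_bounds(1)[of "T / real K"] by (intro power_mono) auto
  finally show ?thesis .
qed

lemma occ_events: "finite Z \<Longrightarrow> {\<omega>. \<forall>z\<in>Z. occ h \<omega> z} \<in> stir.events"
proof -
  assume [measurable]: "finite Z"
  have "{\<omega> \<in> space stir_space. \<forall>z\<in>Z. occ h \<omega> z} \<in> stir.events" by measurable
  then show ?thesis by simp
qed

lemma ex_large_nat: "e > (0::real) \<Longrightarrow> \<exists>K::nat>0. x / real K \<le> e"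
proof -
  assume e: "e > 0"
  have "x / e \<le> real (nat \<lceil>x / e\<rceil> + 1)" by linarith
  then have "x / real (nat \<lceil>x / e\<rceil> + 1) \<le> e" using e by (simp add: field_simps)
  then show ?thesis by (intro exI[of _ "nat \<lceil>x / e\<rceil> + 1"]) auto
qed

text \<open>A coincidence up to T puts both edges into one slot. Each of the K slots has probability
  at most \<open>(T / K)\<^sup>2\<close> for this, in total \<open>T\<^sup>2 / K\<close>.\<close>

lemma AE_arrival_distinct:
  assumes T: "T > 0"
  shows "AE \<omega> in stir_space. \<forall>c c' n m. c \<noteq> c' \<longrightarrow> arrival \<omega> c n = arrival \<omega> c' m \<longrightarrow> arrival \<omega> c n > T"
proof -
  have pos: "arrival \<omega> c n > 0" if "\<forall>z. \<omega> z > 0" for \<omega> c n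
    unfolding arrival_def using that by (intro sum_pos) auto
  have "AE \<omega> in stir_space. (\<forall>z. \<omega> z > 0) \<longrightarrow> (\<forall>n m. arrival \<omega> c n = arrival \<omega> c' m \<longrightarrow> arrival \<omega> c n > T)"
    (is "AE \<omega> in _. ?P \<omega>") if cc: "c \<noteq> c'" for c c'
  proof (rule AE_if_small)
    fix e :: real assume "e > 0"
    then obtain K :: nat where K: "K > 0" "T\<^sup>2 / real K \<le> e" using ex_large_nat by blast
    let ?B = "\<lambda>j. {\<omega>. \<forall>z\<in>{(c, j), (c', j)}. occ (T / real K) \<omega> z}"
    let ?A = "\<Union>j<K. ?B j"
    have B: "?B j \<in> stir.events" for j by (rule occ_events) simp
    have "stir.prob ?A \<le> (\<Sum>j<K. stir.prob (?B j))"
      by (rule stir.finite_measure_subadditive_finite) (use B in auto)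
    also have "\<dots> \<le> (\<Sum>j<K. (T / real K)\<^sup>2)"
    proof (rule sum_mono)
      fix j
      show "stir.prob (?B j) \<le> (T / real K)\<^sup>2"
      proof -
        have c2: "card {(c, j), (c', j)} = 2" using cc by simp
        show ?thesis using prob_occ_le[OF T K(1), of "{(c, j), (c', j)}"] unfolding c2 by blast
      qed
    qed
    also have "\<dots> = T\<^sup>2 / real K" using K by (simp add: power2_eq_square field_simps)
    finally have "stir.prob ?A \<le> e" using K by simp
    moreover have "{\<omega>. \<not> ?P \<omega>} \<subseteq> ?A"
    proof
      fix \<omega> assume "\<omega> \<in> {\<omega>. \<not> ?P \<omega>}"
      then obtain n m where h: "\<forall>z. \<omega> z > 0" "arrival \<omega> c n = arrival \<omega> c' m" "arrival \<omega> c n \<le> T" by (auto simp: not_less)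
      obtain j where "j < K" "arrival \<omega> c n \<in> slot (T / real K) j"
        using ex_slot[OF K(1) T pos[OF h(1)] h(3)] by blast
      then have "occ (T / real K) \<omega> (c, j)" "occ (T / real K) \<omega> (c', j)"
        unfolding occ_def fst_conv snd_conv using h(2) by metis+
      then have "\<omega> \<in> ?B j" by blast
      then show "\<omega> \<in> ?A" using \<open>j < K\<close> by blast
    qed
    ultimately show "\<exists>A\<in>stir.events. stir.prob A \<le> e \<and>
      {\<omega>. \<not> ?P \<omega>} \<subseteq> A"
      using B by (intro bexI[of _ ?A]) auto
  qed
  then have "AE \<omega> in stir_space. \<forall>c c'. c \<noteq> c' \<longrightarrow> (\<forall>z. \<omega> z > 0) \<longrightarrow> (\<forall>n m. arrival \<omega> c n = arrival \<omega> c' m \<longrightarrow> arrival \<omega> c n > T)"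
    unfolding AE_all_countable by (auto intro!: AE_impI)
  with AE_coordinates_pos show ?thesis by eventually_elim blast
qed

lemma AE_arrival_neq:
  assumes T: "T > 0"
  shows "AE \<omega> in stir_space. \<forall>c n. arrival \<omega> c n \<noteq> T"
proof -
  have "AE \<omega> in stir_space. \<forall>n. arrival \<omega> c n \<noteq> T" for c
  proof (rule AE_if_small)
    fix e :: real assume "e > 0"
    then obtain K :: nat where K: "K > 0" "T / real K \<le> e" using ex_large_nat by blast
    let ?A = "{\<omega>. \<forall>z\<in>{(c, K - 1)}. occ (T / real K) \<omega> z}"
    have "stir.prob ?A \<le> e" using prob_occ_le[OF T K(1), of "{(c, K - 1)}"] K by simp
    moreover have "T \<in> slot (T / real K) (K - 1)"
      using K T by (auto simp: slot_def of_nat_diff field_simps)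
    then have "{\<omega>. \<not> (\<forall>n. arrival \<omega> c n \<noteq> T)} \<subseteq> ?A" by (auto simp: occ_def)
    ultimately show "\<exists>A\<in>stir.events. stir.prob A \<le> e \<and> {\<omega>. \<not> (\<forall>n. arrival \<omega> c n \<noteq> T)} \<subseteq> A"
      using occ_events[of "{(c, K - 1)}"] by (intro bexI[of _ ?A]) auto
  qed
  then show ?thesis unfolding AE_all_countable by blast
qed

text \<open>First moment bound: there are d^m descending paths of length m, each entirely open with
  probability at most (T/M)^m.\<close>

lemma AE_subcritical:
  assumes T: "T > 0" and M: "real d * T < real M"
  shows "AE \<omega> in stir_space. \<forall>v j. \<exists>m. \<forall>w. tree_vertex d w \<longrightarrow> length w = m \<longrightarrow>
    (\<exists>i<m. \<not> occ (T / real M) \<omega> (drop i w @ v, j))"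
proof -
  have "0 \<le> real d * T" using T by simp
  then have M0: "M > 0" using M by linarith
  define q where "q = real d * T / real M"
  have q: "0 \<le> q" "q < 1" using T M M0 by (auto simp: q_def)
  have "AE \<omega> in stir_space. \<exists>m. \<forall>w. tree_vertex d w \<longrightarrow> length w = m \<longrightarrow>
    (\<exists>i<m. \<not> occ (T / real M) \<omega> (drop i w @ v, j))" (is "AE \<omega> in _. ?P \<omega>") for v j
  proof (rule AE_if_small)
    fix e :: real assume "e > 0"
    then obtain m where m: "q ^ m < e" using q real_arch_pow_inv by blast
    let ?W = "{w. set w \<subseteq> {..<d} \<and> length w = m}"
    let ?Z = "\<lambda>w. (\<lambda>i. (drop i w @ v, j)) ` {..<m}"
    let ?B = "\<lambda>w. {\<omega>. \<forall>z\<in>?Z w. occ (T / real M) \<omega> z}"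
    let ?A = "\<Union>w\<in>?W. ?B w"
    have fW: "finite ?W" by (rule finite_lists_length_eq) simp
    have B: "?B w \<in> stir.events" for w by (rule occ_events) simp
    have "stir.prob ?A \<le> (\<Sum>w\<in>?W. stir.prob (?B w))"
      by (rule stir.finite_measure_subadditive_finite) (use B fW in auto)
    also have "\<dots> \<le> (\<Sum>w\<in>?W. (T / real M) ^ m)"
    proof (rule sum_mono)
      fix w assume w: "w \<in> ?W"
      have "inj_on (\<lambda>i. (drop i w @ v, j)) {..<m}"
      proof (rule inj_onI)
        fix x y assume "x \<in> {..<m}" "y \<in> {..<m}" "(drop x w @ v, j) = (drop y w @ v, j)"
        then have "length (drop x w) = length (drop y w)" "x < m" "y < m" by auto
        then show "x = y" using w by auto
      qed
      then have "card (?Z w) = m" by (simp add: card_image)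
      then show "stir.prob (?B w) \<le> (T / real M) ^ m" using prob_occ_le[OF T M0, of "?Z w"] by simp
    qed
    also have "\<dots> = q ^ m"
      by (simp add: card_lists_length_eq q_def power_mult_distrib power_divide)
    finally have "stir.prob ?A \<le> e" using m by simp
    moreover have "{\<omega>. \<not> ?P \<omega>} \<subseteq> ?A"
    proof
      fix \<omega> assume "\<omega> \<in> {\<omega>. \<not> ?P \<omega>}"
      then obtain w where w: "tree_vertex d w" "length w = m" "\<forall>i<m. occ (T / real M) \<omega> (drop i w @ v, j)" by blast
      then have "w \<in> ?W" by (auto simp: tree_vertex_def)
      moreover have "\<omega> \<in> ?B w" using w(3) by blast
      ultimately show "\<omega> \<in> ?A" by blast
    qed
    ultimately show "\<exists>A\<in>stir.events. stir.prob A \<le> e \<and> {\<omega>. \<not> ?P \<omega>} \<subseteq> A"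
      using B fW by (intro bexI[of _ ?A]) auto
  qed
  then show ?thesis unfolding AE_all_countable by blast
qed

lemma AE_regular:
  assumes T: "T > 0" and M: "real d * T < real M"
  shows "AE \<omega> in stir_space. regular d T M \<omega>"
  using AE_coordinates_pos AE_arrival_unbounded[OF T] AE_arrival_distinct[OF T] AE_arrival_neq[OF T] AE_subcritical[OF T M]
  unfolding regular_def by eventually_elim (intro conjI)

text \<open>The subtrees below these vertices are disjoint, which provides independent trials.\<close>
definition branch :: "nat \<Rightarrow> nat list" where
  "branch i = 1 # replicate i 0"

text \<open>The branch is recovered from the address of any descendant: \<open>i\<close> is the
  number of zeros at the end of the list.\<close>

lemma append_branch_eqD: "w @ branch i = w' @ branch i' \<Longrightarrow> i = i'"
proof -
  assume "w @ branch i = w' @ branch i'"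
  then have "takeWhile (\<lambda>x. x = 0) (rev (w @ branch i)) = takeWhile (\<lambda>x. x = 0) (rev (w' @ branch i'))" by simp
  moreover have "takeWhile (\<lambda>x. x = 0) (rev (w @ branch i)) = replicate i 0" for w i
    by (simp add: branch_def takeWhile_append)
  ultimately show ?thesis by (metis length_replicate)
qed

text \<open>A bar above the branch vertex could let its cycle leave the subtree, so such a trial is
  written off; this costs a factor exp (-T) in the probability of success.\<close>

definition branch_fails :: "nat \<Rightarrow> nat \<Rightarrow> nat \<Rightarrow> nat \<Rightarrow> (nat list \<times> nat \<Rightarrow> bool) \<Rightarrow> bool" where
  "branch_fails d K n b \<eta> \<longleftrightarrow> (\<exists>j<K. \<eta> (branch b, j)) \<or>
     (\<exists>i. returns d K \<eta> n (branch b) {K - 1} (K - 1) i)"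

text \<open>A trial succeeds with probability at least exp (-T) (1 - s): silence of the edge above
  and failure to return concern disjoint sets of edges. Depth n + m accommodates excursions of depth
  n below the first m branches.\<close>

lemma pr_all_branches_return:
  assumes d: "d \<ge> 2" and T: "T > 0" and K: "K > 0"
    and bound: "\<And>N n v j. tree_vertex d v \<Longrightarrow> length v + n \<le> N \<Longrightarrow> j < K \<Longrightarrow>
      bernoulli_field.pr (idx d K N) (1 - exp (- T / real K)) (\<lambda>\<eta>. \<exists>i. returns d K \<eta> n v {j} j i) \<le> s"
    and L: "L = n + m"
  shows "bernoulli_field.pr (idx d K L) (1 - exp (- T / real K))
    (\<lambda>\<eta>. \<forall>b\<in>{..<m}. branch_fails d K n b \<eta>) \<le> (1 - exp (- T) * (1 - s)) ^ m"
proof -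
  let ?p = "1 - exp (- T / real K)"
  interpret tree_field d K L ?p using K T by unfold_locales auto
  let ?S = "\<lambda>b. {branch b} \<times> {..<K} \<union> below d K n (branch b)"
  let ?F = "branch_fails d K n"
  have tvb: "tree_vertex d (branch b)" "length (branch b) = Suc b" for b
    using d by (auto simp: branch_def tree_vertex_def)
  have ret: "depends (\<lambda>\<eta>. \<exists>i. returns d K \<eta> n v P j i) (below d K n v)" for v P j
    by (intro depends_bex depends_returns K)
  have dep: "depends (?F b) (?S b)" for b
  proof (rule dependsI)
    fix \<eta> \<eta>' assume e: "\<And>x. x \<in> ?S b \<Longrightarrow> \<eta> x = \<eta>' x" and F: "?F b \<eta>"
    have "(\<exists>i. returns d K \<eta> n (branch b) {K - 1} (K - 1) i) = (\<exists>i. returns d K \<eta>' n (branch b) {K - 1} (K - 1) i)"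
      by (rule dependsD[OF ret]) (use e in auto)
    moreover have "\<eta> (branch b, j) = \<eta>' (branch b, j)" if "j < K" for j using e that by auto
    ultimately show "?F b \<eta>'" using F unfolding branch_fails_def by blast
  qed
  have disj: "?S b \<inter> ?S b' = {}" if "b \<noteq> b'" for b b'
  proof -
    have "\<exists>w. fst x = w @ branch b" if "x \<in> ?S b" for x b
      using that by (auto simp: below_def intro: exI[of _ "[]"])
    then show ?thesis using append_branch_eqD that by (metis disjoint_iff)
  qed
  have one: "pr (?F b) \<le> 1 - exp (- T) * (1 - s)" if b: "b < m" for b
  proof -
    have "1 - pr (?F b) = pr (\<lambda>\<eta>. (\<forall>z\<in>{branch b} \<times> {..<K}. \<not> \<eta> z) \<and> \<not> (\<exists>i. returns d K \<eta> n (branch b) {K - 1} (K - 1) i))"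
      unfolding branch_fails_def by (subst pr_not[symmetric]) (intro arg_cong[where f = pr] ext, auto)
    also have "\<dots> = pr (\<lambda>\<eta>. \<forall>z\<in>{branch b} \<times> {..<K}. \<not> \<eta> z) * pr (\<lambda>\<eta>. \<not> (\<exists>i. returns d K \<eta> n (branch b) {K - 1} (K - 1) i))"
      by (rule pr_conj[OF _ depends_not[OF ret], of _ "{branch b} \<times> {..<K}"])
        (auto intro: dependsI dest: below_longer)
    also have "pr (\<lambda>\<eta>. \<forall>z\<in>{branch b} \<times> {..<K}. \<not> \<eta> z) = exp (- T)"
    proof -
      have "{branch b} \<times> {..<K} \<subseteq> idx d K L" using tvb b L by (auto simp: idx_def)
      from pr_none[OF this] show ?thesis using K
        by (simp add: card_cartesian_product flip: exp_of_nat_mult)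
    qed
    finally have e: "1 - pr (?F b) = exp (- T) * pr (\<lambda>\<eta>. \<not> (\<exists>i. returns d K \<eta> n (branch b) {K - 1} (K - 1) i))" .
    have "1 - s \<le> pr (\<lambda>\<eta>. \<not> (\<exists>i. returns d K \<eta> n (branch b) {K - 1} (K - 1) i))"
      unfolding pr_not using bound[OF tvb(1), of b n L "K - 1"] tvb(2) b L K by simp
    then have "exp (- T) * (1 - s) \<le> 1 - pr (?F b)" unfolding e by (intro mult_left_mono) auto
    then show ?thesis by linarith
  qed
  have "pr (\<lambda>\<eta>. \<forall>b\<in>{..<m}. ?F b \<eta>) = (\<Prod>b\<in>{..<m}. pr (?F b))"
    by (rule pr_all[where A = ?S]) (use dep disj in auto)
  also have "\<dots> \<le> (\<Prod>b\<in>{..<m}. 1 - exp (- T) * (1 - s))"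
    by (intro prod_mono conjI pr_nonneg one) simp
  finally show ?thesis by simp
qed

text \<open>Without infinite cycles the first m trials all fail, for every m, once first the depth
  and then the mesh is large. Such eventual events are increasing unions of intersections, so the
  uniform bound on their members passes to the limit, and it tends to 0 as m grows.\<close>

lemma infinite_cycle_of_bound:
  assumes d: "d \<ge> 2" and T: "T > 0" and s: "s < 1"
    and ret: "return_prob_le d T s"
  shows "AE \<omega> in stir_space. has_infinite_cycle d \<omega> T"
proof -
  obtain K0 where bound: "\<forall>K\<ge>K0. \<forall>N n v j. tree_vertex d v \<longrightarrow> length v + n \<le> N \<longrightarrow> j < K \<longrightarrow>
      bernoulli_field.pr (idx d K N) (1 - exp (- T / real K)) (\<lambda>\<eta>. \<exists>i. returns d K \<eta> n v {j} j i) \<le> s"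
    using ret unfolding return_prob_le_def by blast
  obtain M :: nat where M: "real d * T < real M" using reals_Archimedean2 by blast
  have "0 \<le> real d * T" using T by simp
  then have M0: "M > 0" using M by linarith
  let ?\<rho> = "1 - exp (- T) * (1 - s)"
  have tvb: "tree_vertex d (branch b)" for b using d by (auto simp: branch_def tree_vertex_def)
  define Bad where "Bad m N l \<omega> \<longleftrightarrow> (\<forall>b\<in>{..<m}. branch_fails d (M * l) N b (occ (T / real (M * l)) \<omega>))"
    for m N l :: nat and \<omega>
  have Bad: "{\<omega>. Bad m N l \<omega>} \<in> stir.events" "stir.prob {\<omega>. Bad m N l \<omega>} \<le> ?\<rho> ^ m"
    if l: "l > 0" "M * l \<ge> K0" for m N l
  proof -
    let ?K = "M * l"
    have K: "?K > 0" using M0 l by simp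
    let ?E = "\<lambda>\<eta>. \<forall>b\<in>{..<m}. branch_fails d ?K N b \<eta>"
    have dep: "depends ?E (idx d ?K (N + m))"
    proof (rule dependsI)
      fix \<eta> \<eta>' assume e: "\<And>x. x \<in> idx d ?K (N + m) \<Longrightarrow> \<eta> x = \<eta>' x" and E: "?E \<eta>"
      have "\<eta> (branch b, j) = \<eta>' (branch b, j)" if "b < m" "j < ?K" for b j
        using that tvb[of b] by (intro e) (auto simp: idx_def branch_def)
      moreover have "returns d ?K \<eta> N (branch b) P j i = returns d ?K \<eta>' N (branch b) P j i" if "b < m" for b P j i
      proof (rule returns_cong[OF K], rule e)
        fix x assume "x \<in> below d ?K N (branch b)"
        then show "x \<in> idx d ?K (N + m)" using that tvb[of b] by (auto simp: below_def idx_def tree_vertex_def branch_def)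
      qed
      ultimately show "?E \<eta>'" using E unfolding branch_fails_def by (metis lessThan_iff)
    qed
    have h: "T / real ?K > 0" using T K by simp
    show "{\<omega>. Bad m N l \<omega>} \<in> stir.events"
      unfolding Bad_def by (rule occ_event_law(1)[OF finite_idx dep])
    have "stir.prob {\<omega>. Bad m N l \<omega>} = bernoulli_field.pr (idx d ?K (N + m)) (1 - exp (- (T / real ?K))) ?E"
      unfolding Bad_def by (rule occ_event_law(2)[OF finite_idx dep h])
    also have "\<dots> \<le> ?\<rho> ^ m"
      unfolding minus_divide_left by (rule pr_all_branches_return[OF d T K]) (use bound l in blast, rule refl)
    finally show "stir.prob {\<omega>. Bad m N l \<omega>} \<le> ?\<rho> ^ m" .
  qed
  define L where "L = Suc K0"
  have LK: "M * l \<ge> K0" "l > 0" if "l \<ge> L" for l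
  proof -
    have "l \<le> M * l" using M0 by simp
    then show "M * l \<ge> K0" "l > 0" using that unfolding L_def by linarith+
  qed
  have inc: "stir.prob (\<Union>n. A n) \<le> c" if "incseq A" "\<And>n. A n \<in> stir.events" "\<And>n. stir.prob (A n) \<le> c" for A :: "nat \<Rightarrow> _" and c
    by (rule LIMSEQ_le_const2[OF stir.finite_Lim_measure_incseq]) (use that in auto)
  \<comment> \<open>Failure at all depths from \<open>N0\<close> on, at each of them for all fine
    meshes. Taking \<open>l0\<close> from \<open>L\<close> on keeps every mesh in the range where
    \<open>Bad\<close> is an event with the uniform bound.\<close>
  define C where "C m N0 = {\<omega>. \<forall>N\<ge>N0. \<exists>l0\<ge>L. \<forall>l\<ge>l0. Bad m N l \<omega>}" for m N0
  have In: "{\<omega>. \<forall>l\<ge>l0. Bad m N l \<omega>} \<in> stir.events" if "l0 \<ge> L" for m N l0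
  proof -
    have "{\<omega>. \<forall>l\<ge>l0. Bad m N l \<omega>} = (\<Inter>l\<in>{l0..}. {\<omega>. Bad m N l \<omega>})" by auto
    also have "\<dots> \<in> stir.events" using Bad(1) LK that by (intro sets.countable_INT') auto
    finally show ?thesis .
  qed
  let ?EV = "\<lambda>m N. {\<omega>. \<exists>l0\<ge>L. \<forall>l\<ge>l0. Bad m N l \<omega>}"
  have Li: "?EV m N \<in> stir.events" "stir.prob (?EV m N) \<le> ?\<rho> ^ m" for m N
  proof -
    let ?A = "\<lambda>k. {\<omega>. \<forall>l\<ge>L + k. Bad m N l \<omega>}"
    have eq: "?EV m N = (\<Union>k. ?A k)"
      by (auto simp: le_iff_add)
    show "?EV m N \<in> stir.events" unfolding eq using In by auto
    show "stir.prob (?EV m N) \<le> ?\<rho> ^ m" unfolding eq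
    proof (rule inc)
      show "incseq ?A" by (auto simp: incseq_def)
      show "?A k \<in> stir.events" for k by (rule In) simp
      show "stir.prob (?A k) \<le> ?\<rho> ^ m" for k
      proof -
        have "stir.prob (?A k) \<le> stir.prob {\<omega>. Bad m N (L + k) \<omega>}"
          using Bad(1) LK by (intro stir.finite_measure_mono) auto
        also have "\<dots> \<le> ?\<rho> ^ m" using LK by (intro Bad(2)) auto
        finally show ?thesis .
      qed
    qed
  qed
  have Cm: "C m N0 \<in> stir.events" for m N0
  proof -
    have "C m N0 = (\<Inter>N\<in>{N0..}. ?EV m N)" by (auto simp: C_def)
    also have "\<dots> \<in> stir.events" using Li(1) by (intro sets.countable_INT') auto
    finally show ?thesis .
  qed
  have CU: "stir.prob (\<Union>N0. C m N0) \<le> ?\<rho> ^ m" for m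
  proof (rule inc)
    show "incseq (C m)" by (auto simp: incseq_def C_def)
    show "stir.prob (C m N0) \<le> ?\<rho> ^ m" for N0
    proof -
      have "stir.prob (C m N0) \<le> stir.prob (?EV m N0)"
        using Li(1) by (intro stir.finite_measure_mono) (auto simp: C_def)
      also have "\<dots> \<le> ?\<rho> ^ m" by (rule Li(2))
      finally show ?thesis .
    qed
  qed (rule Cm)
  \<comment> \<open>Each trial alone fails eventually, in the depth and then in the mesh; finitely
    many trials are combined by taking maxima of the thresholds.\<close>
  have sub: "\<omega> \<in> (\<Union>N0. C m N0)" if r: "regular d T M \<omega>" and no: "\<not> has_infinite_cycle d \<omega> T" for \<omega> m
  proof -
    let ?G = "\<lambda>b N l. branch_fails d (M * l) N b (occ (T / real (M * l)) \<omega>)"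
    have one: "\<exists>N0. \<forall>N\<ge>N0. \<exists>l0. \<forall>l\<ge>l0. ?G b N l" for b
    proof (cases "occ T \<omega> (branch b, 0)")
      case True
      then obtain n where n: "arrival \<omega> (branch b) n \<in> slot T 0" by (auto simp: occ_def)
      then have t: "0 < arrival \<omega> (branch b) n" "arrival \<omega> (branch b) n \<le> T" by (auto simp: slot_def)
      have "?G b N l" if "l \<ge> 1" for N l
      proof -
        have "M * l > 0" using M0 that by simp
        from ex_slot[OF this T t] show ?thesis by (auto simp: occ_def branch_fails_def)
      qed
      then show ?thesis by blast
    next
      case False
      have "finite (range (\<lambda>n. (stir_perm d \<omega> T ^^ n) (branch b)))"
        using no tvb[of b] unfolding has_infinite_cycle_def by blast
      from returns_of_finite_orbit[OF r T M0 tvb False this] show ?thesis unfolding branch_fails_def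
        by (elim ex_forward all_forward imp_forward) (assumption | rule disjI2)+
    qed
    have "\<exists>N0. \<forall>N\<ge>N0. \<exists>l0\<ge>L. \<forall>l\<ge>l0. Bad m N l \<omega>"
    proof (induction m)
      case 0 then show ?case by (auto simp: Bad_def)
    next
      case (Suc m)
      then obtain N1 where N1: "\<And>N. N \<ge> N1 \<Longrightarrow> \<exists>l0\<ge>L. \<forall>l\<ge>l0. Bad m N l \<omega>" by blast
      obtain N2 where N2: "\<And>N. N \<ge> N2 \<Longrightarrow> \<exists>l0. \<forall>l\<ge>l0. ?G m N l" using one[of m] by blast
      have BS: "Bad (Suc m) N l \<omega> \<longleftrightarrow> ?G m N l \<and> Bad m N l \<omega>" for N l
        unfolding Bad_def lessThan_Suc by blast
      show ?case
      proof (rule exI[of _ "max N1 N2"], intro allI impI)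
        fix N assume "max N1 N2 \<le> N"
        then obtain l1 l2 where l: "l1 \<ge> L" "\<forall>l\<ge>l1. Bad m N l \<omega>" "\<forall>l\<ge>l2. ?G m N l"
          using N1[of N] N2[of N] by auto
        then have "\<forall>l\<ge>max l1 l2. Bad (Suc m) N l \<omega>" unfolding BS by simp
        then show "\<exists>l0\<ge>L. \<forall>l\<ge>l0. Bad (Suc m) N l \<omega>" using l(1) by (intro exI[of _ "max l1 l2"]) auto
      qed
    qed
    then show ?thesis by (auto simp: C_def)
  qed
  have \<rho>: "?\<rho> < 1" using s by simp
  have "AE \<omega> in stir_space. regular d T M \<omega> \<longrightarrow> has_infinite_cycle d \<omega> T"
  proof (rule AE_if_small)
    fix e :: real assume e: "e > 0"
    have "\<exists>m. ?\<rho> ^ m \<le> e"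
    proof (cases "?\<rho> \<ge> 0")
      case True
      then show ?thesis using real_arch_pow_inv[OF e \<rho>] by (auto intro: less_imp_le)
    next
      \<comment> \<open>\<open>s\<close> is bounded only from above here, so the base can be
        negative, and then its first power is already below \<open>e\<close>.\<close>
      case False
      then show ?thesis using e by (intro exI[of _ 1]) simp
    qed
    then obtain m where m: "?\<rho> ^ m \<le> e" by blast
    show "\<exists>A\<in>stir.events. stir.prob A \<le> e \<and> {\<omega>. \<not> (regular d T M \<omega> \<longrightarrow> has_infinite_cycle d \<omega> T)} \<subseteq> A"
      using CU[of m] m Cm sub by (intro bexI[of _ "\<Union>N0. C m N0"]) auto
  qed
  with AE_regular[OF T M] show ?thesis by eventually_elim blast
qed

theorem theorem3:
  shows "\<forall>\<epsilon>::real. \<epsilon> > 0 \<longrightarrow> (\<exists>d0::nat. \<forall>d\<ge>d0.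
     {1 / real d + (7/6 + \<epsilon>) / (real d)^2 ..} \<subseteq> inf_cycle_params d)"
proof (intro allI impI)
  fix \<epsilon> :: real assume \<epsilon>: "\<epsilon> > 0"
  \<comment> \<open>A smaller \<epsilon> enlarges the half-line, so \<epsilon> may be cut down to
    the range that \<open>mean_visited_gt_1\<close> accepts.\<close>
  define e where "e = min \<epsilon> 1"
  have e: "0 < e" "e \<le> 1" "e \<le> \<epsilon>" using \<epsilon> by (auto simp: e_def)
  \<comment> \<open>10^6 is the threshold of the many-bar bound, and 1000 / e yields d e \<ge> 1000
    for the few-bar mean.\<close>
  define d0 where "d0 = max (10 ^ 6) (nat \<lceil>1000 / e\<rceil>)"
  show "\<exists>d0::nat. \<forall>d\<ge>d0. {1 / real d + (7/6 + \<epsilon>) / (real d)^2 ..} \<subseteq> inf_cycle_params d"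
  proof (rule exI[of _ d0], intro allI impI subsetI)
    fix d T assume d: "d0 \<le> d" and "T \<in> {1 / real d + (7/6 + \<epsilon>) / (real d)^2 ..}"
    then have T: "1 / real d + (7/6 + \<epsilon>) / (real d)\<^sup>2 \<le> T" by simp
    have d6: "d \<ge> 10 ^ 6" and "1000 / e \<le> real d" using d unfolding d0_def by linarith+
    then have de: "real d * e \<ge> 1000" using e by (simp add: field_simps)
    have dr: "real d \<ge> 1000" using d6 by simp
    have "1 / real d + (7/6 + e) / (real d)\<^sup>2 \<le> 1 / real d + (7/6 + \<epsilon>) / (real d)\<^sup>2"
      using e by (intro add_left_mono divide_right_mono) auto
    then have Te: "1 / real d + (7/6 + e) / (real d)\<^sup>2 \<le> T" using T by linarith
    have "0 < 1 / real d" "0 \<le> (7/6 + e) / (real d)\<^sup>2" using dr e by auto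
    then have T0: "T > 0" using Te by linarith
    have "\<exists>s<1. return_prob_le d T s"
    proof (cases "T * sqrt (real d) \<le> 1")
      case True
      show ?thesis
        using dr by (intro returns_bound_few_bars[OF T0] mean_visited_gt_1[OF e(1,2) dr de Te True]) simp
    next
      case False
      then show ?thesis by (intro returns_bound_many_bars[OF d6]) simp
    qed
    then have "AE \<omega> in stir_space. has_infinite_cycle d \<omega> T"
      using dr infinite_cycle_of_bound[OF _ T0] by fastforce
    then show "T \<in> inf_cycle_params d" using T0 by (simp add: inf_cycle_params_def)
  qed
qed

end
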